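(* Let $k\ge 1$, let $Z$ be a finite set of pairwise different points in $\check{\mathbb{P}}^2$, let $P$ be a general point of $\check{\mathbb{P}}^2$, let $f$ be the product of the linear forms defining the lines dual to the points of $Z$, and let $L\subset\mathbb{P}^2$ be the (generic) line dual to $P$. Let $\mathcal{S}$ be the (rank $k+1$) bundle of syzygies of $(J/f)^k(|Z|-1)$, and let $(a_1,a_2,\dots,a_{k+1})$ be its splitting type on $L$, i.e. $\mathcal{S}|_L\cong\mathcal{O}_L(-a_1)\oplus\dots\oplus\mathcal{O}_L(-a_{k+1})$. Then, for each integer $j\ge 0$, $$\dim[I_{Z+jP}]_{j+k}=\max\{0,j-a_1+1\}+\dots+\max\{0,j-a_{k+1}+1\}.$$
   Context: $S=\mathbb{C}[x,y,z]$; $\check{\mathbb{P}}^2$ is the projective plane dual to $\mathbb{P}^2$; $J=(f_x,f_y,f_z)$ is the Jacobian ideal of $f$. $I_{Z+jP}$ is the homogeneous ideal of forms (on $\check{\mathbb{P}}^2$) vanishing at every point of $Z$ and vanishing to order at least $j$ at $P$; for a homogeneous ideal $I$, $[I]_t$ is the vector space of forms of degree $t$ in $I$. Bundle of syzygies. Let $\mathrm{Der}^k(S)\cong S^{\binom{k+2}{2}}$ be the free $S$-module on the formal products $\partial_x^{i_1}\partial_y^{i_2}\partial_z^{i_3}$, $i_1+i_2+i_3=k$ (products of first-order derivations, not higher-order derivatives), graded by the degree of the coefficients. Let $D^k(\mathcal{A})$ be the kernel of the map $\phi:S^{\binom{k+2}{2}}\to(J/f)^k(|Z|-1)$, $\phi\big((g_{i_1,i_2,i_3})\big)=\sum_{i_1+i_2+i_3=k}g_{i_1,i_2,i_3}f_x^{i_1}f_y^{i_2}f_z^{i_3}\pmod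 f$ (the twist is such that $\phi$ is a degree-preserving surjection; $(J/f)^k$ is the $k$-th power of the ideal $J/fS$ of $S/fS$). For each of the $\binom{k+1}{2}$ triples with $i_1+i_2+i_3=k-1$ there is an Euler-type element $E=(x\partial_x+y\partial_y+z\partial_z)\cdot\partial_x^{i_1}\partial_y^{i_2}\partial_z^{i_3}\in D^k(\mathcal{A})$; list them as $E_1,\dots,E_{\binom{k+1}{2}}$. Put $D^k_0(\mathcal{A})=D^k(\mathcal{A})/(SE_1\oplus\dots\oplus SE_{\binom{k+1}{2}})$. The rank $k+1$ bundle $\mathcal{S}$ of syzygies of $(J/f)^k(|Z|-1)$ is the sheafification on $\mathbb{P}^2$ of $D_0^k(\mathcal{A})$. *)

theory Defs
  imports "HOL-Analysis.Analysis" "HOL-Library.Poly_Mapping"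
begin

section \<open>Polynomials in three variables\<close>

type_synonym mono3 = "3 \<Rightarrow>\<^sub>0 nat"
type_synonym 'a tripoly = "mono3 \<Rightarrow>\<^sub>0 'a"
type_synonym poly3 = "complex tripoly"

text \<open>With exponent vectors of type \<^typ>\<open>mono3\<close>, the convolution product of
  \<^theory>\<open>HOL-Library.Poly_Mapping\<close> makes \<^typ>\<open>'a tripoly\<close> the polynomial ring
  in three variables over \<open>'a\<close>; \<open>S\<close> is \<^typ>\<open>poly3\<close>.\<close>

definition mdeg :: "mono3 \<Rightarrow> nat" where
  "mdeg m = (\<Sum>i\<in>UNIV. Poly_Mapping.lookup m i)"

definition Var :: "3 \<Rightarrow> 'a::comm_ring_1 tripoly" where
  "Var i = Poly_Mapping.single (Poly_Mapping.single i 1) 1"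

definition cmul :: "'a::comm_ring_1 \<Rightarrow> 'a tripoly \<Rightarrow> 'a tripoly" where
  "cmul c p = Poly_Mapping.single 0 c * p"

definition peval :: "(3 \<Rightarrow> 'a::comm_ring_1) \<Rightarrow> 'a tripoly \<Rightarrow> 'a" where
  "peval v p = (\<Sum>m\<in>Poly_Mapping.keys p.
     Poly_Mapping.lookup p m * (\<Prod>i\<in>UNIV. v i ^ Poly_Mapping.lookup m i))"

definition pdiff :: "3 \<Rightarrow> 'a::comm_ring_1 tripoly \<Rightarrow> 'a tripoly" where
  "pdiff i p = (\<Sum>m\<in>Poly_Mapping.keys p.
     Poly_Mapping.single (m - Poly_Mapping.single i 1)
       (of_nat (Poly_Mapping.lookup m i) * Poly_Mapping.lookup p m))"

text \<open>Homogeneous polynomials of degree \<open>d\<close>, including \<open>0\<close>; there is only \<open>0\<close> for \<open>d < 0\<close>.\<close>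

definition forms :: "int \<Rightarrow> 'a::comm_ring_1 tripoly set" where
  "forms d = {p. \<forall>m\<in>Poly_Mapping.keys p. int (mdeg m) = d}"

lemma module_cmul: "module (cmul :: 'a::comm_ring_1 \<Rightarrow> 'a tripoly \<Rightarrow> 'a tripoly)"
  by unfold_locales (simp_all add: cmul_def algebra_simps single_add mult_single)

lemma vector_space_cmul: "vector_space (cmul :: complex \<Rightarrow> poly3 \<Rightarrow> poly3)"
  by unfold_locales (simp_all add: cmul_def algebra_simps single_add mult_single)


section \<open>The projective plane\<close>

definition proj_rel :: "complex ^ 3 \<Rightarrow> complex ^ 3 \<Rightarrow> bool" where
  "proj_rel v w \<longleftrightarrow> v \<noteq> 0 \<and> (\<exists>c. c \<noteq> 0 \<and> w = c *s v)"

text \<open>Both the plane and its dual are modelled by \<open>proj2\<close>, using dual coordinates: the point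
  \<open>(a\<^sub>1 : a\<^sub>2 : a\<^sub>3)\<close> of the dual plane is the line \<open>a\<^sub>1 x + a\<^sub>2 y + a\<^sub>3 z = 0\<close>. The function
  \<open>rep_proj2\<close> chooses a nonzero vector of homogeneous coordinates; all conditions
  below do not depend on that choice.\<close>

quotient_type proj2 = "complex ^ 3" / partial: proj_rel
proof (rule part_equivpI)
  show "\<exists>v. proj_rel v v"
    by (rule exI[of _ "axis 1 1"]) (auto simp: proj_rel_def axis_eq_0_iff intro!: exI[of _ 1])
  show "symp proj_rel"
  proof (rule sympI)
    fix v w assume "proj_rel v w"
    then obtain c where "v \<noteq> 0" "c \<noteq> 0" "w = c *s v" by (auto simp: proj_rel_def)
    then show "proj_rel w v"
      by (auto simp: proj_rel_def intro!: exI[of _ "inverse c"])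
  qed
  show "transp proj_rel"
  proof (rule transpI)
    fix u v w assume "proj_rel u v" "proj_rel v w"
    then obtain c d where "u \<noteq> 0" "c \<noteq> 0" "v = c *s u" "d \<noteq> 0" "w = d *s v"
      by (auto simp: proj_rel_def)
    then show "proj_rel u w"
      by (auto simp: proj_rel_def intro!: exI[of _ "d * c"])
  qed
qed

definition ev :: "poly3 \<Rightarrow> proj2 \<Rightarrow> complex" where
  "ev p x = peval (($) (rep_proj2 x)) p"

definition zariski_open :: "proj2 set \<Rightarrow> bool" where
  "zariski_open U \<longleftrightarrow>
     (\<exists>T. (\<forall>h\<in>T. \<exists>d. h \<in> forms d) \<and> U = {x. \<exists>h\<in>T. ev h x \<noteq> 0})"

definition dual_form :: "proj2 \<Rightarrow> poly3" where
  "dual_form Q = (\<Sum>i\<in>UNIV. cmul (rep_proj2 Q $ i) (Var i))"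

definition dual_line :: "proj2 \<Rightarrow> proj2 set" where
  "dual_line Q = {x. ev (dual_form Q) x = 0}"


section \<open>The ideal of \<open>Z + jP\<close>\<close>

definition vanishes_to_order :: "nat \<Rightarrow> proj2 \<Rightarrow> poly3 \<Rightarrow> bool" where
  "vanishes_to_order j P F \<longleftrightarrow>
     (\<forall>is. length is < j \<longrightarrow> ev (fold pdiff is F) P = 0)"

text \<open>The graded piece \<open>[I\<^bsub>Z+jP\<^esub>]\<^sub>t\<close>.\<close>

definition fat_forms :: "proj2 set \<Rightarrow> nat \<Rightarrow> proj2 \<Rightarrow> int \<Rightarrow> poly3 set" where
  "fat_forms Z j P t = {F \<in> forms t. (\<forall>Q\<in>Z. ev F Q = 0) \<and> vanishes_to_order j P F}"


section \<open>Graded modules, sheafification and restriction to a line\<close>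

text \<open>A graded \<open>S\<close>-module is given as a subquotient of an ambient \<open>S\<close>-module with
  multiplication \<open>scl\<close>: the elements of degree \<open>d\<close> are represented by those of \<open>hom d\<close>,
  and two of them represent the same element iff their difference is in \<open>den\<close>.\<close>

record 'm gmod =
  den :: "'m set"
  hom :: "int \<Rightarrow> 'm set"
  scl :: "poly3 \<Rightarrow> 'm \<Rightarrow> 'm"

text \<open>The stalk at \<open>x\<close> of the sheaf associated to \<open>M\<close> on the plane is the degree-zero part
  \<open>M\<^sub>(\<^sub>x\<^sub>)\<close> of the localisation of \<open>M\<close> at \<open>x\<close>; its elements \<open>m/g\<close> are represented by
  the pairs in \<open>fracs M x\<close>, and \<open>frac_eq\<close> is equality in \<open>M\<^sub>(\<^sub>x\<^sub>)\<close>.\<close>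

definition fracs :: "'m gmod \<Rightarrow> proj2 \<Rightarrow> ('m \<times> poly3) set" where
  "fracs M x = {(m, g). \<exists>d. m \<in> hom M d \<and> g \<in> forms d \<and> ev g x \<noteq> 0}"

definition frac_eq ::
    "'m::ab_group_add gmod \<Rightarrow> proj2 \<Rightarrow> 'm \<times> poly3 \<Rightarrow> 'm \<times> poly3 \<Rightarrow> bool" where
  "frac_eq M x = (\<lambda>(m, g) (m', g').
     \<exists>d h. h \<in> forms d \<and> ev h x \<noteq> 0 \<and> scl M h (scl M g' m - scl M g m') \<in> den M)"

text \<open>The stalk at \<open>x \<in> L\<close> of the restriction to the line \<open>L = {l = 0}\<close> is
  \<open>M\<^sub>(\<^sub>x\<^sub>) / I\<^sub>L\<^sub>,\<^sub>x M\<^sub>(\<^sub>x\<^sub>)\<close>, where \<open>I\<^sub>L\<^sub>,\<^sub>x M\<^sub>(\<^sub>x\<^sub>)\<close> is the set of all \<open>l a / h\<close> with \<open>a\<close>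
  homogeneous of degree \<open>deg h - 1\<close>. The relation \<open>restr_eq\<close> says that the difference
  of two fractions lies in this submodule; the stalk elements are its classes \<open>germ\<close>.\<close>

definition restr_eq ::
    "'m::ab_group_add gmod \<Rightarrow> poly3 \<Rightarrow> proj2 \<Rightarrow> 'm \<times> poly3 \<Rightarrow> 'm \<times> poly3 \<Rightarrow> bool" where
  "restr_eq M l x = (\<lambda>(m, g) (m', g').
     \<exists>d a h. a \<in> hom M (d - 1) \<and> h \<in> forms d \<and> ev h x \<noteq> 0 \<and>
       frac_eq M x (scl M g' m - scl M g m', g * g') (scl M l a, h))"

definition germ ::
    "'m::ab_group_add gmod \<Rightarrow> poly3 \<Rightarrow> proj2 \<Rightarrow> 'm \<times> poly3 \<Rightarrow> ('m \<times> poly3) set" where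
  "germ M l x u = {w \<in> fracs M x. restr_eq M l x u w}"

definition germ_add where
  "germ_add M l x A B =
     {w. \<exists>(m, g)\<in>A. \<exists>(m', g')\<in>B. w \<in> germ M l x (scl M g' m + scl M g m', g * g')}"

definition germ_scl where
  "germ_scl M l x C A =
     {w. \<exists>(u, v)\<in>C. \<exists>(m, g)\<in>A. w \<in> germ M l x (scl M u m, v * g)}"

definition open_in_line :: "proj2 \<Rightarrow> proj2 set \<Rightarrow> bool" where
  "open_in_line P V \<longleftrightarrow> (\<exists>U. zariski_open U \<and> V = dual_line P \<inter> U)"

text \<open>Sections are functions to the stalks which are locally a fraction \<open>m/g\<close>; they take
  the dummy value \<open>{}\<close> outside of their domain.\<close>

definition sections_on ::
    "'m::ab_group_add gmod \<Rightarrow> proj2 \<Rightarrow> proj2 set \<Rightarrow> (proj2 \<Rightarrow> ('m \<times> poly3) set) set" where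
  "sections_on M P V = {s. (\<forall>x. x \<notin> V \<longrightarrow> s x = {}) \<and>
     (\<forall>x\<in>V. \<exists>W m g d. zariski_open W \<and> x \<in> W \<and> m \<in> hom M d \<and> g \<in> forms d \<and>
        (\<forall>y\<in>W \<inter> V. ev g y \<noteq> 0 \<and> s y = germ M (dual_form P) y (m, g)))}"

definition twist :: "int \<Rightarrow> poly3 gmod" where
  "twist n = \<lparr>den = {0}, hom = (\<lambda>d. forms (d + n)), scl = (*)\<rparr>"

text \<open>As \<open>twist n\<close> is \<open>S(n)\<close>, the sections of the structure sheaf of the line are \<open>sections_on (twist 0) P V\<close>.
  A sheaf of modules over it is given by its sections on the open sets of the line, the
  restriction to a smaller open set, and the module operations.\<close>

type_synonym osection = "proj2 \<Rightarrow> (poly3 \<times> poly3) set"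

record 's osheaf =
  sec :: "proj2 set \<Rightarrow> 's set"
  res :: "proj2 set \<Rightarrow> 's \<Rightarrow> 's"
  sadd :: "'s \<Rightarrow> 's \<Rightarrow> 's"
  sscl :: "osection \<Rightarrow> 's \<Rightarrow> 's"

definition sheaf_on_line ::
    "'m::ab_group_add gmod \<Rightarrow> proj2 \<Rightarrow> (proj2 \<Rightarrow> ('m \<times> poly3) set) osheaf" where
  "sheaf_on_line M P =
     \<lparr>sec = sections_on M P,
      res = (\<lambda>V s x. if x \<in> V then s x else {}),
      sadd = (\<lambda>s t x. germ_add M (dual_form P) x (s x) (t x)),
      sscl = (\<lambda>c s x. germ_scl M (dual_form P) x (c x) (s x))\<rparr>"

definition line_bundle :: "proj2 \<Rightarrow> int \<Rightarrow> osection osheaf" where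
  "line_bundle P n = sheaf_on_line (twist n) P"

definition direct_sum :: "nat \<Rightarrow> (nat \<Rightarrow> 's osheaf) \<Rightarrow> (nat \<Rightarrow> 's) osheaf" where
  "direct_sum n F =
     \<lparr>sec = (\<lambda>V. \<Pi>\<^sub>E i\<in>{..<n}. sec (F i) V),
      res = (\<lambda>V s. \<lambda>i\<in>{..<n}. res (F i) V (s i)),
      sadd = (\<lambda>s t. \<lambda>i\<in>{..<n}. sadd (F i) (s i) (t i)),
      sscl = (\<lambda>c s. \<lambda>i\<in>{..<n}. sscl (F i) c (s i))\<rparr>"

definition sheaf_iso :: "proj2 \<Rightarrow> 's osheaf \<Rightarrow> 't osheaf \<Rightarrow> bool" where
  "sheaf_iso P F G \<longleftrightarrow> (\<exists>\<phi>. \<forall>V. open_in_line P V \<longrightarrow>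
     bij_betw (\<phi> V) (sec F V) (sec G V) \<and>
     (\<forall>s\<in>sec F V. \<forall>t\<in>sec F V. \<phi> V (sadd F s t) = sadd G (\<phi> V s) (\<phi> V t)) \<and>
     (\<forall>c\<in>sections_on (twist 0) P V. \<forall>s\<in>sec F V. \<phi> V (sscl F c s) = sscl G c (\<phi> V s)) \<and>
     (\<forall>V'. open_in_line P V' \<and> V' \<subseteq> V \<longrightarrow>
        (\<forall>s\<in>sec F V. \<phi> V' (res F V' s) = res G V' (\<phi> V s))))"


section \<open>The bundle of syzygies\<close>

definition arr_poly :: "proj2 set \<Rightarrow> poly3" where
  "arr_poly Z = (\<Prod>Q\<in>Z. dual_form Q)"

text \<open>The elements of \<open>Der\<^sup>k(S)\<close> are the elements of \<open>S[\<partial>\<^sub>x, \<partial>\<^sub>y, \<partial>\<^sub>z]\<close> that are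
  homogeneous of degree \<open>k\<close> in the \<open>\<partial>\<close>'s, whence the type \<^typ>\<open>poly3 tripoly\<close>: its
  exponent vectors are those of the \<open>\<partial>\<close>'s.\<close>

definition Der :: "nat \<Rightarrow> poly3 tripoly set" where
  "Der k = forms (int k)"

definition syz_map :: "poly3 \<Rightarrow> poly3 tripoly \<Rightarrow> poly3" where
  "syz_map f \<theta> = peval (\<lambda>i. pdiff i f) \<theta>"

definition syz :: "proj2 set \<Rightarrow> nat \<Rightarrow> poly3 tripoly set" where
  "syz Z k = {\<theta> \<in> Der k. arr_poly Z dvd syz_map (arr_poly Z) \<theta>}"

text \<open>In \<open>cmul (Var i) (Var i)\<close> the scalar is \<open>x\<^sub>i\<close> and the second factor is \<open>\<partial>\<^sub>i\<close>.\<close>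

definition euler :: "poly3 tripoly" where
  "euler = (\<Sum>i\<in>UNIV. cmul (Var i) (Var i))"

definition euler_submodule :: "nat \<Rightarrow> poly3 tripoly set" where
  "euler_submodule k =
     module.span cmul {euler * Poly_Mapping.single m 1 | m. mdeg m + 1 = k}"

text \<open>\<open>D\<^sub>0\<^sup>k(\<A>)\<close>, graded by the degree of the coefficients.\<close>

definition D0 :: "proj2 set \<Rightarrow> nat \<Rightarrow> poly3 tripoly gmod" where
  "D0 Z k =
     \<lparr>den = euler_submodule k,
      hom = (\<lambda>d. {\<theta> \<in> syz Z k. \<forall>m. Poly_Mapping.lookup \<theta> m \<in> forms d}),
      scl = cmul\<rparr>"

definition splitting_type :: "proj2 set \<Rightarrow> nat \<Rightarrow> proj2 \<Rightarrow> (nat \<Rightarrow> int) \<Rightarrow> bool" where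
  "splitting_type Z k P a \<longleftrightarrow>
     sheaf_iso P (sheaf_on_line (D0 Z k) P) (direct_sum (k + 1) (\<lambda>i. line_bundle P (- a i)))"

end

theory Submission
  imports Defs "HOL-Computational_Algebra.Fraction_Field"
    "HOL-Computational_Algebra.Fundamental_Theorem_Algebra"
begin

text \<open>
  Fix coordinates \<open>p\<close> of \<open>P\<close>, so that \<open>L\<close> is the line \<open>p \<cdot> x = 0\<close>. For \<open>x\<close> on \<open>L\<close> the points \<open>y\<close> of the
  dual plane with \<open>y \<cdot> x = 0\<close> form a line through \<open>P\<close>, and every line through \<open>P\<close> arises from exactly
  one \<open>x\<close>. An element \<open>\<theta>\<close> of \<open>D\<^sup>k\<close> with coefficients of degree \<open>d\<close>, read at a point \<open>x\<close>, is a form of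
  degree \<open>k\<close> in the variables \<open>\<partial>\<close>, that is, on the dual plane; to divide by the Euler elements
  \<open>(x \<cdot> \<partial>) \<eta>\<close> is to restrict this form to the line \<open>x \<cdot> \<partial> = 0\<close>. At a point \<open>x\<close> of the line dual to
  \<open>Q \<in> Z\<close> which lies on no other line of the arrangement, the gradient of \<open>f\<close> is a nonzero multiple of
  \<open>Q\<close>, and \<open>f | \<theta>(\<nabla>f)\<close> says that the form vanishes at \<open>Q\<close>. As \<open>P\<close> is general, \<open>L\<close> misses the points
  that lie on two of the lines. So a global section of \<open>\<S>|\<^sub>L(j)\<close> is a family of forms of degree \<open>k\<close> on
  the lines through \<open>P\<close>, of degree \<open>j\<close> in \<open>x\<close>, which vanishes at the points of \<open>Z\<close>.

  A form \<open>F\<close> of degree \<open>j + k\<close> that vanishes to order \<open>j\<close> at \<open>P\<close> gives such a family: on a line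
  through \<open>P\<close> it is the \<open>j\<close>-th power of an equation of \<open>P\<close> times a form of degree \<open>k\<close>. Conversely each
  family comes from one \<open>F\<close>. Hence \<open>[I\<^bsub>Z+jP\<^esub>]\<^bsub>j+k\<^esub>\<close> is \<open>H\<^sup>0(L, \<S>|\<^sub>L(j))\<close>, and the splitting of \<open>\<S>|\<^sub>L\<close>
  turns its dimension into the sum of the dimensions of the \<open>H\<^sup>0(L, \<O>(j - a\<^sub>i))\<close>.

  To make this computable, assume \<open>p\<^sub>3 \<noteq> 0\<close> and use three variables \<open>t\<^sub>1, t\<^sub>2, s\<close>, namely \<open>Var 1\<close>,
  \<open>Var 2\<close> and \<open>Var 3\<close>. The line is parametrised by \<open>X(t) = (t\<^sub>1, t\<^sub>2, - (p\<^sub>1 t\<^sub>1 + p\<^sub>2 t\<^sub>2) / p\<^sub>3)\<close> and the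
  dual plane by \<open>Y(t, s) = s p + (- t\<^sub>2, t\<^sub>1, 0)\<close>, where \<open>Y(t, s) \<cdot> X(t) = 0\<close> and \<open>Y(0, s)\<close> is \<open>P\<close>. Then
  \<open>\<theta>(X(t); Y(t, s))\<close> is a polynomial in \<open>t\<^sub>1, t\<^sub>2, s\<close>, and the following steps carry the proof.

  \<^item> A graded module whose elements are faithfully represented on \<open>L\<close> by such polynomials (locale
    \<open>realization\<close>) has, as sections of its restriction to \<open>L\<close>, elements of the field of fractions of
    the polynomial ring (lemma \<open>sections_on_eq\<close>); sums and products of germs become sums and products
    of fractions. This covers \<open>\<O>(n)\<close> (\<open>realization_twist\<close>) and \<open>\<S>\<close> (\<open>realization_D0\<close>).

  \<^item> A global section of the \<open>j\<close>-th twist is a polynomial \<open>G\<close> such that \<open>G / t\<^sub>1\<^sup>j\<close> and \<open>G / t\<^sub>2\<^sup>j\<close> are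
    sections over the two charts of \<open>L\<close> (\<open>global_twisted_section\<close>). For \<open>\<O>(n)\<close> these are the forms of
    degree \<open>j + n\<close> in \<open>t\<^sub>1, t\<^sub>2\<close> (\<open>twisted_sections_twist\<close>); for \<open>\<S>\<close> they are the forms of degree \<open>j + k\<close>
    that have degree at most \<open>k\<close> in \<open>s\<close> and vanish at \<open>Z\<close> (\<open>twisted_sections_D0\<close>).

  \<^item> The substitution \<open>y = Y(t, s)\<close> identifies the latter with \<open>[I\<^bsub>Z+jP\<^esub>]\<^bsub>j+k\<^esub>\<close> (\<open>fat_forms_iff\<close>).

  \<^item> An isomorphism of sheaves preserves the gluing condition on the two charts, so it induces a linear
    bijection between the twisted sections (\<open>iso_on_twisted_sections\<close>), and the monomials are counted
    (\<open>dim_fat_forms\<close>).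
\<close>

section \<open>Polynomials and their evaluations\<close>

abbreviation "lookup \<equiv> Poly_Mapping.lookup"
abbreviation "keys \<equiv> Poly_Mapping.keys"
abbreviation "single \<equiv> Poly_Mapping.single"

abbreviation cst :: "'a::zero \<Rightarrow> 'b::zero \<Rightarrow>\<^sub>0 'a" where
  "cst \<equiv> single 0"

locale ring_map =
  fixes c :: "'a::comm_ring_1 \<Rightarrow> 'b::comm_ring_1"
  assumes add: "c (a + b) = c a + c b"
    and mult: "c (a * b) = c a * c b"
    and one: "c 1 = 1"
begin

lemma zero: "c 0 = 0"
  using add[of 0 0] by simp

lemma diff: "c (a - b) = c a - c b"
  using add[of "a - b" b] by simp

lemma sum: "c (sum f A) = (\<Sum>a\<in>A. c (f a))"
  by (induction A rule: infinite_finite_induct) (simp_all add: add zero)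

lemma prod: "c (prod f A) = (\<Prod>a\<in>A. c (f a))"
  by (induction A rule: infinite_finite_induct) (simp_all add: mult one)

lemma power: "c (a ^ n) = c a ^ n"
  by (induction n) (simp_all add: mult one)

end

lemma ring_map_id: "ring_map (\<lambda>a. a)"
  by unfold_locales simp_all

lemma ring_map_comp: "ring_map c \<Longrightarrow> ring_map d \<Longrightarrow> ring_map (\<lambda>a. d (c a))"
  by (simp add: ring_map_def)

lemma ring_map_cst:
  "ring_map (cst :: 'a::comm_ring_1 \<Rightarrow> 'a tripoly)"
  by unfold_locales (simp_all add: single_add mult_single)

text \<open>The homomorphism which is \<open>c\<close> on the coefficients and maps the \<open>i\<close>-th variable to \<open>w i\<close>. Evaluation at
  a point, linear change of coordinates, restriction to a line, and the mixed evaluations of elements of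
  \<open>S[\<partial>\<^sub>x, \<partial>\<^sub>y, \<partial>\<^sub>z]\<close> are all of this form, so that they share the rules for sums, products and
  composition.\<close>
definition hsub ::
  "('a::comm_ring_1 \<Rightarrow> 'b::comm_ring_1) \<Rightarrow> (3 \<Rightarrow> 'b) \<Rightarrow> 'a tripoly \<Rightarrow> 'b" where
  "hsub c w p = (\<Sum>m\<in>keys p.
     c (lookup p m) * (\<Prod>i\<in>UNIV. w i ^ lookup m i))"

lemma peval_eq_hsub: "peval v = hsub (\<lambda>a. a) v"
  by (simp add: fun_eq_iff peval_def hsub_def)

lemma monomial_expansion:
  "p = (\<Sum>m\<in>keys p. single m (lookup p m))"
  by (rule poly_mapping_eqI)
     (simp add: lookup_sum lookup_single when_def in_keys_iff if_distrib sum.delta' cong: if_cong)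

lemma tripoly_induct [case_names single add]:
  fixes p :: "'a::comm_ring_1 tripoly"
  assumes "\<And>m a. R (single m a)" "\<And>p q. R p \<Longrightarrow> R q \<Longrightarrow> R (p + q)"
  shows "R p"
proof -
  have "R (\<Sum>m\<in>A. single m (lookup p m))" if "finite A" for A
    using that by (induction A) (use assms assms(1)[of 0 0] in auto)
  from this[OF finite_keys[of p]] show ?thesis
    by (simp flip: monomial_expansion)
qed

context ring_map
begin

lemma hsub_superset:
  assumes "finite A" "keys p \<subseteq> A"
  shows "hsub c w p = (\<Sum>m\<in>A.
     c (lookup p m) * (\<Prod>i\<in>UNIV. w i ^ lookup m i))"
  unfolding hsub_def
  by (rule sum.mono_neutral_left[OF assms]) (auto simp: in_keys_iff zero)

lemma hsub_add: "hsub c w (p + q) = hsub c w p + hsub c w q"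
proof -
  let ?A = "keys p \<union> keys q"
  have "finite ?A" "keys (p + q) \<subseteq> ?A"
    by (simp_all add: keys_add)
  then show ?thesis
    by (simp add: hsub_superset[of ?A] lookup_add add distrib_right sum.distrib)
qed

lemma hsub_single:
  "hsub c w (single m a) = c a * (\<Prod>i\<in>UNIV. w i ^ lookup m i)"
  by (subst hsub_superset[of "{m}"]) auto

lemma hsub_cst: "hsub c w (cst a) = c a"
  by (simp add: hsub_single)

lemma hsub_zero: "hsub c w 0 = 0"
  by (simp add: hsub_def)

lemma hsub_mult: "hsub c w (p * q) = hsub c w p * hsub c w q"
proof (induction p rule: tripoly_induct)
  case (single m a)
  show ?case
  proof (induction q rule: tripoly_induct)
    case (single n b)
    show ?case
      by (simp add: mult_single hsub_single lookup_add power_add prod.distrib mult algebra_simps)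
  qed (simp add: hsub_add distrib_left)
qed (simp add: hsub_add distrib_right)

lemma ring_map_hsub: "ring_map (hsub c w)"
  by unfold_locales
     (simp_all add: hsub_add hsub_mult hsub_cst one flip: single_one)

lemma hsub_Var: "hsub c w (Var i) = w i"
proof -
  have "(\<Prod>j\<in>UNIV. w j ^ lookup (single i 1) j)
      = (\<Prod>j\<in>UNIV. if j = i then w j else 1)"
    by (intro prod.cong) (auto simp: lookup_single when_def)
  then show ?thesis
    by (simp add: Var_def hsub_single one)
qed

lemma hsub_cmul: "hsub c w (cmul a p) = c a * hsub c w p"
  by (simp add: cmul_def hsub_mult hsub_cst)

text \<open>Two substitutions that agree modulo \<open>d\<close> give results that agree modulo \<open>d\<close>. This is how
  divisibility by a linear form, and later by the Euler element, is obtained.\<close>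
lemma hsub_congruent:
  assumes "\<And>i. d dvd v i - w i"
  shows "d dvd hsub c v p - hsub c w p"
proof (induction p rule: tripoly_induct)
  case (single m a)
  have pow: "d dvd v i ^ n - w i ^ n" for i n
  proof (induction n)
    case (Suc n)
    have "v i ^ Suc n - w i ^ Suc n = v i * (v i ^ n - w i ^ n) + (v i - w i) * w i ^ n"
      by (simp add: algebra_simps)
    then show ?case
      using Suc assms[of i] by simp
  qed simp
  have "d dvd (\<Prod>i\<in>A. v i ^ lookup m i) - (\<Prod>i\<in>A. w i ^ lookup m i)"
    if "finite A" for A
    using that
  proof (induction A)
    case (insert i A)
    let ?v = "\<lambda>i. v i ^ lookup m i" and ?w = "\<lambda>i. w i ^ lookup m i"
    have "prod ?v (insert i A) - prod ?w (insert i A)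
        = ?v i * (prod ?v A - prod ?w A) + (?v i - ?w i) * prod ?w A"
      using insert.hyps by (simp add: algebra_simps)
    then show ?case
      using insert.IH pow[of i] by simp
  qed simp
  from this[of UNIV] have "d dvd c a * ((\<Prod>i\<in>UNIV. v i ^ lookup m i)
      - (\<Prod>i\<in>UNIV. w i ^ lookup m i))"
    by simp
  then show ?case
    by (simp add: hsub_single right_diff_distrib)
next
  case (add p q)
  have "hsub c v (p + q) - hsub c w (p + q)
      = (hsub c v p - hsub c w p) + (hsub c v q - hsub c w q)"
    by (simp add: hsub_add)
  then show ?case
    using add by simp
qed

end

lemma hsub_comp:
  assumes "ring_map g"
  shows "g (hsub c w p) = hsub (\<lambda>a. g (c a)) (\<lambda>i. g (w i)) p"
proof -
  interpret ring_map g by fact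
  show ?thesis
    by (simp add: hsub_def sum mult prod power)
qed

lemma hsub_hsub:
  assumes "ring_map c" "ring_map g"
  shows "hsub g v (hsub c w p) = hsub (\<lambda>a. hsub g v (c a)) (\<lambda>i. hsub g v (w i)) p"
  by (intro hsub_comp ring_map.ring_map_hsub assms)

lemma ring_map_peval: "ring_map (peval v)"
  by (simp add: peval_eq_hsub ring_map.ring_map_hsub ring_map_id)

lemma peval_hsub_cst: "peval v (hsub cst w p) = peval (\<lambda>i. peval v (w i)) p"
  by (simp add: peval_eq_hsub hsub_hsub ring_map_cst ring_map_id ring_map.hsub_cst)

lemma peval_Var: "peval v (Var i) = v i"
  by (simp add: peval_eq_hsub ring_map.hsub_Var ring_map_id)

lemma peval_cst: "peval v (cst a) = a"
  by (simp add: peval_eq_hsub ring_map.hsub_cst ring_map_id)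

lemma peval_cmul: "peval v (cmul a p) = a * peval v p"
  by (simp add: peval_eq_hsub ring_map.hsub_cmul ring_map_id)

lemmas peval_add = ring_map.add[OF ring_map_peval]
  and peval_mult = ring_map.mult[OF ring_map_peval]
  and peval_diff = ring_map.diff[OF ring_map_peval]
  and peval_zero = ring_map.zero[OF ring_map_peval]
  and peval_one = ring_map.one[OF ring_map_peval]
  and peval_sum = ring_map.sum[OF ring_map_peval]
  and peval_prod = ring_map.prod[OF ring_map_peval]
  and peval_power = ring_map.power[OF ring_map_peval]

lemma monomial_product:
  "(\<Prod>i\<in>UNIV. Var i ^ lookup m i) = single m (1::'a::comm_ring_1)"
proof -
  have pow: "Var i ^ n = single (single i n) (1::'a)" for i n
  proof (induction n)
    case (Suc n)
    have "Var i ^ Suc n = Var i * single (single i n) (1::'a)"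
      using Suc by simp
    also have "\<dots> = single (single i 1 + single i n) 1"
      by (simp add: Var_def mult_single)
    finally show ?case
      by (simp flip: single_add)
  qed simp
  have "(\<Prod>i\<in>A. Var i ^ lookup m i)
      = single (\<Sum>i\<in>A. single i (lookup m i)) (1::'a)"
    if "finite A" for A
    using that by (induction A) (simp_all add: pow mult_single)
  moreover have "(\<Sum>i\<in>UNIV. single i (lookup m i)) = m"
    by (rule poly_mapping_eqI) (simp add: lookup_sum lookup_single when_def)
  ultimately show ?thesis
    by simp
qed

lemma hsub_cst_Var: "hsub cst Var p = p"
proof (induction p rule: tripoly_induct)
  case (single m a)
  show ?case
    by (simp add: ring_map.hsub_single ring_map_cst monomial_product mult_single)
qed (simp add: ring_map.hsub_add ring_map_cst)

lemma mdeg_add: "mdeg (m + n) = mdeg m + mdeg n"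
  by (simp add: mdeg_def lookup_add sum.distrib)

lemma mdeg_single: "mdeg (single i n) = n"
  by (simp add: mdeg_def lookup_single when_def)

lemma mdeg_zero: "mdeg 0 = 0"
  by (simp add: mdeg_def)

lemma mdeg_3: "mdeg m = lookup m 1 + lookup m 2 + lookup m 3"
  by (simp add: mdeg_def sum_3)

lemma formsD: "p \<in> forms d \<Longrightarrow> m \<in> keys p \<Longrightarrow> int (mdeg m) = d"
  by (simp add: forms_def)

lemma forms_zero: "0 \<in> forms d"
  by (simp add: forms_def)

lemma forms_add: "p \<in> forms d \<Longrightarrow> q \<in> forms d \<Longrightarrow> p + q \<in> forms d"
  using keys_add[of p q] by (auto simp: forms_def)

lemma forms_uminus: "p \<in> forms d \<Longrightarrow> - p \<in> forms d"
  by (auto simp: forms_def in_keys_iff)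

lemma forms_diff: "p \<in> forms d \<Longrightarrow> q \<in> forms d \<Longrightarrow> p - q \<in> forms d"
  using forms_add[of p d "- q"] forms_uminus[of q d] by simp

lemma forms_mult: "p \<in> forms d \<Longrightarrow> q \<in> forms e \<Longrightarrow> p * q \<in> forms (d + e)"
  using keys_mult[of p q] by (fastforce simp: forms_def mdeg_add)

lemma forms_sum: "(\<And>a. a \<in> A \<Longrightarrow> f a \<in> forms d) \<Longrightarrow> sum f A \<in> forms d"
  by (induction A rule: infinite_finite_induct) (simp_all add: forms_zero forms_add)

lemma forms_single: "int (mdeg m) = d \<Longrightarrow> single m a \<in> forms d"
  by (simp add: forms_def)

lemma forms_cst: "cst a \<in> forms 0"
  by (simp add: forms_single mdeg_zero)

lemma forms_one: "1 \<in> forms 0"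
  using forms_cst[of 1] by simp

lemma forms_Var: "Var i \<in> forms 1"
  by (simp add: Var_def forms_single mdeg_single)

lemma forms_cmul: "p \<in> forms d \<Longrightarrow> cmul a p \<in> forms d"
  using forms_mult[OF forms_cst, of p d a] by (simp add: cmul_def)

lemma forms_power: "p \<in> forms d \<Longrightarrow> p ^ n \<in> forms (int n * d)"
  by (induction n) (auto simp: forms_one algebra_simps dest: forms_mult)

lemma forms_prod:
  "(\<And>a. a \<in> A \<Longrightarrow> f a \<in> forms (d a)) \<Longrightarrow> prod f A \<in> forms (\<Sum>a\<in>A. d a)"
  by (induction A rule: infinite_finite_induct) (simp_all add: forms_one forms_mult)

text \<open>A degree-like property of a product descends to a factor: split \<open>q\<close> into the part that satisfies \<open>A\<close>
  and the rest; the product of \<open>p\<close> with the rest has no monomial in \<open>B\<close>, yet equals a difference of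
  polynomials supported in \<open>B\<close>, so it vanishes. It is applied to the total degree and to the degree in the
  third variable.\<close>
lemma keys_of_cofactor:
  fixes p q :: "'a::idom tripoly"
  assumes nz: "p \<noteq> 0" and AB: "\<And>u m. u \<in> keys p \<Longrightarrow> B (u + m) \<longleftrightarrow> A m"
    and pq: "\<And>m. m \<in> keys (p * q) \<Longrightarrow> B m" and m: "m \<in> keys q"
  shows "A m"
proof -
  let ?s = "\<lambda>m. single m (lookup q m)"
  define q1 where "q1 = (\<Sum>m\<in>{m\<in>keys q. A m}. ?s m)"
  define q2 where "q2 = (\<Sum>m\<in>{m\<in>keys q. \<not> A m}. ?s m)"
  have q: "q = q1 + q2"
    unfolding q1_def q2_def
    by (subst sum.union_disjoint[symmetric])
       (auto intro!: trans[OF monomial_expansion[of q]] sum.cong)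
  have k1: "keys q1 \<subseteq> Collect A" and k2: "keys q2 \<subseteq> - Collect A"
    unfolding q1_def q2_def
    by (auto simp: in_keys_iff lookup_sum lookup_single when_def split: if_splits)
  have "keys (p * q1) \<subseteq> Collect B"
    using keys_mult[of p q1] k1 AB by fastforce
  then have B: "keys (p * q2) \<subseteq> Collect B"
    using pq keys_diff[of "p * q" "p * q1"] by (auto simp: q distrib_left)
  have "keys (p * q2) \<subseteq> - Collect B"
    using keys_mult[of p q2] k2 AB by fastforce
  with B have "keys (p * q2) = {}"
    by blast
  then have "p * q2 = 0"
    by simp
  then have "q2 = 0"
    using nz by simp
  then show ?thesis
    using m q k1 by auto
qed

lemma forms_cofactor:
  fixes p q :: "'a::idom tripoly"
  assumes "p \<noteq> 0" "p \<in> forms a" "p * q \<in> forms b"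
  shows "q \<in> forms (b - a)"
proof -
  have "int (mdeg m) = b - a" if "m \<in> keys q" for m
    by (rule keys_of_cofactor[OF assms(1) _ _ that, where B = "\<lambda>m. int (mdeg m) = b"])
       (use assms(2,3) in \<open>auto simp: forms_def mdeg_add\<close>)
  then show ?thesis
    by (simp add: forms_def)
qed

lemma hsub_homogeneous_scale:
  assumes "ring_map c" "p \<in> forms d"
  shows "hsub c (\<lambda>i. a * w i) p = a ^ nat d * hsub c w p"
proof -
  have "(\<Prod>i\<in>UNIV. (a * w i) ^ lookup m i)
      = a ^ nat d * (\<Prod>i\<in>UNIV. w i ^ lookup m i)"
    if "m \<in> keys p" for m
  proof -
    have "nat d = mdeg m"
      using assms(2) that by (auto simp: forms_def)
    then show ?thesis
      by (simp add: power_mult_distrib prod.distrib mdeg_def power_sum)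
  qed
  then show ?thesis
    unfolding hsub_def by (simp add: sum_distrib_left algebra_simps)
qed

lemma peval_homogeneous_scale:
  "p \<in> forms d \<Longrightarrow> peval (\<lambda>i. a * v i) p = a ^ nat d * peval v p"
  by (simp add: peval_eq_hsub hsub_homogeneous_scale ring_map_id)

text \<open>Substituting linear forms into a form of degree \<open>e\<close> whose coefficients are themselves forms of
  degree \<open>d\<close> adds the degrees; for elements of \<open>Der\<^sup>k\<close> this yields the degree \<open>d + k\<close>.\<close>
lemma hsub_forms:
  assumes "\<And>m. c (lookup p m) \<in> forms d" "\<And>i. w i \<in> forms 1" "p \<in> forms e"
  shows "hsub c w p \<in> forms (d + e)"
  unfolding hsub_def
proof (rule forms_sum)
  fix m assume m: "m \<in> keys p"
  have "(\<Prod>i\<in>UNIV. w i ^ lookup m i) \<in> forms (\<Sum>i\<in>UNIV. int (lookup m i) * 1)"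
    by (intro forms_prod forms_power assms)
  moreover have "(\<Sum>i\<in>UNIV. int (lookup m i) * 1) = e"
    using assms(3) m by (auto simp: forms_def mdeg_def)
  ultimately have "(\<Prod>i\<in>UNIV. w i ^ lookup m i) \<in> forms e"
    by (simp only:)
  with assms(1) show "c (lookup p m) * (\<Prod>i\<in>UNIV. w i ^ lookup m i) \<in> forms (d + e)"
    by (rule forms_mult)
qed

lemma hsub_cst_forms:
  assumes "\<And>i. w i \<in> forms 1" "p \<in> forms e"
  shows "hsub cst w p \<in> forms e"
  using hsub_forms[where d = 0, OF _ assms] by (simp add: forms_cst)

text \<open>Kronecker substitution: with \<open>N\<close> larger than all exponents, the monomials of \<open>p\<close> become distinct
  powers of one variable under \<open>x\<^sub>1, x\<^sub>2, x\<^sub>3 \<mapsto> z, z\<^sup>N, z\<^bsup>N*N\<^esup>\<close>, and a nonzero polynomial in one variable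
  has a point where it does not vanish.\<close>
lemma peval_nonzero_ex:
  fixes p :: poly3
  assumes "p \<noteq> 0"
  shows "\<exists>v. peval v p \<noteq> 0"
proof -
  define N where "N = Suc (\<Sum>m\<in>keys p. mdeg m)"
  have bound: "lookup m i < N" if "m \<in> keys p" for m i
  proof -
    have "lookup m i \<le> mdeg m"
      unfolding mdeg_def by (rule member_le_sum) auto
    also have "\<dots> \<le> (\<Sum>m\<in>keys p. mdeg m)"
      by (rule member_le_sum[OF that]) auto
    finally show ?thesis by (simp add: N_def)
  qed
  define e :: "3 \<Rightarrow> nat" where "e = (\<lambda>i. if i = 1 then 1 else if i = 2 then N else N * N)"
  \<comment> \<open>\<open>\<kappa> m\<close> has the exponents of \<open>m\<close> as its digits in base \<open>N\<close>.\<close>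
  define \<kappa> where "\<kappa> m = (\<Sum>i\<in>UNIV. e i * lookup m i)" for m :: mono3
  have \<kappa>: "\<kappa> m = lookup m 1 + N * (lookup m 2 + N * lookup m 3)" for m
    by (simp add: \<kappa>_def e_def sum_3 algebra_simps)
  have inj: "m = n" if "\<kappa> m = \<kappa> n" "m \<in> keys p" "n \<in> keys p" for m n
  proof -
    have digit: "a = a' \<and> b = b'" if "a + N * b = a' + N * b'" "a < N" "a' < N" for a a' b b'
    proof -
      have "a = a'"
        using arg_cong[OF that(1), of "\<lambda>n. n mod N"] that(2,3) by simp
      then show ?thesis
        using that by simp
    qed
    have "lookup m 1 = lookup n 1"
      "lookup m 2 = lookup n 2"
      "lookup m 3 = lookup n 3"
      using digit[OF that(1)[unfolded \<kappa>] bound[OF that(2)] bound[OF that(3)]]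
        digit[OF _ bound[OF that(2)] bound[OF that(3)]] by blast+
    then have "lookup m i = lookup n i" for i
      using exhaust_3[of i] by auto
    then show ?thesis
      by (rule poly_mapping_eqI)
  qed
  define q where "q = hsub (\<lambda>a. [:a:]) (\<lambda>i. monom (1::complex) (e i)) p"
  have rm: "ring_map (\<lambda>a::complex. [:a:])"
    by unfold_locales (simp_all add: one_pCons)
  have prod: "(\<Prod>i\<in>UNIV. monom (1::complex) (e i) ^ lookup m i) = monom 1 (\<kappa> m)" for m
  proof -
    have "(\<Prod>i\<in>A. monom (1::complex) (e i) ^ lookup m i)
        = monom 1 (\<Sum>i\<in>A. e i * lookup m i)" if "finite A" for A
      using that by (induction A) (simp_all add: monom_power mult_monom)
    then show ?thesis
      by (simp add: \<kappa>_def)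
  qed
  obtain m where m: "m \<in> keys p"
    using assms by (metis all_not_in_conv keys_eq_empty)
  have "coeff q (\<kappa> m) = (\<Sum>n\<in>keys p. if n = m then lookup p n else 0)"
    unfolding q_def hsub_def prod coeff_sum
    using inj m by (intro sum.cong) (auto simp: coeff_monom)
  also have "\<dots> \<noteq> 0"
    using m by (simp add: in_keys_iff)
  finally have "q \<noteq> 0"
    by auto
  then obtain z where z: "poly q z \<noteq> 0"
    using poly_all_0_iff_0 by blast
  have "ring_map (\<lambda>q. poly q z)"
    by unfold_locales simp_all
  from hsub_comp[OF this, of "\<lambda>a. [:a:]" "\<lambda>i. monom 1 (e i)" p]
  have "poly q z = peval (\<lambda>i. z ^ e i) p"
    by (simp add: q_def peval_eq_hsub poly_monom)
  with z show ?thesis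
    by auto
qed

lemma peval_eqI:
  fixes p q :: poly3
  assumes "\<And>v. peval v p = peval v q"
  shows "p = q"
  using peval_nonzero_ex[of "p - q"] assms by (auto simp: peval_diff)

section \<open>Linear forms are prime\<close>

definition lin :: "complex ^ 3 \<Rightarrow> poly3" where
  "lin c = (\<Sum>i\<in>UNIV. cmul (c $ i) (Var i))"

lemma dual_form_eq_lin: "dual_form Q = lin (rep_proj2 Q)"
  by (simp add: dual_form_def lin_def)

abbreviation dot :: "complex ^ 3 \<Rightarrow> (3 \<Rightarrow> complex) \<Rightarrow> complex" where
  "dot c v \<equiv> (\<Sum>i\<in>UNIV. c $ i * v i)"

lemma peval_lin: "peval v (lin c) = dot c v"
  by (simp add: lin_def peval_sum peval_cmul peval_Var)

lemma forms_lin: "lin c \<in> forms 1"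
  unfolding lin_def by (intro forms_sum forms_cmul forms_Var)

text \<open>Solving \<open>c \<cdot> v = 0\<close> for a variable whose coefficient is nonzero gives a polynomial retraction of the
  space onto the plane; modulo \<open>lin c\<close> it is the identity.\<close>
lemma lin_retraction:
  assumes "c \<noteq> 0"
  obtains w where "\<And>i. lin c dvd Var i - w i"
    "\<And>v. (\<Sum>i\<in>UNIV. c $ i * peval v (w i)) = 0"
    "\<And>v i. dot c v = 0 \<Longrightarrow> peval v (w i) = v i"
proof -
  obtain k where k: "c $ k \<noteq> 0"
    using assms by (auto simp: vec_eq_iff)
  define w where "w i = (if i = k then Var k - cmul (1 / c $ k) (lin c) else Var i)" for i
  have w: "peval v (w i) = (if i = k then v k - (1 / c $ k) * dot c v else v i)" for v i
    by (simp add: w_def peval_diff peval_cmul peval_Var peval_lin)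
  show ?thesis
  proof
    fix i show "lin c dvd Var i - w i"
      by (simp add: w_def cmul_def)
  next
    fix v
    have "(\<Sum>i\<in>UNIV. c $ i * peval v (w i)) = (\<Sum>i\<in>UNIV. c $ i * v i -
        (if i = k then dot c v else 0))"
      using k by (intro sum.cong) (auto simp: w field_simps)
    also have "\<dots> = 0"
      by (simp add: sum_subtractf)
    finally show "(\<Sum>i\<in>UNIV. c $ i * peval v (w i)) = 0" .
  qed (simp add: w)
qed

text \<open>The Nullstellensatz for a plane. Composing \<open>p\<close> with the retraction changes it by a multiple of
  \<open>lin c\<close> and gives zero if \<open>p\<close> vanishes on the plane.\<close>
lemma lin_dvd_iff:
  assumes "c \<noteq> 0"
  shows "lin c dvd p \<longleftrightarrow> (\<forall>v. dot c v = 0 \<longrightarrow> peval v p = 0)"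
proof
  assume "lin c dvd p"
  then show "\<forall>v. dot c v = 0 \<longrightarrow> peval v p = 0"
    by (auto simp: dvd_def peval_mult peval_lin)
next
  assume p: "\<forall>v. dot c v = 0 \<longrightarrow> peval v p = 0"
  obtain w where w: "\<And>i. lin c dvd Var i - w i" "\<And>v. (\<Sum>i\<in>UNIV. c $ i * peval v (w i)) = 0"
    using lin_retraction[OF assms] by metis
  have "hsub cst w p = 0"
    by (rule peval_eqI) (simp add: peval_hsub_cst p w peval_zero)
  moreover have "lin c dvd hsub cst Var p - hsub cst w p"
    by (rule ring_map.hsub_congruent[OF ring_map_cst w(1)])
  ultimately show "lin c dvd p"
    by (simp add: hsub_cst_Var)
qed

text \<open>By the retraction, divisibility by \<open>lin c\<close> is the kernel of a ring homomorphism into a domain.\<close>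
lemma prime_lin:
  assumes "c \<noteq> 0"
  shows "prime_elem (lin c)"
proof (rule prime_elemI)
  show "lin c \<noteq> 0"
  proof
    assume "lin c = 0"
    then have "(\<Sum>i\<in>UNIV. c $ i * cnj (c $ i)) = 0"
      using peval_lin[of "\<lambda>i. cnj (c $ i)" c] by (simp add: peval_zero)
    then have "Re (\<Sum>i\<in>UNIV. c $ i * cnj (c $ i)) = 0"
      by simp
    then have "(\<Sum>i\<in>UNIV. (cmod (c $ i))\<^sup>2) = 0"
      by (simp add: cmod_power2 flip: power2_eq_square)
    then show False
      using assms by (simp add: sum_nonneg_eq_0_iff vec_eq_iff)
  qed
  have *: "\<not> lin c dvd 1"
    unfolding lin_dvd_iff[OF assms] by (auto simp: peval_one intro!: exI[of _ "\<lambda>_. 0"])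
  then show "\<not> lin c dvd 1" .
next
  fix p q assume pq: "lin c dvd p * q"
  obtain w where w: "\<And>i. lin c dvd Var i - w i" "\<And>v. (\<Sum>i\<in>UNIV. c $ i * peval v (w i)) = 0"
    "\<And>v i. dot c v = 0 \<Longrightarrow> peval v (w i) = v i"
    using lin_retraction[OF assms] by metis
  have R: "lin c dvd r \<longleftrightarrow> hsub cst w r = 0" for r
  proof
    assume "lin c dvd r"
    then show "hsub cst w r = 0"
      unfolding lin_dvd_iff[OF assms]
      by (intro peval_eqI) (simp add: peval_hsub_cst w peval_zero)
  next
    assume r: "hsub cst w r = 0"
    show "lin c dvd r"
      unfolding lin_dvd_iff[OF assms]
    proof (intro allI impI)
      fix v :: "3 \<Rightarrow> complex"
      assume v: "dot c v = 0"
      have "peval v r = peval v (hsub cst w r)"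
        by (simp add: peval_hsub_cst w(3)[OF v])
      then show "peval v r = 0"
        by (simp add: r peval_zero)
    qed
  qed
  show "lin c dvd p \<or> lin c dvd q"
    using pq unfolding R by (simp add: ring_map.hsub_mult ring_map_cst)
qed

lemma lin_nonzero: "c \<noteq> 0 \<Longrightarrow> lin c \<noteq> 0"
  using prime_lin by (auto simp: prime_elem_def)

lemma prime_elem_dvd_prod:
  assumes "prime_elem q" "finite A" "q dvd prod f A"
  shows "\<exists>a\<in>A. q dvd f a"
  using assms(2,3)
proof (induction A)
  case empty
  then show ?case
    using assms(1) by (simp add: prime_elem_def)
next
  case (insert a A)
  then show ?case
    by (auto simp: prime_elem_dvd_mult_iff[OF assms(1)])
qed

lemma power_dvd_cancel_prime:
  fixes p :: "'a::idom"
  assumes "prime_elem p" "\<not> p dvd b" "p ^ n dvd a * b"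
  shows "p ^ n dvd a"
  using assms(3)
proof (induction n arbitrary: a)
  case (Suc n)
  then have "p dvd a * b"
    by (metis dvd_mult_left power_Suc)
  then obtain a' where a': "a = p * a'"
    using assms(1,2) by (auto simp: prime_elem_dvd_mult_iff elim: dvdE)
  then have "p ^ n dvd a' * b"
    using Suc.prems assms(1) by (auto simp: mult.assoc prime_elem_def)
  then show ?case
    using Suc.IH[of a'] by (simp add: a' mult_dvd_mono)
qed simp

lemma prod_prime_dvd:
  fixes f :: "'b \<Rightarrow> 'a::idom"
  assumes "finite A" "\<And>a. a \<in> A \<Longrightarrow> prime_elem (f a)"
    "\<And>a b. a \<in> A \<Longrightarrow> b \<in> A \<Longrightarrow> f a dvd f b \<Longrightarrow> a = b" "\<And>a. a \<in> A \<Longrightarrow> f a dvd x"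
  shows "prod f A dvd x"
  using assms
proof (induction A arbitrary: x)
  case (insert a A)
  obtain y where y: "x = f a * y"
    using insert.prems(3)[of a] by auto
  have "f b dvd y" if "b \<in> A" for b
    using insert.prems(1)[of b] insert.prems(2)[of b a] insert.prems(3)[of b] insert.hyps that
    by (auto simp: y prime_elem_dvd_mult_iff)
  then have "prod f A dvd y"
    using insert by auto
  then show ?case
    using insert.hyps by (simp add: y)
qed simp

lemma sum_axis_mult: "(\<Sum>k\<in>UNIV. (axis i 1 :: complex ^ 3) $ k * v k) = v i"
proof -
  have "(\<Sum>k\<in>UNIV. (axis i 1 :: complex ^ 3) $ k * v k) = (\<Sum>k\<in>UNIV. if k = i then v i else 0)"
    by (intro sum.cong) (auto simp: axis_def)
  then show ?thesis
    by simp
qed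

lemma lin_axis: "lin (axis i 1) = Var i"
  by (rule peval_eqI) (simp add: peval_lin peval_Var sum_axis_mult)

lemma prime_Var: "prime_elem (Var i :: poly3)"
  using prime_lin[of "axis i 1"] by (simp add: lin_axis axis_eq_0_iff)

lemma Var_nonzero: "(Var i :: poly3) \<noteq> 0"
  using prime_Var[of i] by (simp add: prime_elem_def)

lemma Var_dvd_iff: "(Var i :: poly3) dvd Var j \<longleftrightarrow> i = j"
proof -
  have "(Var i :: poly3) dvd Var j \<longleftrightarrow>
      (\<forall>v. (\<Sum>k\<in>UNIV. (axis i 1 :: complex ^ 3) $ k * v k) = 0 \<longrightarrow> v j = 0)"
    unfolding lin_axis[symmetric]
    by (subst lin_dvd_iff) (simp_all add: axis_eq_0_iff lin_axis peval_Var)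
  also have "\<dots> \<longleftrightarrow> (\<forall>v::3 \<Rightarrow> complex. v i = 0 \<longrightarrow> v j = 0)"
    by (simp only: sum_axis_mult)
  also have "\<dots> \<longleftrightarrow> i = j"
  proof
    assume "\<forall>v::3 \<Rightarrow> complex. v i = 0 \<longrightarrow> v j = 0"
    from spec[OF this, of "\<lambda>k. if k = i then 0 else 1"] show "i = j"
      by (simp split: if_splits)
  qed simp
  finally show ?thesis .
qed

section \<open>Derivatives and the order of vanishing\<close>

lemma tripoly_ring_induct [case_names cst Var add mult]:
  fixes p :: "'a::comm_ring_1 tripoly"
  assumes cst: "\<And>a. R (cst a)" and Var: "\<And>i. R (Var i)"
    and add: "\<And>p q. R p \<Longrightarrow> R q \<Longrightarrow> R (p + q)" and mult: "\<And>p q. R p \<Longrightarrow> R q \<Longrightarrow> R (p * q)"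
  shows "R p"
proof (induction p rule: tripoly_induct)
  case (single m a)
  have pow: "R (Var i ^ n)" for i n
    by (induction n) (use cst[of 1] Var mult in auto)
  have "R (\<Prod>i\<in>A. Var i ^ lookup m i)" if "finite A" for A
    using that by (induction A) (use cst[of 1] pow mult in auto)
  from mult[OF cst[of a] this[of UNIV]] show ?case
    by (simp add: monomial_product mult_single)
qed (rule add)

lemma pdiff_superset:
  assumes "finite A" "keys p \<subseteq> A"
  shows "pdiff i p = (\<Sum>m\<in>A. single (m - single i 1)
       (of_nat (lookup m i) * lookup p m))"
  unfolding pdiff_def by (rule sum.mono_neutral_left[OF assms]) (auto simp: in_keys_iff)

lemma pdiff_single:
  "pdiff i (single m a) =
     single (m - single i 1) (of_nat (lookup m i) * a)"
  by (subst pdiff_superset[of "{m}"]) auto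

lemma pdiff_add: "pdiff i (p + q) = pdiff i p + pdiff i q"
proof -
  let ?A = "keys p \<union> keys q"
  have "finite ?A" "keys (p + q) \<subseteq> ?A"
    by (simp_all add: keys_add)
  then show ?thesis
    by (simp add: pdiff_superset[of ?A] lookup_add distrib_left single_add sum.distrib)
qed

lemma pdiff_mult: "pdiff i (p * q) = pdiff i p * q + p * pdiff i q"
proof (induction p rule: tripoly_induct)
  case (single m a)
  show ?case
  proof (induction q rule: tripoly_induct)
    case (single n b)
    have shift: "single (m + n - single i 1) (of_nat (lookup m i) * x)
        = single ((m - single i 1) + n) (of_nat (lookup m i) * x)"
      for m n :: mono3 and x :: 'a
    proof (cases "lookup m i = 0")
      case False
      then have "m + n - single i 1 = (m - single i 1) + n"
        by (intro poly_mapping_eqI)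
           (auto simp: lookup_add lookup_single when_def minus_poly_mapping.rep_eq)
      then show ?thesis
        by simp
    qed simp
    show ?case
      using shift[of m n "a * b"] shift[of n m "a * b"]
      by (simp add: mult_single pdiff_single lookup_add distrib_right distrib_left single_add ac_simps)
  qed (simp add: pdiff_add distrib_left add_ac)
qed (simp add: pdiff_add distrib_right add_ac)

lemma pdiff_cst: "pdiff i (cst a) = 0"
  by (simp add: pdiff_single)

lemma pdiff_zero: "pdiff i 0 = 0"
  by (simp add: pdiff_def)

lemma pdiff_Var: "pdiff i (Var j) = (if i = j then 1 else 0)"
  by (simp add: Var_def pdiff_single lookup_single when_def)

lemma pdiff_cmul: "pdiff i (cmul a p) = cmul a (pdiff i p)"
  by (simp add: cmul_def pdiff_mult pdiff_cst)

lemma pdiff_sum: "pdiff i (sum f A) = (\<Sum>a\<in>A. pdiff i (f a))"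
  by (induction A rule: infinite_finite_induct) (simp_all add: pdiff_zero pdiff_add)

lemma pdiff_lin: "pdiff i (lin c) = cst (c $ i)"
  proof -
  have "pdiff i (lin c) = (\<Sum>j\<in>UNIV. if j = i then cst (c $ i) else 0)"
    unfolding lin_def pdiff_sum pdiff_cmul pdiff_Var
    by (intro sum.cong) (auto simp: cmul_def)
  then show ?thesis
    by simp
qed

text \<open>The chain rule for a polynomial substitution.\<close>
lemma pdiff_hsub_cst:
  "pdiff i (hsub cst w p) = (\<Sum>l\<in>UNIV. pdiff i (w l) * hsub cst w (pdiff l p))"
proof (induction p rule: tripoly_ring_induct)
  case (mult p q)
  then show ?case
    by (simp add: ring_map.hsub_mult ring_map.hsub_add ring_map_cst pdiff_mult sum_distrib_left
        sum_distrib_right sum.distrib algebra_simps)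
qed (simp_all add: ring_map.hsub_cst ring_map.hsub_Var ring_map.hsub_add ring_map.hsub_zero
      ring_map_cst pdiff_cst pdiff_Var pdiff_add sum.distrib distrib_left if_distrib
      ring_map.one[OF ring_map.ring_map_hsub] cong: if_cong)

lemma lookup_pdiff:
  "lookup (pdiff i p) m =
     of_nat (Suc (lookup m i)) * lookup p (m + single i 1)"
proof (induction p rule: tripoly_induct)
  case (single n a)
  show ?case
  proof (cases "n = m + single i 1")
    case True
    then show ?thesis
      by (simp add: pdiff_single lookup_add)
  next
    case False
    have "lookup n i = 0" if "n - single i 1 = m"
    proof (rule ccontr)
      assume "lookup n i \<noteq> 0"
      then have "n = m + single i 1"
        unfolding that[symmetric]
        by (intro poly_mapping_eqI)
           (auto simp: lookup_add lookup_single when_def minus_poly_mapping.rep_eq)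
      with False show False ..
    qed
    with False show ?thesis
      by (auto simp: pdiff_single lookup_single when_def)
  qed
qed (simp add: pdiff_add lookup_add distrib_left)

lemma pdiff_forms: "p \<in> forms d \<Longrightarrow> pdiff i p \<in> forms (d - 1)"
proof -
  assume p: "p \<in> forms d"
  have "int (mdeg m) = d - 1" if "m \<in> keys (pdiff i p)" for m
  proof -
    have "m + single i 1 \<in> keys p"
      using that by (auto simp: in_keys_iff lookup_pdiff)
    then have "int (mdeg (m + single i 1)) = d"
      using p unfolding forms_def by blast
    then show ?thesis
      by (simp add: mdeg_add mdeg_single)
  qed
  then show ?thesis
    by (simp add: forms_def)
qed

definition vanish :: "nat \<Rightarrow> (3 \<Rightarrow> complex) \<Rightarrow> poly3 \<Rightarrow> bool" where
  "vanish j v F \<longleftrightarrow> (\<forall>is. length is < j \<longrightarrow> peval v (fold pdiff is F) = 0)"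

lemma vanishes_to_order_eq: "vanishes_to_order j P F \<longleftrightarrow> vanish j (($) (rep_proj2 P)) F"
  by (simp add: vanishes_to_order_def vanish_def ev_def)

lemma vanish_0: "vanish 0 v F"
  by (simp add: vanish_def)

text \<open>The recursion behind all inductions on the order of vanishing.\<close>
lemma vanish_Suc: "vanish (Suc j) v F \<longleftrightarrow> peval v F = 0 \<and> (\<forall>i. vanish j v (pdiff i F))"
proof -
  have "(\<forall>is. length is < Suc j \<longrightarrow> peval v (fold pdiff is F) = 0) \<longleftrightarrow>
      peval v F = 0 \<and> (\<forall>i is. length is < j \<longrightarrow> peval v (fold pdiff is (pdiff i F)) = 0)"
    (is "?l \<longleftrightarrow> ?r")
  proof
    assume l: ?l
    from l have "peval v F = 0"
      by (elim allE[of _ "[]"]) simp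
    moreover from l have "peval v (fold pdiff is (pdiff i F)) = 0" if "length is < j" for i "is"
      using that by (elim allE[of _ "i # is"]) simp
    ultimately show ?r by blast
  next
    assume r: ?r
    show ?l
    proof (intro allI impI)
      fix js :: "3 list" assume "length js < Suc j"
      then show "peval v (fold pdiff js F) = 0"
        using r by (cases js) auto
    qed
  qed
  then show ?thesis
    by (simp add: vanish_def)
qed

lemma vanish_add: "vanish j v F \<Longrightarrow> vanish j v G \<Longrightarrow> vanish j v (F + G)"
  by (induction j arbitrary: F G) (simp_all add: vanish_0 vanish_Suc peval_add pdiff_add)

lemma vanish_cst_mult: "vanish j v F \<Longrightarrow> vanish j v (cst a * F)"
  by (induction j arbitrary: F) (simp_all add: vanish_0 vanish_Suc peval_mult pdiff_mult pdiff_cst)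

lemma vanish_zero: "vanish j v 0"
  by (induction j) (simp_all add: vanish_0 vanish_Suc peval_zero pdiff_zero)

lemma vanish_sum: "(\<And>a. a \<in> A \<Longrightarrow> vanish j v (f a)) \<Longrightarrow> vanish j v (sum f A)"
  by (induction A rule: infinite_finite_induct) (simp_all add: vanish_zero vanish_add)

text \<open>The order of vanishing does not depend on linear coordinates, by the chain rule. It is used to move
  \<open>P\<close> to the coordinate point \<open>(0 : 0 : 1)\<close>.\<close>
lemma vanish_linear_substitution:
  assumes "vanish j (\<lambda>i. peval u (lin (c i))) F"
  shows "vanish j u (hsub cst (\<lambda>i. lin (c i)) F)"
  using assms
proof (induction j arbitrary: F)
  case (Suc j)
  then show ?case
    by (auto simp: vanish_Suc peval_hsub_cst pdiff_hsub_cst pdiff_lin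
        intro!: vanish_sum vanish_cst_mult)
qed (simp add: vanish_0)

lemma prod_3: "prod f (UNIV :: 3 set) = f 1 * f 2 * (f 3 :: 'a::comm_monoid_mult)"
  unfolding UNIV_3 by (simp add: ac_simps)

definition point3 :: "3 \<Rightarrow> complex" where
  "point3 i = (if i = 3 then 1 else 0)"

lemma prod_point3:
  "(\<Prod>i\<in>UNIV. point3 i ^ lookup m i) =
    (if lookup m 1 + lookup m 2 = 0 then 1 else 0)"
  by (simp add: point3_def prod_3 power_0_left)

text \<open>At \<open>(0 : 0 : 1)\<close> the order of vanishing can be read off from the monomials: differentiating by one of
  the first two variables lowers their joint degree by one, while a monomial in the third variable alone is
  detected by the value at the point. In characteristic zero no coefficient is lost.\<close>
lemma vanish_point3_iff:
  assumes "G \<in> forms d"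
  shows "vanish j point3 G \<longleftrightarrow>
    (\<forall>m\<in>keys G. j \<le> lookup m 1 + lookup m 2)"
  using assms
proof (induction j arbitrary: G d)
  case (Suc j)
  let ?low = "\<lambda>m. lookup m 1 + lookup m (2::3)"
  show ?case
  proof
    assume v: "vanish (Suc j) point3 G"
    show "\<forall>m\<in>keys G. Suc j \<le> ?low m"
    proof
      fix m assume m: "m \<in> keys G"
      have pos: "?low m \<noteq> 0"
      proof
        assume m0: "?low m = 0"
        have uniq: "m' = m" if "m' \<in> keys G" "?low m' = 0" for m'
        proof (rule poly_mapping_eqI)
          fix i :: 3
          have "mdeg m' = mdeg m"
            using formsD[OF Suc.prems m] formsD[OF Suc.prems that(1)] by simp
          moreover have low: "lookup m 1 = 0" "lookup m 2 = 0"
            "lookup m' 1 = 0" "lookup m' 2 = 0"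
            using m0 that(2) by simp_all
          ultimately have "lookup m' 3 = lookup m 3"
            unfolding mdeg_3 by linarith
          with low show "lookup m' i = lookup m i"
            using exhaust_3[of i] by auto
        qed
        have "?low m' = 0 \<longleftrightarrow> m' = m" if "m' \<in> keys G" for m'
        proof
          assume "m' = m"
          with m0 show "?low m' = 0"
            by (simp only:)
        qed (rule uniq[OF that])
        then have "peval point3 G = (\<Sum>m'\<in>keys G. if m' = m then lookup G m else 0)"
          unfolding peval_def prod_point3 by (intro sum.cong) (simp_all del: add_is_0)
        then show False
          using m v by (simp add: vanish_Suc in_keys_iff)
      qed
      have step: "Suc j \<le> ?low m" if i: "i \<in> {1, 2}" and mi: "lookup m i \<noteq> 0" for i
      proof -
        let ?m = "m - single i 1"
        have m': "?m + single i 1 = m"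
          using mi by (intro poly_mapping_eqI)
            (auto simp: lookup_add lookup_single when_def minus_poly_mapping.rep_eq)
        have "?m \<in> keys (pdiff i G)"
          unfolding in_keys_iff lookup_pdiff m' using m by (simp add: in_keys_iff del: of_nat_Suc)
        moreover have "vanish j point3 (pdiff i G)"
          using v by (simp add: vanish_Suc)
        ultimately have "j \<le> ?low ?m"
          using Suc.IH[OF pdiff_forms[OF Suc.prems]] by blast
        then show ?thesis
          using i mi by (auto simp: lookup_single when_def minus_poly_mapping.rep_eq)
      qed
      show "Suc j \<le> ?low m"
        using pos step[of 1] step[of 2] by auto
    qed
  next
    assume low: "\<forall>m\<in>keys G. Suc j \<le> ?low m"
    then have "peval point3 G = 0"
      unfolding peval_def prod_point3 by (intro sum.neutral) auto
    moreover have "vanish j point3 (pdiff i G)" for i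
      unfolding Suc.IH[OF pdiff_forms[OF Suc.prems]]
    proof
      fix m assume "m \<in> keys (pdiff i G)"
      then have "m + single i 1 \<in> keys G"
        by (auto simp: in_keys_iff lookup_pdiff)
      then have "Suc j \<le> ?low (m + single i 1)"
        using low by blast
      then show "j \<le> ?low m"
        by (auto simp: lookup_add lookup_single when_def split: if_splits)
    qed
    ultimately show "vanish (Suc j) point3 G"
      by (simp add: vanish_Suc)
  qed
qed (simp add: vanish_0)

section \<open>Degree in the third variable\<close>

definition deg3_le :: "nat \<Rightarrow> poly3 \<Rightarrow> bool" where
  "deg3_le k q \<longleftrightarrow> (\<forall>m\<in>keys q. lookup m 3 \<le> k)"

lemma deg3_le_zero: "deg3_le k 0"
  by (simp add: deg3_le_def)

lemma deg3_le_add: "deg3_le k p \<Longrightarrow> deg3_le k q \<Longrightarrow> deg3_le k (p + q)"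
  using keys_add[of p q] by (auto simp: deg3_le_def)

lemma deg3_le_mult: "deg3_le k p \<Longrightarrow> deg3_le l q \<Longrightarrow> deg3_le (k + l) (p * q)"
  using keys_mult[of p q] by (fastforce simp: deg3_le_def lookup_add intro: add_mono)

lemma deg3_le_sum: "(\<And>a. a \<in> A \<Longrightarrow> deg3_le k (f a)) \<Longrightarrow> deg3_le k (sum f A)"
  by (induction A rule: infinite_finite_induct) (simp_all add: deg3_le_zero deg3_le_add)

lemma deg3_le_cst: "deg3_le k (cst a)"
  by (simp add: deg3_le_def)

lemma deg3_le_Var: "deg3_le (if i = 3 then 1 else 0) (Var i)"
  by (simp add: deg3_le_def Var_def lookup_single when_def)

lemma deg3_le_mono: "deg3_le k p \<Longrightarrow> k \<le> l \<Longrightarrow> deg3_le l p"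
  by (auto simp: deg3_le_def)

lemma deg3_le_power: "deg3_le k p \<Longrightarrow> deg3_le (k * n) (p ^ n)"
proof (induction n)
  case 0
  show ?case
    using deg3_le_cst[of 0 1] by simp
qed (auto dest: deg3_le_mult)

lemma deg3_le_prod:
  "(\<And>a. a \<in> A \<Longrightarrow> deg3_le (k a) (f a)) \<Longrightarrow> deg3_le (\<Sum>a\<in>A. k a) (prod f A)"
proof (induction A rule: infinite_finite_induct)
  case (insert a A)
  then show ?case
    by (simp add: deg3_le_mult)
qed (use deg3_le_cst[of 0 1] in simp_all)

lemma deg3_le_lin: "deg3_le (if c $ 3 = 0 then 0 else 1) (lin c)"
proof -
  have "deg3_le (if c $ 3 = 0 then 0 else 1) (cmul (c $ i) (Var i))" for i
  proof (cases "i = 3 \<and> c $ 3 = 0")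
    case True
    then show ?thesis
      by (simp add: cmul_def deg3_le_zero)
  next
    case False
    have "deg3_le (0 + (if i = 3 then 1 else 0)) (cmul (c $ i) (Var i))"
      unfolding cmul_def by (intro deg3_le_mult deg3_le_cst deg3_le_Var)
    then show ?thesis
      by (rule deg3_le_mono) (use False in auto)
  qed
  then show ?thesis
    unfolding lin_def by (intro deg3_le_sum)
qed

lemma deg3_le_cofactor:
  assumes "p \<noteq> 0" "deg3_le 0 p" "deg3_le k (p * q)"
  shows "deg3_le k q"
proof -
  have "lookup m 3 \<le> k" if "m \<in> keys q" for m
    by (rule keys_of_cofactor[OF assms(1) _ _ that, where B = "\<lambda>m. lookup m 3 \<le> k"])
       (use assms(2,3) in \<open>auto simp: deg3_le_def lookup_add\<close>)
  then show ?thesis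
    by (simp add: deg3_le_def)
qed

lemma deg3_le_hsub:
  assumes "\<And>m. deg3_le 0 (c (lookup p m))" "\<And>i. deg3_le b (w i)" "p \<in> forms (int k)"
  shows "deg3_le (b * k) (hsub c w p)"
  unfolding hsub_def
proof (rule deg3_le_sum)
  fix m assume m: "m \<in> keys p"
  have "deg3_le (\<Sum>i\<in>UNIV. b * lookup m i) (\<Prod>i\<in>UNIV. w i ^ lookup m i)"
    by (intro deg3_le_prod deg3_le_power assms)
  moreover have "(\<Sum>i\<in>UNIV. b * lookup m i) = b * k"
  proof -
    have "mdeg m = k"
      using formsD[OF assms(3) m] by simp
    then show ?thesis
      by (simp add: mdeg_def flip: sum_distrib_left)
  qed
  ultimately show "deg3_le (b * k) (c (lookup p m) * (\<Prod>i\<in>UNIV. w i ^ lookup m i))"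
    using deg3_le_mult[OF assms(1)[of m]] by fastforce
qed

lemma deg3_le_0_hsub_cst:
  assumes "\<And>i. deg3_le 0 (w i)"
  shows "deg3_le 0 (hsub cst w p)"
  unfolding hsub_def
proof (rule deg3_le_sum)
  fix m
  have "deg3_le (\<Sum>i\<in>UNIV. 0 * lookup m i) (\<Prod>i\<in>UNIV. w i ^ lookup m i)"
    by (intro deg3_le_prod deg3_le_power assms)
  then show "deg3_le 0 (cst (lookup p m) * (\<Prod>i\<in>UNIV. w i ^ lookup m i))"
    using deg3_le_mult[OF deg3_le_cst] by fastforce
qed

lemma peval_deg3_le_0:
  assumes "deg3_le 0 q" "u 1 = v 1" "u 2 = v 2"
  shows "peval u q = peval v q"
  unfolding peval_def
  by (rule sum.cong) (use assms in \<open>auto simp: prod_3 deg3_le_def\<close>)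

section \<open>Points of the projective plane\<close>

lemma rep_proj2_nonzero: "rep_proj2 x \<noteq> 0"
  using Quotient_rep_reflp[OF Quotient_proj2, of x] by (simp add: proj_rel_def)

lemma abs_proj2_rep: "abs_proj2 (rep_proj2 x) = x"
  by (rule Quotient_abs_rep[OF Quotient_proj2])

lemma rep_proj2_not_proportional:
  assumes "x \<noteq> y"
  shows "rep_proj2 y \<noteq> c *s rep_proj2 x"
proof
  assume *: "rep_proj2 y = c *s rep_proj2 x"
  then have "c \<noteq> 0"
    using rep_proj2_nonzero[of y] by auto
  then have "proj_rel (rep_proj2 x) (rep_proj2 y)"
    using * rep_proj2_nonzero[of x] by (auto simp: proj_rel_def)
  then have "abs_proj2 (rep_proj2 x) = abs_proj2 (rep_proj2 y)"
    using Quotient_rel_abs[OF Quotient_proj2] by blast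
  then show False
    using assms by (simp add: abs_proj2_rep)
qed

lemma proj2_of_vector:
  assumes "v \<noteq> 0"
  obtains x c where "c \<noteq> 0" "rep_proj2 x = c *s v"
proof -
  have "proj_rel v v"
    using assms by (auto simp: proj_rel_def intro!: exI[of _ 1])
  then have "proj_rel v (rep_proj2 (abs_proj2 v))"
    using Quotient_rep_abs[OF Quotient_proj2] Quotient_symp[OF Quotient_proj2] by (metis sympD)
  then show ?thesis
    using that by (auto simp: proj_rel_def)
qed

lemma ev_mult: "ev (g * h) x = ev g x * ev h x"
  by (simp add: ev_def peval_mult)

lemma ev_power: "ev (g ^ n) x = ev g x ^ n"
  by (simp add: ev_def peval_power)

lemma ev_one: "ev 1 x = 1"
  by (simp add: ev_def peval_one)

lemma ev_Var: "ev (Var i) x = rep_proj2 x $ i"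
  by (simp add: ev_def peval_Var)

lemma zariski_open_form: "g \<in> forms d \<Longrightarrow> zariski_open {x. ev g x \<noteq> 0}"
  unfolding zariski_open_def by (rule exI[of _ "{g}"]) auto

section \<open>A line with a parametrisation\<close>

text \<open>The coordinates of \<open>X(t)\<close>.\<close>
definition line_pt :: "complex ^ 3 \<Rightarrow> 3 \<Rightarrow> poly3" where
  "line_pt p i = lin (if i = 3 then vector [- (p $ 1 / p $ 3), - (p $ 2 / p $ 3), 0] else axis i 1)"

lemma peval_line_pt:
  "peval v (line_pt p i) = (if i = 3 then - ((p $ 1 * v 1 + p $ 2 * v 2) / p $ 3) else v i)"
  by (cases "i = 3")
     (simp_all add: line_pt_def lin_axis peval_Var peval_lin sum_3 vector_3 add_divide_distrib)

definition restrict_line :: "complex ^ 3 \<Rightarrow> poly3 \<Rightarrow> poly3" where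
  "restrict_line p = hsub cst (line_pt p)"

lemma ring_map_restrict_line: "ring_map (restrict_line p)"
  unfolding restrict_line_def by (intro ring_map.ring_map_hsub ring_map_cst)

lemma restrict_line_forms: "h \<in> forms d \<Longrightarrow> restrict_line p h \<in> forms d"
  unfolding restrict_line_def by (rule hsub_cst_forms) (simp_all add: line_pt_def forms_lin)

lemma deg3_le_line_pt: "deg3_le 0 (line_pt p i)"
  using deg3_le_lin[of "vector [- (p $ 1 / p $ 3), - (p $ 2 / p $ 3), 0]"] deg3_le_Var[of i]
  by (auto simp: line_pt_def vector_3 lin_axis)

lemma deg3_le_restrict_line: "deg3_le 0 (restrict_line p h)"
  unfolding restrict_line_def by (rule deg3_le_0_hsub_cst) (rule deg3_le_line_pt)

lemma peval_restrict_line: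
  "peval v (restrict_line p h) = peval (\<lambda>i. peval v (line_pt p i)) h"
  by (simp add: restrict_line_def peval_hsub_cst)

lemma restrict_line_Var: "i \<noteq> 3 \<Longrightarrow> restrict_line p (Var i) = Var i"
  by (rule peval_eqI) (simp add: peval_restrict_line peval_Var peval_line_pt)

text \<open>An element \<open>\<phi>\<close> of the field of fractions stands for a germ at \<open>x\<close>: the class of all fractions \<open>m / g\<close>
  regular at \<open>x\<close> whose representation by \<open>\<rho>\<close> is \<open>\<phi>\<close>. If it is empty, \<open>\<phi>\<close> is not regular at \<open>x\<close>.\<close>
definition stalk ::
    "complex ^ 3 \<Rightarrow> 'm gmod \<Rightarrow> ('m \<Rightarrow> poly3) \<Rightarrow> proj2 \<Rightarrow> poly3 fract \<Rightarrow> ('m \<times> poly3) set" where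
  "stalk p M \<rho> x \<phi> = {(m, g) \<in> fracs M x. Fract (\<rho> m) (restrict_line p g) = \<phi>}"

definition chart :: "proj2 \<Rightarrow> 3 \<Rightarrow> proj2 set" where
  "chart P i = {x \<in> dual_line P. rep_proj2 x $ i \<noteq> 0}"

locale line_chart =
  fixes P :: proj2 and p :: "complex ^ 3"
  assumes p_def: "p = rep_proj2 P" and p3: "p $ 3 \<noteq> 0"
begin

lemma p_nonzero: "p \<noteq> 0"
  using p3 by auto

lemma on_line_iff: "x \<in> dual_line P \<longleftrightarrow> (\<Sum>i\<in>UNIV. p $ i * rep_proj2 x $ i) = 0"
  by (simp add: dual_line_def dual_form_eq_lin ev_def peval_lin p_def)

lemma line_pt_on_line: "(\<Sum>i\<in>UNIV. p $ i * peval v (line_pt p i)) = 0"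
  using p3 by (simp add: sum_3 peval_line_pt)

lemma line_pt_of_on_line:
  assumes "dot p v = 0"
  shows "peval v (line_pt p i) = v i"
proof (cases "i = 3")
  case True
  have "(p $ 1 * v 1 + p $ 2 * v 2) + p $ 3 * v 3 = 0"
    using assms by (simp add: sum_3)
  then have "p $ 3 * v 3 = - (p $ 1 * v 1 + p $ 2 * v 2)"
    by (simp only: add_eq_0_iff)
  then have "v 3 = - ((p $ 1 * v 1 + p $ 2 * v 2) / p $ 3)"
    using p3 by (simp only: minus_divide_left nonzero_eq_divide_eq mult.commute not_False_eq_True)
  then show ?thesis
    using True by (simp add: peval_line_pt)
qed (simp add: peval_line_pt)

lemma peval_restrict_line_at:
  assumes "x \<in> dual_line P"
  shows "peval (($) (rep_proj2 x)) (restrict_line p h) = ev h x"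
  using assms by (simp add: on_line_iff peval_restrict_line line_pt_of_on_line ev_def)

lemma restrict_line_nonzero: "x \<in> dual_line P \<Longrightarrow> ev h x \<noteq> 0 \<Longrightarrow> restrict_line p h \<noteq> 0"
  by (metis peval_restrict_line_at peval_zero)

lemma restrict_line_dual_form: "restrict_line p (dual_form P) = 0"
  by (rule peval_eqI)
     (simp add: peval_restrict_line dual_form_eq_lin peval_lin peval_zero line_pt_on_line flip: p_def)

lemma restrict_line_eq_0_iff: "restrict_line p h = 0 \<longleftrightarrow> dual_form P dvd h"
proof
  assume "dual_form P dvd h"
  then show "restrict_line p h = 0"
    using ring_map.mult[OF ring_map_restrict_line] restrict_line_dual_form by (auto elim!: dvdE)
next
  assume h: "restrict_line p h = 0"
  have "peval v h = 0" if "dot p v = 0" for v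
    using peval_restrict_line[of v p h] by (simp add: h peval_zero line_pt_of_on_line[OF that])
  then show "dual_form P dvd h"
    unfolding dual_form_eq_lin p_def[symmetric] lin_dvd_iff[OF p_nonzero] by blast
qed

lemma line_point_ex:
  assumes "v 1 \<noteq> 0 \<or> v 2 \<noteq> 0"
  obtains x c where "x \<in> dual_line P" "c \<noteq> 0"
    "\<And>i. rep_proj2 x $ i = c * peval v (line_pt p i)"
proof -
  define u where "u = (\<chi> i. peval v (line_pt p i))"
  have "u $ 1 = v 1" "u $ 2 = v 2"
    by (simp_all add: u_def peval_line_pt)
  then have "u \<noteq> 0"
    using assms by auto
  then obtain x c where x: "c \<noteq> 0" "rep_proj2 x = c *s u"
    by (rule proj2_of_vector)
  have "(\<Sum>i\<in>UNIV. p $ i * rep_proj2 x $ i) = c * (\<Sum>i\<in>UNIV. p $ i * peval v (line_pt p i))"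
    by (simp add: x u_def sum_distrib_left algebra_simps)
  then have "x \<in> dual_line P"
    by (simp add: on_line_iff line_pt_on_line)
  then show ?thesis
    using that x by (simp add: u_def)
qed

lemma ev_line_point:
  assumes "\<And>i. rep_proj2 x $ i = c * peval v (line_pt p i)" "g \<in> forms d"
  shows "ev g x = c ^ nat d * peval v (restrict_line p g)"
proof -
  have "(($) (rep_proj2 x)) = (\<lambda>i. c * peval v (line_pt p i))"
    using assms(1) by auto
  then show ?thesis
    using assms(2) by (simp add: ev_def peval_homogeneous_scale peval_restrict_line)
qed

lemma rep_coordinate_nonzero:
  assumes "x \<in> dual_line P"
  shows "rep_proj2 x $ 1 \<noteq> 0 \<or> rep_proj2 x $ 2 \<noteq> 0"
proof (rule ccontr)
  assume "\<not> ?thesis"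
  then have "rep_proj2 x $ 1 = 0" "rep_proj2 x $ 2 = 0" "rep_proj2 x $ 3 = 0"
    using assms p3 by (auto simp: on_line_iff sum_3)
  then have "rep_proj2 x = 0"
    by (simp add: vec_eq_iff forall_3)
  then show False
    using rep_proj2_nonzero by blast
qed

text \<open>A line is irreducible: the product of the polynomials in \<open>t\<^sub>1, t\<^sub>2\<close> that define the complements of the
  given open sets is not zero, so some point of the line avoids all of these complements.\<close>
lemma line_irreducible:
  assumes "finite A" "\<And>U. U \<in> A \<Longrightarrow> zariski_open U" "\<And>U. U \<in> A \<Longrightarrow> U \<inter> dual_line P \<noteq> {}"
  shows "\<exists>x\<in>dual_line P. \<forall>U\<in>A. x \<in> U"
proof -
  have "\<exists>h d. h \<in> forms d \<and> {x. ev h x \<noteq> 0} \<subseteq> U \<and> restrict_line p h \<noteq> 0" if U: "U \<in> A" for U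
  proof -
    obtain T where T: "\<forall>h\<in>T. \<exists>d. h \<in> forms d" "U = {x. \<exists>h\<in>T. ev h x \<noteq> 0}"
      using assms(2)[OF U] by (auto simp: zariski_open_def)
    obtain x where x: "x \<in> U" "x \<in> dual_line P"
      using assms(3)[OF U] by auto
    then obtain h where h: "h \<in> T" "ev h x \<noteq> 0"
      using T by auto
    then show ?thesis
      using T restrict_line_nonzero[OF x(2) h(2)] by blast
  qed
  then obtain h d where h: "\<And>U. U \<in> A \<Longrightarrow> h U \<in> forms (d U)"
    "\<And>U. U \<in> A \<Longrightarrow> {x. ev (h U) x \<noteq> 0} \<subseteq> U" "\<And>U. U \<in> A \<Longrightarrow> restrict_line p (h U) \<noteq> 0"
    by metis
  define q where "q = Var 1 * (\<Prod>U\<in>A. restrict_line p (h U))"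
  have "q \<noteq> 0"
    using assms(1) h(3) prime_Var by (auto simp: q_def prime_elem_def)
  then obtain v where v: "peval v q \<noteq> 0"
    using peval_nonzero_ex by blast
  then have v1: "v 1 \<noteq> 0" and vU: "\<And>U. U \<in> A \<Longrightarrow> peval v (restrict_line p (h U)) \<noteq> 0"
    using assms(1) by (auto simp: q_def peval_mult peval_prod peval_Var)
  obtain x c where x: "x \<in> dual_line P" "c \<noteq> 0"
    "\<And>i. rep_proj2 x $ i = c * peval v (line_pt p i)"
    using line_point_ex[of v] v1 by metis
  have "x \<in> U" if "U \<in> A" for U
    using h(2)[OF that] ev_line_point[OF x(3) h(1)[OF that]] x(2) vU[OF that] by auto
  then show ?thesis
    using x(1) by blast
qed

lemma charts_meet: "\<exists>x. x \<in> chart P 1 \<inter> chart P 2"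
proof -
  obtain x c where "x \<in> dual_line P" "c \<noteq> 0"
    "\<And>i. rep_proj2 x $ i = c * peval (\<lambda>_. 1) (line_pt p i)"
    using line_point_ex[of "\<lambda>_. 1"] by (metis zero_neq_one)
  then show ?thesis
    by (auto simp: chart_def peval_line_pt)
qed

lemma chart_point_ex: "i \<noteq> 3 \<Longrightarrow> \<exists>x. x \<in> chart P i"
  using charts_meet exhaust_3[of i] by auto

lemma open_chart: "open_in_line P (chart P i)"
proof -
  have "chart P i = dual_line P \<inter> {x. ev (Var i) x \<noteq> 0}"
    by (auto simp: chart_def ev_Var)
  then show ?thesis
    unfolding open_in_line_def using zariski_open_form[OF forms_Var] by blast
qed

lemma open_chart_Int: "open_in_line P (chart P i \<inter> chart P j)"
proof -
  have "chart P i \<inter> chart P j = dual_line P \<inter> {x. ev (Var i * Var j) x \<noteq> 0}"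
    by (auto simp: chart_def ev_Var ev_mult)
  then show ?thesis
    unfolding open_in_line_def using zariski_open_form[OF forms_mult[OF forms_Var forms_Var]] by blast
qed

end

section \<open>Modules realized by polynomials on the line\<close>

text \<open>The polynomial \<open>\<rho> m\<close> depends on the parameters \<open>t\<^sub>1, t\<^sub>2\<close> of the line and on \<open>s\<close>; scalars act
  through their restriction to the line. The last assumption is faithfulness: an element represented by
  zero lies, up to a scalar that does not vanish at \<open>x\<close>, in the ideal of the line times the module. The
  numbers \<open>e\<close> and \<open>k\<close> record by how much \<open>\<rho>\<close> raises the degree and which degree in \<open>s\<close> may occur.\<close>
locale realization = line_chart P p
  for P :: proj2 and p :: "complex ^ 3" +
  fixes M :: "'m::ab_group_add gmod" and \<rho> :: "'m \<Rightarrow> poly3" and e :: int and k :: nat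
  assumes module_scl: "module (scl M)"
    and hom_add: "m \<in> hom M d \<Longrightarrow> m' \<in> hom M d \<Longrightarrow> m + m' \<in> hom M d"
    and hom_diff: "m \<in> hom M d \<Longrightarrow> m' \<in> hom M d \<Longrightarrow> m - m' \<in> hom M d"
    and hom_scl: "h \<in> forms c \<Longrightarrow> m \<in> hom M d \<Longrightarrow> scl M h m \<in> hom M (c + d)"
    and den_scl: "m \<in> den M \<Longrightarrow> scl M h m \<in> den M"
    and \<rho>_add: "\<rho> (m + m') = \<rho> m + \<rho> m'"
    and \<rho>_scl: "\<rho> (scl M h m) = restrict_line p h * \<rho> m"
    and \<rho>_den: "m \<in> den M \<Longrightarrow> \<rho> m = 0"
    and \<rho>_forms: "m \<in> hom M d \<Longrightarrow> \<rho> m \<in> forms (d + e)"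
    and \<rho>_deg3: "m \<in> hom M d \<Longrightarrow> deg3_le k (\<rho> m)"
    and \<rho>_kernel: "m \<in> hom M d \<Longrightarrow> \<rho> m = 0 \<Longrightarrow> x \<in> dual_line P \<Longrightarrow>
      \<exists>c h a. h \<in> forms c \<and> ev h x \<noteq> 0 \<and> a \<in> hom M (c + d - 1) \<and>
        scl M h m - scl M (dual_form P) a \<in> den M"
begin

lemma \<rho>_diff: "\<rho> (m - m') = \<rho> m - \<rho> m'"
  using \<rho>_add[of "m - m'" m'] by simp

abbreviation "val u \<equiv> Fract (\<rho> (fst u)) (restrict_line p (snd u))"

lemma stalk_iff: "u \<in> stalk p M \<rho> x \<phi> \<longleftrightarrow> u \<in> fracs M x \<and> val u = \<phi>"
  by (cases u) (simp add: stalk_def)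

lemma fracs_iff: "(m, g) \<in> fracs M x \<longleftrightarrow> (\<exists>d. m \<in> hom M d \<and> g \<in> forms d \<and> ev g x \<noteq> 0)"
  by (simp add: fracs_def)

text \<open>Equality in the stalk of the restricted sheaf is equality of fractions. In one direction the factors
  that do not vanish at \<open>x\<close> can be cancelled, as the polynomial ring is a domain; the other direction is
  faithfulness applied to \<open>g' m - g m'\<close>.\<close>
lemma restr_eq_iff:
  assumes x: "x \<in> dual_line P" and u: "(m, g) \<in> fracs M x" and u': "(m', g') \<in> fracs M x"
  shows "restr_eq M (dual_form P) x (m, g) (m', g') \<longleftrightarrow> val (m, g) = val (m', g')"
proof -
  interpret module "scl M" by (rule module_scl)
  let ?r = "restrict_line p" and ?\<delta> = "scl M g' m - scl M g m'"
  interpret r: ring_map ?r by (rule ring_map_restrict_line)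
  obtain d where d: "m \<in> hom M d" "g \<in> forms d" "ev g x \<noteq> 0"
    using u by (auto simp: fracs_iff)
  obtain d' where d': "m' \<in> hom M d'" "g' \<in> forms d'" "ev g' x \<noteq> 0"
    using u' by (auto simp: fracs_iff)
  have nz: "?r g \<noteq> 0" "?r g' \<noteq> 0"
    using restrict_line_nonzero x d d' by auto
  have \<delta>: "?\<delta> \<in> hom M (d + d')"
    using hom_diff[OF hom_scl[OF d'(2) d(1)]] hom_scl[OF d(2) d'(1)] by (simp add: add.commute)
  have \<rho>\<delta>: "\<rho> ?\<delta> = 0 \<longleftrightarrow> val (m, g) = val (m', g')"
    using nz by (simp add: \<rho>_diff \<rho>_scl eq_fract mult.commute)
  show ?thesis
    unfolding \<rho>\<delta>[symmetric]
  proof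
    assume "restr_eq M (dual_form P) x (m, g) (m', g')"
    then obtain a h h' where h: "ev h x \<noteq> 0" "ev h' x \<noteq> 0"
      "scl M h' (scl M h ?\<delta> - scl M (g * g') (scl M (dual_form P) a)) \<in> den M"
      by (auto simp: restr_eq_def frac_eq_def)
    have "?r h' * (?r h * \<rho> ?\<delta>) = 0"
      using \<rho>_den[OF h(3)] by (simp add: \<rho>_scl \<rho>_diff r.mult restrict_line_dual_form)
    then show "\<rho> ?\<delta> = 0"
      using restrict_line_nonzero[OF x h(1)] restrict_line_nonzero[OF x h(2)] by simp
  next
    assume "\<rho> ?\<delta> = 0"
    then obtain c h a where h: "h \<in> forms c" "ev h x \<noteq> 0" "a \<in> hom M (c + (d + d') - 1)"
      and den: "scl M h ?\<delta> - scl M (dual_form P) a \<in> den M"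
      using \<rho>_kernel[OF \<delta> _ x] by blast
    have "scl M (g * g') (scl M h ?\<delta> - scl M (dual_form P) a) \<in> den M"
      using den by (rule den_scl)
    also have "scl M (g * g') (scl M h ?\<delta> - scl M (dual_form P) a)
        = scl M 1 (scl M (h * (g * g')) ?\<delta> - scl M (g * g') (scl M (dual_form P) a))"
      by (simp add: scale_right_diff_distrib mult_ac)
    finally have "frac_eq M x (?\<delta>, g * g') (scl M (dual_form P) a, h * (g * g'))"
      unfolding frac_eq_def prod.case
      by (intro exI[of _ 0] exI[of _ 1]) (simp add: forms_one ev_one)
    moreover have "h * (g * g') \<in> forms (c + (d + d'))"
      by (intro forms_mult h d d')
    moreover have "ev (h * (g * g')) x \<noteq> 0"
      using h d d' by (simp add: ev_mult)
    ultimately show "restr_eq M (dual_form P) x (m, g) (m', g')"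
      unfolding restr_eq_def prod.case using h(3) by blast
  qed
qed

lemma germ_eq_stalk:
  "x \<in> dual_line P \<Longrightarrow> u \<in> fracs M x \<Longrightarrow> germ M (dual_form P) x u = stalk p M \<rho> x (val u)"
  by (cases u) (auto simp: germ_def stalk_iff restr_eq_iff)

lemma stalk_inj:
  assumes "stalk p M \<rho> x \<phi> = stalk p M \<rho> x \<psi>" "stalk p M \<rho> x \<phi> \<noteq> {}"
  shows "\<phi> = \<psi>"
  using assms by (metis all_not_in_conv stalk_iff)

lemma stalk_add_mem:
  assumes x: "x \<in> dual_line P" and u: "(m, g) \<in> stalk p M \<rho> x \<phi>" and u': "(m', g') \<in> stalk p M \<rho> x \<psi>"
  shows "(scl M g' m + scl M g m', g * g') \<in> stalk p M \<rho> x (\<phi> + \<psi>)"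
proof -
  let ?r = "restrict_line p"
  interpret r: ring_map ?r by (rule ring_map_restrict_line)
  obtain d where d: "m \<in> hom M d" "g \<in> forms d" "ev g x \<noteq> 0"
    using u by (auto simp: stalk_iff fracs_iff)
  obtain d' where d': "m' \<in> hom M d'" "g' \<in> forms d'" "ev g' x \<noteq> 0"
    using u' by (auto simp: stalk_iff fracs_iff)
  have nz: "?r g \<noteq> 0" "?r g' \<noteq> 0"
    using restrict_line_nonzero x d d' by auto
  have "scl M g' m + scl M g m' \<in> hom M (d + d')"
    using hom_add[OF hom_scl[OF d'(2) d(1)]] hom_scl[OF d(2) d'(1)] by (simp add: add.commute)
  then have "(scl M g' m + scl M g m', g * g') \<in> fracs M x"
    using d d' forms_mult[OF d(2) d'(2)] by (auto simp: fracs_iff ev_mult)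
  moreover have "val (scl M g' m + scl M g m', g * g') = \<phi> + \<psi>"
    using u u' nz by (auto simp: stalk_iff \<rho>_add \<rho>_scl r.mult mult.commute)
  ultimately show ?thesis
    by (simp add: stalk_iff)
qed

lemma germ_add_stalk:
  assumes x: "x \<in> dual_line P" and ne: "stalk p M \<rho> x \<phi> \<noteq> {}" "stalk p M \<rho> x \<psi> \<noteq> {}"
  shows "germ_add M (dual_form P) x (stalk p M \<rho> x \<phi>) (stalk p M \<rho> x \<psi>) = stalk p M \<rho> x (\<phi> + \<psi>)"
proof -
  have *: "germ M (dual_form P) x (scl M g' m + scl M g m', g * g') = stalk p M \<rho> x (\<phi> + \<psi>)"
    if "(m, g) \<in> stalk p M \<rho> x \<phi>" "(m', g') \<in> stalk p M \<rho> x \<psi>" for m g m' g'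
    using stalk_add_mem[OF x that] by (simp add: germ_eq_stalk[OF x] stalk_iff)
  obtain m g m' g' where "(m, g) \<in> stalk p M \<rho> x \<phi>" "(m', g') \<in> stalk p M \<rho> x \<psi>"
    using ne by fast
  with * show ?thesis
    unfolding germ_add_def by (fastforce simp del: fst_conv snd_conv)
qed

abbreviation "stalk0 \<equiv> stalk p (twist 0) (restrict_line p)"

lemma stalk_scl_mem:
  assumes x: "x \<in> dual_line P" and u: "(u, v) \<in> stalk0 x \<gamma>" and m: "(m, g) \<in> stalk p M \<rho> x \<phi>"
  shows "(scl M u m, v * g) \<in> stalk p M \<rho> x (\<gamma> * \<phi>)"
proof -
  let ?r = "restrict_line p"
  interpret r: ring_map ?r by (rule ring_map_restrict_line)
  obtain d where d: "m \<in> hom M d" "g \<in> forms d" "ev g x \<noteq> 0"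
    using m by (auto simp: stalk_iff fracs_iff)
  obtain c where c: "u \<in> forms c" "v \<in> forms c" "ev v x \<noteq> 0"
    using u by (auto simp: stalk_def fracs_def twist_def)
  have "(scl M u m, v * g) \<in> fracs M x"
    using hom_scl[OF c(1) d(1)] forms_mult[OF c(2) d(2)] c d by (auto simp: fracs_iff ev_mult)
  moreover have "val (scl M u m, v * g) = \<gamma> * \<phi>"
    using u m by (auto simp: stalk_def \<rho>_scl r.mult)
  ultimately show ?thesis
    by (simp add: stalk_iff)
qed

lemma germ_scl_stalk:
  assumes x: "x \<in> dual_line P" and ne: "stalk0 x \<gamma> \<noteq> {}" "stalk p M \<rho> x \<phi> \<noteq> {}"
  shows "germ_scl M (dual_form P) x (stalk0 x \<gamma>) (stalk p M \<rho> x \<phi>) = stalk p M \<rho> x (\<gamma> * \<phi>)"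
proof -
  have *: "germ M (dual_form P) x (scl M u m, v * g) = stalk p M \<rho> x (\<gamma> * \<phi>)"
    if "(u, v) \<in> stalk0 x \<gamma>" "(m, g) \<in> stalk p M \<rho> x \<phi>" for u v m g
    using stalk_scl_mem[OF x that] by (simp add: germ_eq_stalk[OF x] stalk_iff)
  obtain u v m g where "(u, v) \<in> stalk0 x \<gamma>" "(m, g) \<in> stalk p M \<rho> x \<phi>"
    using ne by fast
  with * show ?thesis
    unfolding germ_scl_def by (fastforce simp del: fst_conv snd_conv)
qed

definition regular :: "proj2 set \<Rightarrow> poly3 fract set" where
  "regular V = {\<phi>. \<forall>x\<in>V. stalk p M \<rho> x \<phi> \<noteq> {}}"

definition sect :: "proj2 set \<Rightarrow> poly3 fract \<Rightarrow> proj2 \<Rightarrow> ('m \<times> poly3) set" where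
  "sect V \<phi> x = (if x \<in> V then stalk p M \<rho> x \<phi> else {})"

lemma section_inj:
  assumes "V \<noteq> {}" "\<phi> \<in> regular V" "sect V \<phi> = sect V \<psi>"
  shows "\<phi> = \<psi>"
proof -
  obtain x where x: "x \<in> V"
    using assms(1) by blast
  then show ?thesis
    using assms(2) fun_cong[OF assms(3), of x] by (intro stalk_inj) (auto simp: sect_def regular_def)
qed

lemma regular_antimono: "V \<subseteq> W \<Longrightarrow> regular W \<subseteq> regular V"
  by (auto simp: regular_def)

lemma section_mem_sections_on:
  assumes V: "V \<subseteq> dual_line P" and \<phi>: "\<phi> \<in> regular V"
  shows "sect V \<phi> \<in> sections_on M P V"
  unfolding sections_on_def
proof (intro CollectI conjI allI ballI impI)
  fix x assume x: "x \<in> V"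
  then obtain m g where "(m, g) \<in> stalk p M \<rho> x \<phi>"
    using \<phi> unfolding regular_def by fast
  then obtain d where d: "m \<in> hom M d" "g \<in> forms d" "ev g x \<noteq> 0" and \<phi>: "val (m, g) = \<phi>"
    by (auto simp: stalk_iff fracs_iff)
  have "\<forall>y\<in>{y. ev g y \<noteq> 0} \<inter> V. ev g y \<noteq> 0 \<and> sect V \<phi> y = germ M (dual_form P) y (m, g)"
  proof (intro ballI conjI)
    fix y assume y: "y \<in> {y. ev g y \<noteq> 0} \<inter> V"
    then show "ev g y \<noteq> 0"
      by simp
    have "(m, g) \<in> fracs M y"
      using d y by (auto simp: fracs_iff)
    then show "sect V \<phi> y = germ M (dual_form P) y (m, g)"
      using y V by (auto simp: sect_def germ_eq_stalk \<phi> subset_iff simp del: fst_conv snd_conv)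
  qed
  then show "\<exists>W m g d. zariski_open W \<and> x \<in> W \<and> m \<in> hom M d \<and> g \<in> forms d \<and>
      (\<forall>y\<in>W \<inter> V. ev g y \<noteq> 0 \<and> sect V \<phi> y = germ M (dual_form P) y (m, g))"
    using zariski_open_form[OF d(2)] d by blast
qed (simp add: sect_def)

text \<open>A section is locally given by one fraction, hence by one element of the field. Since any two nonempty
  open sets of the line meet, this element is the same everywhere.\<close>
lemma sections_on_eq:
  assumes V: "open_in_line P V" "V \<noteq> {}"
  shows "sections_on M P V = sect V ` regular V"
proof
  have sub: "V \<subseteq> dual_line P"
    using V by (auto simp: open_in_line_def)
  then show "sect V ` regular V \<subseteq> sections_on M P V"
    using section_mem_sections_on by blast
  show "sections_on M P V \<subseteq> sect V ` regular V"
  proof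
    fix s assume s: "s \<in> sections_on M P V"
    obtain U where U: "zariski_open U" "V = dual_line P \<inter> U"
      using V by (auto simp: open_in_line_def)
    have loc: "\<exists>W u. zariski_open W \<and> x \<in> W \<and>
        (\<forall>y\<in>W \<inter> V. u \<in> fracs M y \<and> s y = stalk p M \<rho> y (val u))" if x: "x \<in> V" for x
    proof -
      obtain W m g d where W: "zariski_open W" "x \<in> W" "m \<in> hom M d" "g \<in> forms d"
        "\<forall>y\<in>W \<inter> V. ev g y \<noteq> 0 \<and> s y = germ M (dual_form P) y (m, g)"
        using s x unfolding sections_on_def by blast
      have "(m, g) \<in> fracs M y \<and> s y = stalk p M \<rho> y (val (m, g))" if "y \<in> W \<inter> V" for y
      proof -
        have "(m, g) \<in> fracs M y"
          using W that by (auto simp: fracs_iff)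
        then show ?thesis
          using W(5) that sub germ_eq_stalk[of y "(m, g)"] by blast
      qed
      then show ?thesis
        using W(1,2) by blast
    qed
    obtain x0 where x0: "x0 \<in> V"
      using V by blast
    obtain W0 u0 where W0: "zariski_open W0" "x0 \<in> W0"
      "\<forall>y\<in>W0 \<inter> V. u0 \<in> fracs M y \<and> s y = stalk p M \<rho> y (val u0)"
      using loc[OF x0] by blast
    have *: "s x = stalk p M \<rho> x (val u0) \<and> stalk p M \<rho> x (val u0) \<noteq> {}" if x: "x \<in> V" for x
    proof -
      obtain W u where W: "zariski_open W" "x \<in> W"
        "\<forall>y\<in>W \<inter> V. u \<in> fracs M y \<and> s y = stalk p M \<rho> y (val u)"
        using loc[OF x] by blast
      obtain y where "y \<in> dual_line P" "\<forall>U'\<in>{U, W0, W}. y \<in> U'"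
        using line_irreducible[of "{U, W0, W}"] U W0 W x x0 by auto
      then have y: "y \<in> V" "y \<in> W0 \<inter> V" "y \<in> W \<inter> V"
        using U by auto
      have "u \<in> stalk p M \<rho> y (val u)" "stalk p M \<rho> y (val u) = stalk p M \<rho> y (val u0)"
        using W(3) W0(3) y by (auto simp: stalk_iff)
      then have "val u = val u0"
        by (simp add: stalk_iff)
      moreover have "u \<in> fracs M x" "s x = stalk p M \<rho> x (val u)"
        using W x by auto
      ultimately show ?thesis
        by (auto simp: stalk_iff)
    qed
    have "s = sect V (val u0)"
      using * s by (auto simp: fun_eq_iff sect_def sections_on_def)
    moreover have "val u0 \<in> regular V"
      using * by (auto simp: regular_def)
    ultimately show "s \<in> sect V ` regular V"
      by blast
  qed
qed

lemma regular_add: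
  "V \<subseteq> dual_line P \<Longrightarrow> \<phi> \<in> regular V \<Longrightarrow> \<psi> \<in> regular V \<Longrightarrow> \<phi> + \<psi> \<in> regular V"
  unfolding regular_def by (fastforce dest: stalk_add_mem)

lemma sadd_section:
  assumes "V \<subseteq> dual_line P" "\<phi> \<in> regular V" "\<psi> \<in> regular V"
  shows "sadd (sheaf_on_line M P) (sect V \<phi>) (sect V \<psi>) = sect V (\<phi> + \<psi>)"
proof
  fix x
  show "sadd (sheaf_on_line M P) (sect V \<phi>) (sect V \<psi>) x = sect V (\<phi> + \<psi>) x"
  proof (cases "x \<in> V")
    case True
    then show ?thesis
      using assms germ_add_stalk[of x \<phi> \<psi>] by (auto simp: sheaf_on_line_def sect_def regular_def)
  qed (simp add: sheaf_on_line_def sect_def germ_add_def)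
qed

lemma sscl_section:
  assumes "V \<subseteq> dual_line P" "\<And>x. x \<in> V \<Longrightarrow> stalk0 x \<gamma> \<noteq> {}" "\<phi> \<in> regular V"
  shows "sscl (sheaf_on_line M P) (\<lambda>x. if x \<in> V then stalk0 x \<gamma> else {}) (sect V \<phi>) = sect V (\<gamma> * \<phi>)"
proof
  fix x
  show "sscl (sheaf_on_line M P) (\<lambda>x. if x \<in> V then stalk0 x \<gamma> else {}) (sect V \<phi>) x = sect V (\<gamma> * \<phi>) x"
  proof (cases "x \<in> V")
    case True
    then show ?thesis
      using assms germ_scl_stalk[of x \<gamma> \<phi>] by (auto simp: sheaf_on_line_def sect_def regular_def)
  qed (simp add: sheaf_on_line_def sect_def germ_scl_def)
qed

lemma regular_scl:
  assumes "V \<subseteq> dual_line P" "\<And>x. x \<in> V \<Longrightarrow> stalk0 x \<gamma> \<noteq> {}" "\<phi> \<in> regular V"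
  shows "\<gamma> * \<phi> \<in> regular V"
  unfolding regular_def
proof (intro CollectI ballI)
  fix x assume x: "x \<in> V"
  then obtain u v m g where "(u, v) \<in> stalk0 x \<gamma>" "(m, g) \<in> stalk p M \<rho> x \<phi>"
    using assms(2)[OF x] assms(3) unfolding regular_def by fast
  then show "stalk p M \<rho> x (\<gamma> * \<phi>) \<noteq> {}"
    using stalk_scl_mem x assms(1) by blast
qed

lemma res_section:
  "V' \<subseteq> V \<Longrightarrow> res (sheaf_on_line M P) V' (sect V \<phi>) = sect V' \<phi>"
  by (auto simp: sheaf_on_line_def sect_def fun_eq_iff)

section \<open>Global sections of the twists\<close>

text \<open>On the chart where \<open>t\<^sub>i\<close> does not vanish, a regular fraction has a power of \<open>t\<^sub>i\<close> as denominator. Take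
  a denominator \<open>h\<close> in \<open>t\<^sub>1, t\<^sub>2\<close> of minimal degree. If it had a zero in the chart, it would be divisible by
  the linear form of that zero; comparison with a fraction that is regular at this point shows that the
  numerator is divisible too, against minimality. By the fundamental theorem of algebra a form in two
  variables without zeros in the chart is a multiple of a power of \<open>t\<^sub>i\<close>.\<close>
lemma chart_denominator:
  assumes i: "i \<noteq> 3" and \<phi>: "\<phi> \<in> regular (chart P i)"
  shows "\<exists>C n. \<phi> = Fract C (Var i ^ n)"
proof -
  define D where "D n \<longleftrightarrow> (\<exists>h C. h \<in> forms (int n) \<and> deg3_le 0 h \<and> h \<noteq> 0 \<and> \<phi> = Fract C h)" for n
  have local: "\<exists>m g d. g \<in> forms d \<and> ev g x \<noteq> 0 \<and> \<phi> = Fract (\<rho> m) (restrict_line p g)" if "x \<in> chart P i" for x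
    using \<phi> that by (fastforce simp: regular_def stalk_def fracs_def)
  have "\<exists>n. D n"
  proof -
    obtain x where x: "x \<in> chart P i"
      using chart_point_ex[OF i] by blast
    obtain m g d where g: "g \<in> forms d" "ev g x \<noteq> 0" "\<phi> = Fract (\<rho> m) (restrict_line p g)"
      using local[OF x] by blast
    have nz: "restrict_line p g \<noteq> 0"
      using restrict_line_nonzero g x by (auto simp: chart_def)
    have f: "restrict_line p g \<in> forms d"
      by (rule restrict_line_forms[OF g(1)])
    obtain u where "u \<in> keys (restrict_line p g)"
      using nz by (metis all_not_in_conv keys_eq_empty)
    from formsD[OF f this] have "d = int (mdeg u)" by simp
    then show ?thesis
      unfolding D_def using f nz g(3) deg3_le_restrict_line by blast
  qed
  then obtain n where n: "D n" "\<And>n'. n' < n \<Longrightarrow> \<not> D n'"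
    using exists_least_iff[of D] by blast
  obtain h C where h: "h \<in> forms (int n)" "deg3_le 0 h" "h \<noteq> 0" "\<phi> = Fract C h"
    using n(1) by (auto simp: D_def)
  have noroot: "peval v h \<noteq> 0" if v: "v i \<noteq> 0" for v
  proof
    assume root: "peval v h = 0"
    \<comment> \<open>the linear form in \<open>t\<^sub>1, t\<^sub>2\<close> that vanishes at \<open>v\<close>\<close>
    define c :: "complex ^ 3" where "c = vector [v 2, - v 1, 0]"
    have i12: "i = 1 \<or> i = 2"
      using i exhaust_3[of i] by blast
    have c0: "c \<noteq> 0"
      using v i12 by (auto simp: c_def vec_eq_iff forall_3)
    have sum_c: "dot c u = v 2 * u 1 - v 1 * u 2" for u
      by (simp add: c_def sum_3)
    have "lin c dvd h"
      unfolding lin_dvd_iff[OF c0]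
    proof (intro allI impI)
      fix u :: "3 \<Rightarrow> complex"
      assume u: "dot c u = 0"
      have "u 1 = u i / v i * v 1 \<and> u 2 = u i / v i * v 2"
        using u[unfolded sum_c] v i12 by (auto simp: field_simps)
      then have "peval u h = peval (\<lambda>k. u i / v i * v k) h"
        by (intro peval_deg3_le_0[OF h(2)]) auto
      then show "peval u h = 0"
        by (simp only: peval_homogeneous_scale[OF h(1)] root mult_zero_right)
    qed
    then obtain h' where h': "h = lin c * h'" by blast
    obtain x b where x: "x \<in> dual_line P" "b \<noteq> 0" "\<And>k. rep_proj2 x $ k = b * peval v (line_pt p k)"
      using line_point_ex[of v] v i12 by metis
    have xi: "x \<in> chart P i"
      using x i v by (auto simp: chart_def peval_line_pt)
    obtain m g d where g: "g \<in> forms d" "ev g x \<noteq> 0" "\<phi> = Fract (\<rho> m) (restrict_line p g)"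
      using local[OF xi] by blast
    have "C * restrict_line p g = \<rho> m * h"
      using g(3) h(3,4) restrict_line_nonzero[OF x(1) g(2)] by (simp add: eq_fract)
    then have "lin c dvd C * restrict_line p g"
      by (simp add: h')
    moreover have "\<not> lin c dvd restrict_line p g"
    proof
      assume "lin c dvd restrict_line p g"
      then have "peval v (restrict_line p g) = 0"
        unfolding lin_dvd_iff[OF c0] by (simp add: sum_c)
      then show False
        using g(2) ev_line_point[OF x(3) g(1)] by simp
    qed
    ultimately have "lin c dvd C"
      using prime_lin[OF c0] by (simp add: prime_elem_dvd_mult_iff)
    then obtain C' where C': "C = lin c * C'" by blast
    have h'0: "h' \<noteq> 0"
      using h(3) h' by auto
    have h'f: "h' \<in> forms (int n - 1)"
      by (rule forms_cofactor[OF lin_nonzero[OF c0] forms_lin]) (use h h' in simp)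
    obtain u where "u \<in> keys h'"
      using h'0 by (metis all_not_in_conv keys_eq_empty)
    from formsD[OF h'f this] have n1: "int (n - 1) = int n - 1" "n - 1 < n"
      by auto
    have "deg3_le 0 (lin c)"
      using deg3_le_lin[of c] by (simp add: c_def)
    then have "deg3_le 0 h'"
      using deg3_le_cofactor[OF lin_nonzero[OF c0]] h(2) h' by blast
    moreover have "\<phi> = Fract C' h'"
      using h(3,4) by (simp add: C' h' eq_fract)
    ultimately have "D (n - 1)"
      unfolding D_def n1(1) using h'0 h'f by blast
    with n(2) n1(2) show False
      by blast
  qed
  define q where "q = hsub (\<lambda>a. [:a:]) (\<lambda>k. if k = i then 1 else if k = 3 then 0 else [:0, 1:]) h"
  have q: "poly q z = peval (\<lambda>k. if k = i then 1 else if k = 3 then 0 else z) h" for z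
  proof -
    have "ring_map (\<lambda>q. poly q z)"
      by unfold_locales simp_all
    from hsub_comp[OF this, of "\<lambda>a. [:a:]" "\<lambda>k. if k = i then 1 else if k = 3 then 0 else [:0, 1:]" h]
    show ?thesis
      by (simp add: q_def peval_eq_hsub if_distrib[of "\<lambda>q. poly q z"] cong: if_cong)
  qed
  have "constant (poly q)"
  proof (rule ccontr)
    assume "\<not> constant (poly q)"
    then obtain z where "poly q z = 0"
      using fundamental_theorem_of_algebra by blast
    then show False
      using noroot by (simp add: q)
  qed
  then have qc: "poly q z = poly q 0" for z
    unfolding constant_def by blast
  \<comment> \<open>The factor \<open>Var i\<close> makes the comparison trivial outside of the chart.\<close>
  have "h * Var i = (cst (poly q 0) * Var i ^ n) * Var i"
  proof (rule peval_eqI)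
    fix v :: "3 \<Rightarrow> complex"
    have "peval v h = poly q 0 * v i ^ n" if v: "v i \<noteq> 0"
    proof -
      define z where "z = (if i = 1 then v 2 else v 1) / v i"
      have "peval v h = peval (\<lambda>k. v i * (if k = i then 1 else if k = 3 then 0 else z)) h"
        using v i exhaust_3[of i] by (intro peval_deg3_le_0[OF h(2)]) (auto simp: z_def)
      also have "\<dots> = v i ^ n * poly q z"
        by (simp only: peval_homogeneous_scale[OF h(1)] q nat_int)
      finally show ?thesis
        by (simp add: qc[of z])
    qed
    then show "peval v (h * Var i) = peval v ((cst (poly q 0) * Var i ^ n) * Var i)"
      by (cases "v i = 0") (simp_all add: peval_mult peval_Var peval_power peval_cst)
  qed
  then have h_eq: "h = cst (poly q 0) * Var i ^ n"
    using prime_Var[of i] by (simp add: prime_elem_def)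
  have q0: "poly q 0 \<noteq> 0"
    using h(3) h_eq by auto
  have "\<phi> = Fract (cst (1 / poly q 0) * C) (Var i ^ n)"
  proof -
    have "cst (1 / poly q 0) * cst (poly q 0) = (1 :: poly3)"
      using q0 by (simp add: mult_single)
    moreover have "(cst (1 / poly q 0) * C) * (cst (poly q 0) * Var i ^ n)
        = (cst (1 / poly q 0) * cst (poly q 0)) * (C * Var i ^ n)"
      by (simp only: ac_simps)
    ultimately have "C * Var i ^ n = (cst (1 / poly q 0) * C) * (cst (poly q 0) * Var i ^ n)"
      by simp
    then show ?thesis
      using h(3,4) prime_Var[of i] by (simp add: h_eq eq_fract prime_elem_def)
  qed
  then show ?thesis
    by blast
qed


text \<open>The gluing condition says that \<open>\<phi> t\<^sub>1\<^sup>j = \<psi> t\<^sub>2\<^sup>j\<close>. This common value has a power of \<open>t\<^sub>1\<close> as one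
  denominator and a power of \<open>t\<^sub>2\<close> as another, so it is a polynomial.\<close>
lemma global_twisted_section:
  assumes \<phi>: "\<phi> \<in> regular (chart P 1)" and \<psi>: "\<psi> \<in> regular (chart P 2)"
    and glue: "\<psi> * Fract (Var 2 ^ j) 1 = \<phi> * Fract (Var 1 ^ j) 1"
  shows "\<exists>G. \<phi> = Fract G (Var 1 ^ j) \<and> \<psi> = Fract G (Var 2 ^ j)"
proof -
  obtain C n where C: "\<phi> = Fract C (Var 1 ^ n)"
    using chart_denominator[OF _ \<phi>] by auto
  obtain D n' where D: "\<psi> = Fract D (Var 2 ^ n')"
    using chart_denominator[OF _ \<psi>] by auto
  have eq: "D * Var 2 ^ j * Var 1 ^ n = C * Var 1 ^ j * Var 2 ^ n'"
    using glue by (simp add: C D eq_fract Var_nonzero)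
  have nd: "\<not> (Var 1 :: poly3) dvd Var 2 ^ n'"
    using prime_elem_dvd_power[OF prime_Var, of 1 "Var 2" n'] Var_dvd_iff[of 1 2] by auto
  have "(Var 1 :: poly3) ^ n dvd C * Var 1 ^ j"
    by (rule power_dvd_cancel_prime[OF prime_Var nd]) (simp flip: eq)
  then obtain G where G: "C * Var 1 ^ j = G * Var 1 ^ n"
    by (metis dvdE mult.commute)
  have "D * Var 2 ^ j * Var 1 ^ n = G * Var 2 ^ n' * Var 1 ^ n"
    unfolding eq G by (simp add: ac_simps)
  then have "D * Var 2 ^ j = G * Var 2 ^ n'"
    using Var_nonzero by simp
  then show ?thesis
    using G by (auto simp: C D eq_fract Var_nonzero)
qed

lemma numerator_homogeneous:
  assumes "Fract G (Var i ^ j) \<in> regular (chart P i)" "i \<noteq> 3"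
  shows "G \<in> forms (int j + e)" "deg3_le k G"
proof -
  obtain x where x: "x \<in> chart P i"
    using chart_point_ex[OF assms(2)] by blast
  then obtain m g d where g: "m \<in> hom M d" "g \<in> forms d" "ev g x \<noteq> 0"
    "Fract (\<rho> m) (restrict_line p g) = Fract G (Var i ^ j)"
    using assms(1) by (fastforce simp: regular_def stalk_def fracs_def)
  have nz: "restrict_line p g \<noteq> 0"
    using restrict_line_nonzero g x by (auto simp: chart_def)
  have eq: "restrict_line p g * G = \<rho> m * Var i ^ j"
    using g(4) nz by (simp add: eq_fract Var_nonzero mult.commute)
  have "restrict_line p g * G \<in> forms ((d + e) + int j * 1)"
    unfolding eq by (intro forms_mult \<rho>_forms[OF g(1)] forms_power forms_Var)
  from forms_cofactor[OF nz restrict_line_forms[OF g(2)] this]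
  show "G \<in> forms (int j + e)"
    by (simp add: algebra_simps)
  have "deg3_le (k + 0 * j) (\<rho> m * Var i ^ j)"
    using assms(2) deg3_le_Var[of i] by (intro deg3_le_mult deg3_le_power \<rho>_deg3[OF g(1)]) auto
  then show "deg3_le k G"
    using deg3_le_cofactor[OF nz deg3_le_restrict_line] eq by simp
qed

text \<open>Global sections of the \<open>j\<close>-th twist of the sheaf, where the section \<open>G / t\<^sub>i\<^sup>j\<close> over the \<open>i\<close>-th chart
  is identified with its common numerator \<open>G\<close>.\<close>
definition twisted_sections :: "nat \<Rightarrow> poly3 set" where
  "twisted_sections j = {G. Fract G (Var 1 ^ j) \<in> regular (chart P 1) \<and>
     Fract G (Var 2 ^ j) \<in> regular (chart P 2)}"

end

section \<open>Line bundles on the line\<close>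

lemma hom_twist: "hom (twist n) d = forms (d + n)"
  by (simp add: twist_def)

context line_chart
begin

lemma restrict_line_binary: "deg3_le 0 G \<Longrightarrow> restrict_line p G = G"
  by (rule peval_eqI, unfold peval_restrict_line, erule peval_deg3_le_0)
     (simp_all add: peval_line_pt)

text \<open>Faithfulness is the fact that a form which vanishes on the line is divisible by its equation.\<close>
lemma realization_twist: "realization P p (twist n) (restrict_line p) n 0"
proof unfold_locales
  interpret r: ring_map "restrict_line p" by (rule ring_map_restrict_line)
  fix m m' h :: poly3 and d c x
  show "restrict_line p (m + m') = restrict_line p m + restrict_line p m'"
    by (rule r.add)
  show "restrict_line p (scl (twist n) h m) = restrict_line p h * restrict_line p m"
    by (simp add: twist_def r.mult)
  show "m \<in> den (twist n) \<Longrightarrow> restrict_line p m = 0"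
    by (simp add: twist_def r.zero)
  show "m \<in> hom (twist n) d \<Longrightarrow> restrict_line p m \<in> forms (d + n)"
    by (simp add: twist_def restrict_line_forms)
  show "m \<in> hom (twist n) d \<Longrightarrow> deg3_le 0 (restrict_line p m)"
    by (rule deg3_le_restrict_line)
  assume m: "m \<in> hom (twist n) d" and "restrict_line p m = 0"
  then obtain a where a: "m = dual_form P * a"
    unfolding restrict_line_eq_0_iff by blast
  have "a \<in> forms ((d + n) - 1)"
    using m lin_nonzero[OF p_nonzero] unfolding a dual_form_eq_lin p_def[symmetric]
    by (intro forms_cofactor[OF _ forms_lin]) (auto simp: twist_def)
  then show "\<exists>c h a. h \<in> forms c \<and> ev h x \<noteq> 0 \<and> a \<in> hom (twist n) (c + d - 1) \<and>
      scl (twist n) h m - scl (twist n) (dual_form P) a \<in> den (twist n)"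
    by (intro exI[of _ 0] exI[of _ 1] exI[of _ a])
       (simp add: forms_one ev_one twist_def a algebra_simps)
qed (auto simp: twist_def algebra_simps intro: forms_add forms_diff dest: forms_mult)

text \<open>The space \<open>H\<^sup>0(L, \<O>(j + n))\<close>.\<close>
lemma twisted_sections_twist:
  "realization.twisted_sections P p (twist n) (restrict_line p) j = {G \<in> forms (int j + n). deg3_le 0 G}"
proof -
  interpret realization P p "twist n" "restrict_line p" n 0 by (rule realization_twist)
  have "Fract G (Var i ^ j) \<in> regular (chart P i)"
    if G: "G \<in> forms (int j + n)" "deg3_le 0 G" and i: "i \<noteq> 3" for G i
  proof -
    interpret r: ring_map "restrict_line p" by (rule ring_map_restrict_line)
    have "Var i ^ j \<in> forms (int j)"
      using forms_power[OF forms_Var, of i j] by simp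
    then have "(G, Var i ^ j) \<in> stalk p (twist n) (restrict_line p) x (Fract G (Var i ^ j))"
      if "x \<in> chart P i" for x
      using G that i by (auto simp: stalk_iff fracs_iff hom_twist chart_def ev_power ev_Var r.power
          restrict_line_Var restrict_line_binary)
    then show ?thesis
      by (auto simp: regular_def)
  qed
  then show ?thesis
    using numerator_homogeneous by (fastforce simp: twisted_sections_def)
qed

end

section \<open>Syzygies and the gradient of the arrangement\<close>

definition coeff_forms :: "int \<Rightarrow> poly3 tripoly set" where
  "coeff_forms d = {\<theta>. \<forall>m. lookup \<theta> m \<in> forms d}"

lemma coeff_forms_zero: "0 \<in> coeff_forms d"
  by (simp add: coeff_forms_def forms_zero)

lemma coeff_forms_add: "\<theta> \<in> coeff_forms d \<Longrightarrow> \<eta> \<in> coeff_forms d \<Longrightarrow> \<theta> + \<eta> \<in> coeff_forms d"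
  by (simp add: coeff_forms_def lookup_add forms_add)

lemma coeff_forms_diff: "\<theta> \<in> coeff_forms d \<Longrightarrow> \<eta> \<in> coeff_forms d \<Longrightarrow> \<theta> - \<eta> \<in> coeff_forms d"
  by (simp add: coeff_forms_def lookup_minus forms_diff)

lemma coeff_forms_sum: "(\<And>a. a \<in> A \<Longrightarrow> f a \<in> coeff_forms d) \<Longrightarrow> sum f A \<in> coeff_forms d"
  by (induction A rule: infinite_finite_induct) (simp_all add: coeff_forms_zero coeff_forms_add)

lemma coeff_forms_single: "a \<in> forms d \<Longrightarrow> single m a \<in> coeff_forms d"
  by (simp add: coeff_forms_def lookup_single when_def forms_zero)

lemma coeff_forms_Var: "Var i \<in> coeff_forms 0"
  unfolding Var_def by (intro coeff_forms_single forms_one)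

lemma coeff_forms_mult:
  assumes "\<theta> \<in> coeff_forms d" "\<eta> \<in> coeff_forms e"
  shows "\<theta> * \<eta> \<in> coeff_forms (d + e)"
proof -
  let ?s = "\<lambda>\<theta> m. single m (lookup \<theta> m)"
  have "\<theta> * \<eta> = (\<Sum>m\<in>keys \<theta>. \<Sum>n\<in>keys \<eta>. ?s \<theta> m * ?s \<eta> n)"
    using arg_cong2[OF monomial_expansion[of \<theta>] monomial_expansion[of \<eta>], of "(*)"]
    by (simp only: sum_product)
  also have "\<dots> \<in> coeff_forms (d + e)"
    unfolding mult_single
    by (intro coeff_forms_sum coeff_forms_single forms_mult) (use assms in \<open>auto simp: coeff_forms_def\<close>)
  finally show ?thesis .
qed

lemma coeff_forms_cmul: "h \<in> forms d \<Longrightarrow> \<theta> \<in> coeff_forms e \<Longrightarrow> cmul h \<theta> \<in> coeff_forms (d + e)"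
  unfolding cmul_def by (intro coeff_forms_mult coeff_forms_single)

lemma coeff_forms_one: "1 \<in> coeff_forms 0"
  using coeff_forms_single[OF forms_one, of 0] by simp

lemma coeff_forms_power: "\<theta> \<in> coeff_forms d \<Longrightarrow> \<theta> ^ n \<in> coeff_forms (int n * d)"
proof (induction n)
  case (Suc n)
  then show ?case
    using coeff_forms_mult[of \<theta> d "\<theta> ^ n" "int n * d"] by (simp add: algebra_simps)
qed (simp add: coeff_forms_one)

lemma coeff_forms_prod:
  "(\<And>a. a \<in> A \<Longrightarrow> f a \<in> coeff_forms (d a)) \<Longrightarrow> prod f A \<in> coeff_forms (\<Sum>a\<in>A. d a)"
  by (induction A rule: infinite_finite_induct) (simp_all add: coeff_forms_one coeff_forms_mult)

lemma coeff_forms_hsub: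
  assumes "\<And>m. c (lookup \<theta> m) \<in> coeff_forms d" "\<And>i. w i \<in> coeff_forms 1" "\<theta> \<in> forms e"
  shows "hsub c w \<theta> \<in> coeff_forms (d + e)"
  unfolding hsub_def
proof (rule coeff_forms_sum)
  fix m assume m: "m \<in> keys \<theta>"
  have "(\<Prod>i\<in>UNIV. w i ^ lookup m i) \<in> coeff_forms (\<Sum>i\<in>UNIV. int (lookup m i) * 1)"
    by (intro coeff_forms_prod coeff_forms_power assms)
  moreover have "(\<Sum>i\<in>UNIV. int (lookup m i) * 1) = e"
    using formsD[OF assms(3) m] by (simp add: mdeg_def)
  ultimately have "(\<Prod>i\<in>UNIV. w i ^ lookup m i) \<in> coeff_forms e"
    by (simp only:)
  with assms(1) show "c (lookup \<theta> m) * (\<Prod>i\<in>UNIV. w i ^ lookup m i) \<in> coeff_forms (d + e)"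
    by (rule coeff_forms_mult)
qed

lemma lookup_cmul: "lookup (cmul a p) m = a * lookup p m"
proof (induction p rule: tripoly_induct)
  case (single n b)
  show ?case
    by (simp add: cmul_def mult_single lookup_single when_def)
qed (simp add: cmul_def distrib_left lookup_add)

text \<open>A homomorphism applied to the coefficients alone.\<close>
lemma lookup_map_coeffs:
  fixes c :: "'a::comm_ring_1 \<Rightarrow> 'b::comm_ring_1"
  assumes "ring_map c"
  shows "lookup (hsub (\<lambda>a. cst (c a)) Var p) m = c (lookup p m)"
proof -
  interpret c: ring_map c by fact
  interpret cc: ring_map "\<lambda>a. cst (c a) :: 'b tripoly"
    by (rule ring_map_comp[OF assms ring_map_cst])
  show ?thesis
  proof (induction p rule: tripoly_induct)
    case (single n b)
    show ?case
      by (simp add: cc.hsub_single monomial_product mult_single lookup_single when_def c.zero)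
  qed (simp add: cc.hsub_add lookup_add c.add)
qed

lemma syz_map_eq: "syz_map f \<theta> = hsub (\<lambda>a. a) (\<lambda>i. pdiff i f) \<theta>"
  by (simp add: syz_map_def peval_eq_hsub)

lemma ring_map_syz_map: "ring_map (syz_map f)"
  unfolding syz_map_eq by (intro ring_map.ring_map_hsub ring_map_id)

lemma syz_map_cmul: "syz_map f (cmul h \<theta>) = h * syz_map f \<theta>"
  by (simp add: syz_map_eq ring_map.hsub_cmul ring_map_id)

lemma peval_syz_map:
  "peval v (syz_map f \<theta>) = hsub (peval v) (\<lambda>i. peval v (pdiff i f)) \<theta>"
  by (simp add: syz_map_eq hsub_comp[OF ring_map_peval])

lemma syz_map_euler: "syz_map f euler = (\<Sum>i\<in>UNIV. Var i * pdiff i f)"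
  by (simp add: euler_def ring_map.sum[OF ring_map_syz_map] syz_map_cmul)
     (simp add: syz_map_eq ring_map.hsub_Var ring_map_id)

text \<open>Euler's relation up to a factor, by the product rule.\<close>
lemma euler_prod_lin:
  assumes "finite A"
  shows "(\<Prod>Q\<in>A. dual_form Q) dvd (\<Sum>i\<in>UNIV. Var i * pdiff i (\<Prod>Q\<in>A. dual_form Q))"
  using assms
proof (induction A)
  case (insert Q A)
  let ?E = "\<lambda>f. \<Sum>i\<in>UNIV. Var i * pdiff i f" and ?f = "\<Prod>Q\<in>A. dual_form Q"
  have l: "?E (dual_form Q) = dual_form Q"
    by (simp add: dual_form_eq_lin pdiff_lin)
       (simp add: lin_def cmul_def mult.commute)
  have "?E (dual_form Q * ?f) = ?E (dual_form Q) * ?f + dual_form Q * ?E ?f"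
    by (simp add: pdiff_mult sum_distrib_left sum_distrib_right sum.distrib algebra_simps)
  then show ?case
    using insert by (simp add: l mult_dvd_mono)
qed simp

lemma arr_poly_dvd_euler: "finite Z \<Longrightarrow> arr_poly Z dvd syz_map (arr_poly Z) euler"
  unfolding syz_map_euler arr_poly_def by (rule euler_prod_lin)

lemma syzI: "\<theta> \<in> forms (int k) \<Longrightarrow> arr_poly Z dvd syz_map (arr_poly Z) \<theta> \<Longrightarrow> \<theta> \<in> syz Z k"
  by (simp add: syz_def Der_def)

lemma prime_dual_form: "prime_elem (dual_form Q)"
  unfolding dual_form_eq_lin by (rule prime_lin[OF rep_proj2_nonzero])

text \<open>On the line dual to \<open>Q\<close> the gradient of the arrangement is proportional to \<open>Q\<close>.\<close>
lemma peval_gradient_arr_poly: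
  assumes "finite Z" "Q \<in> Z" "dot (rep_proj2 Q) v = 0"
  shows "peval v (pdiff i (arr_poly Z)) = peval v (arr_poly (Z - {Q})) * rep_proj2 Q $ i"
proof -
  have "arr_poly Z = dual_form Q * arr_poly (Z - {Q})"
    using assms by (simp add: arr_poly_def prod.remove)
  then show ?thesis
    using assms(3)
    by (simp add: pdiff_mult dual_form_eq_lin pdiff_lin peval_add peval_mult peval_lin peval_cst)
qed

text \<open>Consequently, on this line the condition for \<open>\<theta>\<close> to be a syzygy concerns only its value at \<open>Q\<close>.\<close>
lemma peval_syz_map_arr_poly:
  assumes "finite Z" "Q \<in> Z" "dot (rep_proj2 Q) v = 0" "\<theta> \<in> forms (int k)"
  shows "peval v (syz_map (arr_poly Z) \<theta>) =
    peval v (arr_poly (Z - {Q})) ^ k * hsub (peval v) (($) (rep_proj2 Q)) \<theta>"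
  unfolding peval_syz_map peval_gradient_arr_poly[OF assms(1-3)]
  using hsub_homogeneous_scale[OF ring_map_peval assms(4)] by simp

section \<open>The syzygy module realized on the line\<close>

text \<open>The coordinates of \<open>Y(t, s)\<close>.\<close>
definition dual_pt :: "complex ^ 3 \<Rightarrow> 3 \<Rightarrow> poly3" where
  "dual_pt p i = lin (if i = 1 then vector [0, -1, p $ 1] else
     if i = 2 then vector [1, 0, p $ 2] else vector [0, 0, p $ 3])"

text \<open>The parameters \<open>(t\<^sub>1, t\<^sub>2, s)\<close> with \<open>Y(t, s) = q\<close>.\<close>
definition dual_coord :: "complex ^ 3 \<Rightarrow> (3 \<Rightarrow> complex) \<Rightarrow> 3 \<Rightarrow> complex" where
  "dual_coord p q i = (if i = 1 then q 2 - q 3 * p $ 2 / p $ 3 else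
     if i = 2 then q 3 * p $ 1 / p $ 3 - q 1 else q 3 / p $ 3)"

lemma peval_dual_pt:
  "peval v (dual_pt p i) = (if i = 1 then p $ 1 * v 3 - v 2 else
     if i = 2 then v 1 + p $ 2 * v 3 else p $ 3 * v 3)"
  by (simp add: dual_pt_def peval_lin sum_3 vector_3)

text \<open>The same parameters as linear forms in \<open>q\<close>.\<close>
definition dual_coord_form :: "complex ^ 3 \<Rightarrow> 3 \<Rightarrow> complex ^ 3" where
  "dual_coord_form p i = (if i = 1 then vector [0, 1, - (p $ 2 / p $ 3)] else
     if i = 2 then vector [-1, 0, p $ 1 / p $ 3] else vector [0, 0, 1 / p $ 3])"

lemma dual_coord_form: "(\<Sum>l\<in>UNIV. dual_coord_form p i $ l * q l) = dual_coord p q i"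
  by (simp add: dual_coord_form_def dual_coord_def sum_3 vector_3)

context line_chart
begin

lemma dual_pt_coord: "peval (dual_coord p q) (dual_pt p i) = q i"
  using p3 exhaust_3[of i] by (auto simp: peval_dual_pt dual_coord_def field_simps)

lemma dual_coord_pt: "dual_coord p (\<lambda>i. peval v (dual_pt p i)) i = v i"
  using p3 exhaust_3[of i] by (auto simp: peval_dual_pt dual_coord_def field_simps)

text \<open>Modulo the equation of the line, the pairing of \<open>q\<close> with a point is the determinant of the parameters
  \<open>t\<close> of \<open>q\<close> and of the point. So \<open>X(t)\<close>, with the parameters \<open>t\<close> of \<open>q\<close>, is the point where the
  line meets the line dual to \<open>q\<close>.\<close>
lemma pairing_coord:
  "(\<Sum>i\<in>UNIV. q i * v i) =
    dual_coord p q 3 * dot p v + (dual_coord p q 1 * v 2 - dual_coord p q 2 * v 1)"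
  using p3 by (simp add: sum_3 dual_coord_def field_simps)

definition \<rho>D :: "poly3 tripoly \<Rightarrow> poly3" where
  "\<rho>D = hsub (restrict_line p) (dual_pt p)"

lemma ring_map_\<rho>D: "ring_map \<rho>D"
  unfolding \<rho>D_def by (intro ring_map.ring_map_hsub ring_map_restrict_line)

lemma peval_\<rho>D:
  "peval v (\<rho>D \<theta>) = hsub (peval (\<lambda>i. peval v (line_pt p i))) (\<lambda>i. peval v (dual_pt p i)) \<theta>"
  unfolding \<rho>D_def hsub_comp[OF ring_map_peval] peval_restrict_line ..

text \<open>This is the orthogonality \<open>Y(t, s) \<cdot> X(t) = 0\<close>.\<close>
lemma \<rho>D_euler: "\<rho>D euler = 0"
proof (rule peval_eqI)
  fix v :: "3 \<Rightarrow> complex"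
  have "peval v (\<rho>D euler) = (\<Sum>i\<in>UNIV. peval v (line_pt p i) * peval v (dual_pt p i))"
    unfolding peval_\<rho>D euler_def
    by (simp add: ring_map.sum[OF ring_map.ring_map_hsub] ring_map_peval ring_map.hsub_cmul ring_map.hsub_Var peval_Var)
  also have "\<dots> = 0"
    using p3 by (simp add: sum_3 peval_line_pt peval_dual_pt field_simps)
  finally show "peval v (\<rho>D euler) = peval v 0"
    by (simp add: peval_zero)
qed

end

lemma euler_forms: "euler \<in> forms 1"
  unfolding euler_def by (intro forms_sum forms_cmul forms_Var)

lemma euler_coeff_forms: "euler \<in> coeff_forms 1"
  unfolding euler_def
  by (intro coeff_forms_sum) (use coeff_forms_cmul[OF forms_Var coeff_forms_Var] in simp)

lemma euler_mult_mem:
  assumes "\<beta> \<in> forms (int k - 1)"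
  shows "euler * \<beta> \<in> euler_submodule k"
proof -
  interpret module "cmul :: poly3 \<Rightarrow> poly3 tripoly \<Rightarrow> _" by (rule module_cmul)
  have "euler * \<beta> = (\<Sum>m\<in>keys \<beta>. euler * single m (lookup \<beta> m))"
    by (subst monomial_expansion[of \<beta>]) (simp only: sum_distrib_left)
  also have "\<dots> = (\<Sum>m\<in>keys \<beta>. cmul (lookup \<beta> m) (euler * single m 1))"
    by (intro sum.cong refl) (simp add: cmul_def mult.left_commute mult_single)
  also have "\<dots> \<in> euler_submodule k"
    unfolding euler_submodule_def
  proof (intro span_sum span_scale span_base CollectI exI conjI)
    fix m assume "m \<in> keys \<beta>"
    from formsD[OF assms this] show "mdeg m + 1 = k"
      by simp
  qed simp
  finally show ?thesis .
qed

lemma euler_nonzero: "euler \<noteq> 0"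
proof
  assume "euler = 0"
  then have "hsub (\<lambda>a::poly3. a) (\<lambda>i. if i = 1 then 1 else 0) euler = 0"
    by (simp add: hsub_def)
  moreover have "hsub (\<lambda>a::poly3. a) (\<lambda>i. if i = 1 then 1 else 0) euler = Var 1"
    unfolding euler_def
    by (simp add: ring_map.sum[OF ring_map.ring_map_hsub] ring_map_id ring_map.hsub_cmul ring_map.hsub_Var
        if_distrib[of "(*) _"] cong: if_cong)
  ultimately show False
    using Var_nonzero[of 1] by simp
qed

lemma hom_D0: "\<theta> \<in> hom (D0 Z k) d \<longleftrightarrow> \<theta> \<in> syz Z k \<and> \<theta> \<in> coeff_forms d"
  by (simp add: D0_def coeff_forms_def)

text \<open>The genericity of \<open>P\<close>: it is not a point of \<open>Z\<close>, and no line through \<open>P\<close> contains two points of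
  \<open>Z\<close>. As \<open>t\<^sub>1\<close> and \<open>t\<^sub>2\<close> are homogeneous coordinates on the pencil of lines through \<open>P\<close>, these conditions
  are a nonvanishing of coordinates and of determinants.\<close>
locale syz_chart = line_chart P p for P p +
  fixes Z :: "proj2 set" and k :: nat
  assumes finite_Z: "finite Z" and k1: "k \<ge> 1"
    and off_P: "Q \<in> Z \<Longrightarrow> dual_coord p (($) (rep_proj2 Q)) 1 \<noteq> 0 \<or> dual_coord p (($) (rep_proj2 Q)) 2 \<noteq> 0"
    and not_collinear: "Q \<in> Z \<Longrightarrow> Q' \<in> Z \<Longrightarrow> Q \<noteq> Q' \<Longrightarrow>
      dual_coord p (($) (rep_proj2 Q)) 1 * dual_coord p (($) (rep_proj2 Q')) 2 \<noteq>
      dual_coord p (($) (rep_proj2 Q)) 2 * dual_coord p (($) (rep_proj2 Q')) 1"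
begin

abbreviation "T Q \<equiv> dual_coord p (($) (rep_proj2 Q))"

lemma not_dvd_arr_poly: "\<not> dual_form P dvd arr_poly Z"
proof
  assume "dual_form P dvd arr_poly Z"
  then obtain Q where Q: "Q \<in> Z" "dual_form P dvd dual_form Q"
    unfolding arr_poly_def using prime_elem_dvd_prod[OF prime_dual_form finite_Z] by blast
  from Q(2) have *: "\<And>v. dot p v = 0 \<Longrightarrow> dot (rep_proj2 Q) v = 0"
    unfolding dual_form_eq_lin p_def[symmetric] lin_dvd_iff[OF p_nonzero] by (auto simp: peval_lin)
  have "T Q 1 * v 2 - T Q 2 * v 1 = 0" for v :: "3 \<Rightarrow> complex"
    using *[of "\<lambda>i. peval v (line_pt p i)"] line_pt_on_line[of v]
    unfolding pairing_coord[of "($) (rep_proj2 Q)"] by (simp add: peval_line_pt)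
  from this[of "\<lambda>i. if i = 1 then 1 else 0"] this[of "\<lambda>i. if i = 2 then 1 else 0"]
  show False
    using off_P[OF Q(1)] by simp
qed

lemma syz_cancel:
  assumes "arr_poly Z dvd dual_form P * A"
  shows "arr_poly Z dvd A"
proof -
  obtain B where B: "dual_form P * A = arr_poly Z * B"
    using assms by blast
  then have "dual_form P dvd arr_poly Z * B"
    by (metis dvd_triv_left)
  then obtain B' where "B = dual_form P * B'"
    using not_dvd_arr_poly prime_dual_form by (auto simp: prime_elem_dvd_mult_iff)
  then have "dual_form P * A = dual_form P * (arr_poly Z * B')"
    by (simp only: B mult.left_commute)
  then show ?thesis
    using prime_dual_form[of P] unfolding prime_elem_def by simp
qed

text \<open>The substitution \<open>w\<close> replaces \<open>\<partial>\<close> by \<open>x\<^sub>i \<partial> - (x \<cdot> \<partial>) e\<^sub>i\<close>, where \<open>e\<^sub>i\<close> is the \<open>i\<close>-th unit vector. This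
  vector is orthogonal to \<open>x\<close>, so for \<open>x = X(t)\<close> on the line it is a multiple of some \<open>Y(t, s)\<close>, where
  \<open>\<theta>\<close> vanishes by assumption, provided that it is not proportional to \<open>p\<close>. Density removes the proviso.\<close>
lemma clearing_substitution_vanishes:
  assumes \<theta>: "\<theta> \<in> forms (int k)" and \<rho>: "\<rho>D \<theta> = 0" and i: "i = 1 \<or> i = 2"
    and v: "dot p v = 0"
  defines "w \<equiv> \<lambda>l. cmul (Var i) (Var l) - (if l = i then euler else 0)"
  shows "peval v (lookup (hsub cst w \<theta>) m) = 0"
proof -
  \<comment> \<open>At \<open>x = v\<close> and \<open>\<partial> = y\<close> the substituted vector is \<open>s p + lam(y) (- v\<^sub>2, v\<^sub>1, 0)\<close>. The polynomial
    \<open>C\<close> vanishes wherever \<open>lam\<close> does not, so \<open>C * lam = 0\<close> and \<open>C = 0\<close>.\<close>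
  define lam :: poly3 where "lam = lin (if i = 1 then vector [0, 1, - (p $ 2 / p $ 3)] else vector [-1, 0, p $ 1 / p $ 3])"
  define C where "C = hsub (\<lambda>a. cst (peval v a)) Var (hsub cst w \<theta>)"
  have C: "peval y C = hsub (peval v) (\<lambda>l. v i * y l - (if l = i then (\<Sum>l\<in>UNIV. v l * y l) else 0)) \<theta>" for y
  proof -
    interpret h: ring_map "hsub (peval v) y"
      by (intro ring_map.ring_map_hsub ring_map_peval)
    have E: "hsub (peval v) y euler = (\<Sum>l\<in>UNIV. v l * y l)"
      unfolding euler_def
      by (simp add: h.sum ring_map.hsub_cmul ring_map.hsub_Var ring_map_peval peval_Var)
    have "peval y C = hsub (peval v) y (hsub cst w \<theta>)"
      unfolding C_def hsub_comp[OF ring_map_peval[of y]] by (simp add: peval_cst peval_Var)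
    also have "\<dots> = hsub (peval v) (\<lambda>l. hsub (peval v) y (w l)) \<theta>"
      by (simp add: hsub_hsub ring_map_cst ring_map_peval ring_map.hsub_cst)
    also have "(\<lambda>l. hsub (peval v) y (w l)) = (\<lambda>l. v i * y l - (if l = i then (\<Sum>l\<in>UNIV. v l * y l) else 0))"
      by (auto simp: w_def h.diff h.zero E ring_map.hsub_cmul ring_map.hsub_Var ring_map_peval peval_Var)
    finally show ?thesis .
  qed
  have "C * lam = 0"
  proof (rule peval_eqI)
    fix y :: "3 \<Rightarrow> complex"
    define c where "c = peval y lam"
    have "peval y C = 0" if c: "c \<noteq> 0"
    proof -
      define s where "s = v i * y 3 / p $ 3"
      define u where "u l = (if l = 3 then s / c else v l)" for l :: 3
      have v3: "v 3 = - ((p $ 1 * v 1 + p $ 2 * v 2) / p $ 3)"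
        using line_pt_of_on_line[OF v, of 3] by (simp add: peval_line_pt)
      have "(\<lambda>l. v i * y l - (if l = i then (\<Sum>l\<in>UNIV. v l * y l) else 0))
          = (\<lambda>l. c * peval u (dual_pt p l))"
      proof
        fix l :: 3
        show "v i * y l - (if l = i then (\<Sum>l\<in>UNIV. v l * y l) else 0) = c * peval u (dual_pt p l)"
          using i
        proof
          assume [simp]: "i = 1"
          have c_eq: "c = y 2 - p $ 2 / p $ 3 * y 3"
            by (simp add: c_def lam_def peval_lin sum_3)
          have "c * (s / c) = v 1 * y 3 / p $ 3"
            using c by (simp add: s_def)
          then show ?thesis
            using exhaust_3[of l] p3
            by (auto simp: peval_dual_pt u_def sum_3 right_diff_distrib distrib_left mult.left_commute[of c] v3)
               (simp_all add: c_eq field_simps)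
        next
          assume [simp]: "i = 2"
          have c_eq: "c = p $ 1 / p $ 3 * y 3 - y 1"
            by (simp add: c_def lam_def peval_lin sum_3)
          have "c * (s / c) = v 2 * y 3 / p $ 3"
            using c by (simp add: s_def)
          then show ?thesis
            using exhaust_3[of l] p3
            by (auto simp: peval_dual_pt u_def sum_3 right_diff_distrib distrib_left mult.left_commute[of c] v3)
               (simp_all add: c_eq field_simps)
        qed
      qed
      then have "peval y C = hsub (peval v) (\<lambda>l. c * peval u (dual_pt p l)) \<theta>"
        by (simp only: C)
      also have "\<dots> = c ^ k * hsub (peval v) (\<lambda>l. peval u (dual_pt p l)) \<theta>"
        using hsub_homogeneous_scale[OF ring_map_peval \<theta>] by simp
      also have "v = (\<lambda>l. peval u (line_pt p l))"
        using line_pt_of_on_line[OF v] by (auto simp: peval_line_pt u_def v3)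
      also have "hsub (peval \<dots>) (\<lambda>l. peval u (dual_pt p l)) \<theta> = peval u (\<rho>D \<theta>)"
        by (simp only: peval_\<rho>D)
      finally show ?thesis
        by (simp add: \<rho> peval_zero)
    qed
    then show "peval y (C * lam) = peval y 0"
      by (cases "c = 0") (simp_all add: peval_mult peval_zero flip: c_def)
  qed
  moreover have "lam \<noteq> 0"
    unfolding lam_def by (intro lin_nonzero) (auto simp: vec_eq_iff forall_3)
  ultimately have "C = 0"
    by simp
  then show ?thesis
    using lookup_map_coeffs[OF ring_map_peval, of v "hsub cst w \<theta>" m] by (simp add: C_def)
qed

text \<open>Faithfulness. Modulo the Euler element, \<open>x\<^sub>i\<^sup>k \<theta>\<close> equals \<open>\<theta>\<close> after the substitution \<open>w\<close>, whose coefficients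
  vanish on the line and are therefore divisible by its equation. The quotient is again a syzygy because
  the equation of the line is prime and does not divide \<open>f\<close>.\<close>
lemma \<rho>D_kernel:
  assumes \<theta>: "\<theta> \<in> hom (D0 Z k) d" and \<rho>: "\<rho>D \<theta> = 0" and x: "x \<in> dual_line P"
  shows "\<exists>c h a. h \<in> forms c \<and> ev h x \<noteq> 0 \<and> a \<in> hom (D0 Z k) (c + d - 1) \<and>
    scl (D0 Z k) h \<theta> - scl (D0 Z k) (dual_form P) a \<in> den (D0 Z k)"
proof -
  obtain i where i: "i = 1 \<or> i = (2::3)" and xi: "rep_proj2 x $ i \<noteq> 0"
    using rep_coordinate_nonzero[OF x] by blast
  define w where "w = (\<lambda>l. cmul (Var i) (Var l) - (if l = i then euler else 0))"
  define \<Theta> where "\<Theta> = hsub cst w \<theta>"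
  let ?h = "Var i ^ k :: poly3"
  have \<theta>f: "\<theta> \<in> forms (int k)" and \<theta>c: "\<theta> \<in> coeff_forms d" and \<theta>s: "arr_poly Z dvd syz_map (arr_poly Z) \<theta>"
    using \<theta> by (simp_all add: hom_D0 syz_def Der_def)
  have w1: "w l \<in> forms 1" "w l \<in> coeff_forms 1" for l
    using coeff_forms_cmul[OF forms_Var coeff_forms_Var]
    by (auto simp: w_def intro!: forms_diff forms_cmul forms_Var euler_forms forms_zero
        coeff_forms_diff euler_coeff_forms coeff_forms_zero)
  have \<Theta>f: "\<Theta> \<in> forms (int k)"
    unfolding \<Theta>_def by (rule hsub_cst_forms[OF w1(1) \<theta>f])
  have \<Theta>c: "\<Theta> \<in> coeff_forms (d + int k)"
    unfolding \<Theta>_def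
  proof (rule coeff_forms_hsub[OF _ w1(2) \<theta>f])
    show "cst (lookup \<theta> m) \<in> coeff_forms d" for m
      using \<theta>c by (intro coeff_forms_single) (simp add: coeff_forms_def)
  qed
  have "euler dvd hsub cst (\<lambda>l. cmul (Var i) (Var l)) \<theta> - \<Theta>"
    unfolding \<Theta>_def
    by (rule ring_map.hsub_congruent[OF ring_map_cst]) (simp add: w_def)
  moreover have "hsub cst (\<lambda>l. cmul (Var i) (Var l)) \<theta> = cmul ?h \<theta>"
    using hsub_homogeneous_scale[OF ring_map_cst \<theta>f, of "cst (Var i)" Var]
    by (simp add: cmul_def hsub_cst_Var ring_map.power[OF ring_map_cst])
  ultimately obtain \<beta> where \<beta>: "cmul ?h \<theta> - \<Theta> = euler * \<beta>"
    by (auto elim: dvdE)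
  have "euler * \<beta> \<in> forms (int k)"
    unfolding \<beta>[symmetric] by (intro forms_diff forms_cmul \<theta>f \<Theta>f)
  then have \<beta>f: "\<beta> \<in> forms (int k - 1)"
    by (rule forms_cofactor[OF euler_nonzero euler_forms])
  have "dual_form P dvd lookup \<Theta> m" for m
    unfolding dual_form_eq_lin p_def[symmetric] lin_dvd_iff[OF p_nonzero]
    unfolding \<Theta>_def w_def by (intro allI impI clearing_substitution_vanishes \<theta>f \<rho> i)
  then obtain a where a: "\<And>m. lookup \<Theta> m = dual_form P * a m"
    unfolding dvd_def by metis
  define \<alpha> where "\<alpha> = (\<Sum>m\<in>keys \<Theta>. single m (a m))"
  have \<alpha>: "cmul (dual_form P) \<alpha> = \<Theta>"
    unfolding \<alpha>_def cmul_def sum_distrib_left mult_single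
    by (simp add: a[symmetric] monomial_expansion[symmetric])
  have \<alpha>f: "\<alpha> \<in> forms (int k)"
    unfolding \<alpha>_def by (intro forms_sum forms_single) (rule formsD[OF \<Theta>f])
  have "a m \<in> forms ((d + int k) - 1)" for m
    using \<Theta>c prime_dual_form[of P]
    by (intro forms_cofactor[of "dual_form P"])
       (auto simp: coeff_forms_def a dual_form_eq_lin forms_lin prime_elem_def)
  then have \<alpha>c: "\<alpha> \<in> coeff_forms (int k + d - 1)"
    unfolding \<alpha>_def by (intro coeff_forms_sum coeff_forms_single) (simp add: algebra_simps)
  interpret s: ring_map "syz_map (arr_poly Z)"
    by (rule ring_map_syz_map)
  have "dual_form P * syz_map (arr_poly Z) \<alpha> = syz_map (arr_poly Z) (cmul ?h \<theta> - euler * \<beta>)"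
    by (simp add: \<alpha> flip: syz_map_cmul \<beta>)
  also have "arr_poly Z dvd \<dots>"
    unfolding s.diff s.mult syz_map_cmul
    by (rule dvd_diff[OF dvd_mult[OF \<theta>s] dvd_mult2[OF arr_poly_dvd_euler[OF finite_Z]]])
  finally have "\<alpha> \<in> syz Z k"
    by (rule syzI[OF \<alpha>f syz_cancel])
  then have "\<alpha> \<in> hom (D0 Z k) (int k + d - 1)"
    using \<alpha>c by (simp add: hom_D0)
  moreover have "?h \<in> forms (int k)"
    using forms_power[OF forms_Var, of i k] by simp
  moreover have "ev ?h x \<noteq> 0"
    using xi by (simp add: ev_power ev_Var)
  moreover have "scl (D0 Z k) ?h \<theta> - scl (D0 Z k) (dual_form P) \<alpha> \<in> den (D0 Z k)"
    using euler_mult_mem[OF \<beta>f] by (simp add: D0_def \<alpha> \<beta>)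
  ultimately show ?thesis
    by blast
qed

lemma realization_D0: "realization P p (D0 Z k) \<rho>D (int k) k"
proof unfold_locales
  interpret r: ring_map \<rho>D by (rule ring_map_\<rho>D)
  interpret s: ring_map "syz_map (arr_poly Z)" by (rule ring_map_syz_map)
  interpret module "cmul :: poly3 \<Rightarrow> poly3 tripoly \<Rightarrow> _" by (rule module_cmul)
  show "scl (D0 Z k) a (x + y) = scl (D0 Z k) a x + scl (D0 Z k) a y"
    "scl (D0 Z k) (a + b) x = scl (D0 Z k) a x + scl (D0 Z k) b x"
    "scl (D0 Z k) a (scl (D0 Z k) b x) = scl (D0 Z k) (a * b) x"
    "scl (D0 Z k) 1 x = x" for a b x y
    by (simp_all add: D0_def scale_right_distrib scale_left_distrib)
  fix m m' :: "poly3 tripoly" and h :: poly3 and d c and x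
  show "m \<in> hom (D0 Z k) d \<Longrightarrow> m' \<in> hom (D0 Z k) d \<Longrightarrow> m + m' \<in> hom (D0 Z k) d"
    by (auto simp: hom_D0 syz_def Der_def forms_add coeff_forms_add s.add)
  show "m \<in> hom (D0 Z k) d \<Longrightarrow> m' \<in> hom (D0 Z k) d \<Longrightarrow> m - m' \<in> hom (D0 Z k) d"
    by (auto simp: hom_D0 syz_def Der_def forms_diff coeff_forms_diff s.diff)
  show "h \<in> forms c \<Longrightarrow> m \<in> hom (D0 Z k) d \<Longrightarrow> scl (D0 Z k) h m \<in> hom (D0 Z k) (c + d)"
    by (simp add: hom_D0 syz_def Der_def forms_cmul coeff_forms_cmul syz_map_cmul)
       (simp add: D0_def forms_cmul coeff_forms_cmul syz_map_cmul)
  show "m \<in> den (D0 Z k) \<Longrightarrow> scl (D0 Z k) h m \<in> den (D0 Z k)"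
    by (simp add: D0_def euler_submodule_def span_scale)
  show "\<rho>D (m + m') = \<rho>D m + \<rho>D m'"
    by (rule r.add)
  show "\<rho>D (scl (D0 Z k) h m) = restrict_line p h * \<rho>D m"
    by (simp add: D0_def \<rho>D_def ring_map.hsub_cmul ring_map_restrict_line)
  show "\<rho>D m = 0" if "m \<in> den (D0 Z k)"
  proof -
    have "m \<in> span {euler * single m 1 | m. mdeg m + 1 = k}"
      using that by (simp add: D0_def euler_submodule_def)
    then show ?thesis
    proof (induction rule: span_induct_alt)
      case base
      show ?case by (rule r.zero)
    next
      case (step c x y)
      then show ?case
        by (auto simp: r.add r.mult \<rho>D_euler cmul_def)
    qed
  qed
  show "m \<in> hom (D0 Z k) d \<Longrightarrow> \<rho>D m \<in> forms (d + int k)"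
    unfolding \<rho>D_def hom_D0 syz_def Der_def
    by (intro hsub_forms restrict_line_forms) (auto simp: coeff_forms_def dual_pt_def forms_lin)
  show "deg3_le k (\<rho>D m)" if "m \<in> hom (D0 Z k) d"
  proof -
    have "deg3_le 1 (dual_pt p i)" for i
      unfolding dual_pt_def by (rule deg3_le_mono[OF deg3_le_lin]) simp
    then have "deg3_le (1 * k) (\<rho>D m)"
      unfolding \<rho>D_def using that
      by (intro deg3_le_hsub deg3_le_restrict_line) (auto simp: hom_D0 syz_def Der_def)
    then show ?thesis
      by simp
  qed
qed (rule \<rho>D_kernel)

end

sublocale syz_chart \<subseteq> D: realization P p "D0 Z k" \<rho>D "int k" k
  by (rule realization_D0)

section \<open>Global sections of the twisted syzygy bundle\<close>

lemma split_exponents: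
  fixes a b j :: nat
  assumes "j \<le> a + b"
  shows "min a j + (j - min a j) = j" "min a j \<le> a" "j - min a j \<le> b"
  using assms by auto

context syz_chart
begin

text \<open>The parameters \<open>t\<^sub>1, t\<^sub>2, s\<close> of a point of the dual plane, written in the variables \<open>\<partial>\<close>.\<close>
definition dcoord :: "3 \<Rightarrow> poly3 tripoly" where
  "dcoord l = (\<Sum>i\<in>UNIV. cmul (cst (dual_coord_form p l $ i)) (Var i))"

lemma hsub_dcoord:
  "ring_map c \<Longrightarrow> hsub c w (dcoord l) = (\<Sum>i\<in>UNIV. c (cst (dual_coord_form p l $ i)) * w i)"
  by (simp add: dcoord_def ring_map.sum[OF ring_map.ring_map_hsub] ring_map.hsub_cmul ring_map.hsub_Var)

text \<open>To lift \<open>t\<^sub>1\<^sup>a t\<^sub>2\<^sup>b s\<^sup>i\<close> to \<open>Der\<^sup>k\<close> with coefficients of degree \<open>j\<close>, write \<open>j\<close> of the factors \<open>t\<^sub>1, t\<^sub>2\<close> as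
  linear forms \<open>\<pi>1, \<pi>2\<close> in \<open>x\<close> and the other factors in the variables \<open>\<partial>\<close>. The linear forms \<open>\<pi>1\<close> and \<open>\<pi>2\<close>
  should restrict to \<open>t\<^sub>1\<close> and \<open>t\<^sub>2\<close> on the line; the remaining freedom is used in lemma \<open>local_lift\<close>.\<close>
definition lift_monomial :: "nat \<Rightarrow> poly3 \<Rightarrow> poly3 \<Rightarrow> mono3 \<Rightarrow> poly3 tripoly" where
  "lift_monomial j \<pi>1 \<pi>2 m =
    (let a = lookup m 1; b = lookup m 2; a' = min a j; b' = j - a' in
     cmul (\<pi>1 ^ a' * \<pi>2 ^ b') (dcoord 1 ^ (a - a') * dcoord 2 ^ (b - b') * dcoord 3 ^ lookup m 3))"

definition lift_form :: "nat \<Rightarrow> poly3 \<Rightarrow> poly3 \<Rightarrow> poly3 \<Rightarrow> poly3 tripoly" where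
  "lift_form j \<pi>1 \<pi>2 G =
    (\<Sum>m\<in>keys G. cmul (cst (lookup G m)) (lift_monomial j \<pi>1 \<pi>2 m))"

text \<open>If \<open>\<pi>1\<close> and \<open>\<pi>2\<close> evaluate to \<open>\<kappa>\<close> times the first two parameters of \<open>w\<close>, only the power \<open>\<kappa>\<^sup>j\<close>
  distinguishes the value of the lift from the value of \<open>G\<close> at the parameters of \<open>w\<close>.\<close>
lemma hsub_lift_form:
  assumes c: "ring_map c" and G: "G \<in> forms (int (j + k))" "deg3_le k G"
    and \<pi>: "c \<pi>1 = \<kappa> * hsub c w (dcoord 1)" "c \<pi>2 = \<kappa> * hsub c w (dcoord 2)"
  shows "hsub c w (lift_form j \<pi>1 \<pi>2 G) = \<kappa> ^ j * hsub (\<lambda>a. c (cst a)) (\<lambda>l. hsub c w (dcoord l)) G"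
proof -
  interpret c: ring_map c by fact
  interpret h: ring_map "hsub c w" by (rule c.ring_map_hsub)
  have "hsub c w (cmul (cst (lookup G m)) (lift_monomial j \<pi>1 \<pi>2 m)) =
      \<kappa> ^ j * (c (cst (lookup G m)) * (\<Prod>l\<in>UNIV. hsub c w (dcoord l) ^ lookup m l))"
    if m: "m \<in> keys G" for m
  proof -
    let ?a = "lookup m 1" and ?b = "lookup m 2"
    define a' where "a' = min ?a j"
    define b' where "b' = j - a'"
    have "j \<le> ?a + ?b"
      using formsD[OF G(1) m] G(2) m by (auto simp: deg3_le_def mdeg_3 dest: bspec)
    from split_exponents[OF this] have j: "a' + b' = j" "a' \<le> ?a" "b' \<le> ?b"
      by (simp_all add: a'_def b'_def)
    let ?t = "\<lambda>l. hsub c w (dcoord l)"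
    have L: "lift_monomial j \<pi>1 \<pi>2 m = cmul (\<pi>1 ^ a' * \<pi>2 ^ b')
        (dcoord 1 ^ (?a - a') * dcoord 2 ^ (?b - b') * dcoord 3 ^ lookup m 3)"
      by (simp add: lift_monomial_def Let_def a'_def b'_def)
    have "hsub c w (lift_monomial j \<pi>1 \<pi>2 m) =
        (\<kappa> * ?t 1) ^ a' * (\<kappa> * ?t 2) ^ b' * (?t 1 ^ (?a - a') * ?t 2 ^ (?b - b') * ?t 3 ^ lookup m 3)"
      by (simp only: L c.hsub_cmul h.mult h.power c.mult c.power \<pi>)
    also have "\<dots> = \<kappa> ^ (a' + b') * (?t 1 ^ (a' + (?a - a')) * ?t 2 ^ (b' + (?b - b')) * ?t 3 ^ lookup m 3)"
      by (simp only: power_add power_mult_distrib ac_simps)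
    also have "\<dots> = \<kappa> ^ j * (\<Prod>l\<in>UNIV. ?t l ^ lookup m l)"
      using j by (simp add: prod_3)
    finally show ?thesis
      by (simp add: c.hsub_cmul mult.left_commute)
  qed
  then show ?thesis
    by (simp add: lift_form_def h.sum hsub_def[of "\<lambda>a. c (cst a)"] sum_distrib_left)
qed

lemma lift_form_mem:
  assumes G: "G \<in> forms (int (j + k))" "deg3_le k G" and \<pi>: "\<pi>1 \<in> forms 1" "\<pi>2 \<in> forms 1"
  shows "lift_form j \<pi>1 \<pi>2 G \<in> forms (int k)" "lift_form j \<pi>1 \<pi>2 G \<in> coeff_forms (int j)"
proof -
  have d: "dcoord l \<in> forms 1" "dcoord l \<in> coeff_forms 0" for l
    unfolding dcoord_def
    using coeff_forms_cmul[OF forms_cst coeff_forms_Var]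
    by (auto intro!: forms_sum forms_cmul forms_Var coeff_forms_sum)
  have "lift_monomial j \<pi>1 \<pi>2 m \<in> forms (int k) \<and> lift_monomial j \<pi>1 \<pi>2 m \<in> coeff_forms (int j)"
    if m: "m \<in> keys G" for m
  proof -
    let ?a = "lookup m 1" and ?b = "lookup m 2" and ?i = "lookup m 3"
    define a' where "a' = min ?a j"
    define b' where "b' = j - a'"
    have sum: "?a + ?b + ?i = j + k"
      using formsD[OF G(1) m] by (simp add: mdeg_3)
    then have "j \<le> ?a + ?b"
      using G(2) m by (auto simp: deg3_le_def dest: bspec)
    from split_exponents[OF this] have j: "a' + b' = j" "a' \<le> ?a" "b' \<le> ?b"
      by (simp_all add: a'_def b'_def)
    let ?D = "dcoord 1 ^ (?a - a') * dcoord 2 ^ (?b - b') * dcoord 3 ^ ?i"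
    have L: "lift_monomial j \<pi>1 \<pi>2 m = cmul (\<pi>1 ^ a' * \<pi>2 ^ b') ?D"
      by (simp add: lift_monomial_def Let_def a'_def b'_def)
    have "?D \<in> forms (int (?a - a') * 1 + int (?b - b') * 1 + int ?i * 1)"
      by (intro forms_mult forms_power d)
    moreover have "int (?a - a') * 1 + int (?b - b') * 1 + int ?i * 1 = int k"
      using sum j by linarith
    moreover have "?D \<in> coeff_forms (int (?a - a') * 0 + int (?b - b') * 0 + int ?i * 0)"
      by (intro coeff_forms_mult coeff_forms_power d)
    moreover have "\<pi>1 ^ a' * \<pi>2 ^ b' \<in> forms (int a' * 1 + int b' * 1)"
      by (intro forms_mult forms_power \<pi>)
    moreover have "int a' * 1 + int b' * 1 = int j"
      using j by linarith
    ultimately show ?thesis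
      using coeff_forms_cmul[of "\<pi>1 ^ a' * \<pi>2 ^ b'" "int j" ?D 0] by (simp add: L forms_cmul)
  qed
  then show "lift_form j \<pi>1 \<pi>2 G \<in> forms (int k)" "lift_form j \<pi>1 \<pi>2 G \<in> coeff_forms (int j)"
    unfolding lift_form_def
    using coeff_forms_cmul[OF forms_cst, of _ "int j"]
    by (auto intro!: forms_sum forms_cmul coeff_forms_sum)
qed

lemma \<rho>D_dcoord: "\<rho>D (dcoord l) = Var l"
proof (rule peval_eqI)
  fix v :: "3 \<Rightarrow> complex"
  have "peval v (\<rho>D (dcoord l)) = (\<Sum>i\<in>UNIV. dual_coord_form p l $ i * peval v (dual_pt p i))"
    unfolding peval_\<rho>D hsub_dcoord[OF ring_map_peval] by (simp add: peval_cst)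
  also have "\<dots> = v l"
    by (simp only: dual_coord_form dual_coord_pt)
  finally show "peval v (\<rho>D (dcoord l)) = peval v (Var l)"
    by (simp add: peval_Var)
qed

lemma \<rho>D_lift_form:
  assumes G: "G \<in> forms (int (j + k))" "deg3_le k G"
    and \<pi>: "restrict_line p \<pi>1 = Var 1" "restrict_line p \<pi>2 = Var 2"
  shows "\<rho>D (lift_form j \<pi>1 \<pi>2 G) = G"
proof -
  have "restrict_line p (cst a) = cst a" for a
    by (simp add: restrict_line_def ring_map.hsub_cst ring_map_cst)
  moreover have "hsub (restrict_line p) (dual_pt p) (dcoord l) = Var l" for l
    using \<rho>D_dcoord by (simp add: \<rho>D_def)
  ultimately show ?thesis
    using hsub_lift_form[OF ring_map_restrict_line G, of p \<pi>1 1 "dual_pt p" \<pi>2] \<pi>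
    by (simp add: \<rho>D_def hsub_cst_Var)
qed

lemma peval_lift_form:
  assumes G: "G \<in> forms (int (j + k))" "deg3_le k G"
    and \<pi>: "peval v \<pi>1 = \<kappa> * dual_coord p q 1" "peval v \<pi>2 = \<kappa> * dual_coord p q 2"
  shows "hsub (peval v) q (lift_form j \<pi>1 \<pi>2 G) = \<kappa> ^ j * peval (dual_coord p q) G"
proof -
  have "hsub (peval v) q (dcoord l) = dual_coord p q l" for l
    by (simp add: hsub_dcoord[OF ring_map_peval] peval_cst dual_coord_form)
  then show ?thesis
    using hsub_lift_form[OF ring_map_peval G, of v \<pi>1 \<kappa> q \<pi>2] \<pi>
    by (simp add: peval_cst peval_eq_hsub[of "dual_coord p q"])
qed

lemma arr_poly_forms: "finite Y \<Longrightarrow> arr_poly Y \<in> forms (int (card Y))"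
  using forms_prod[of Y dual_form "\<lambda>_. 1"] by (simp add: arr_poly_def dual_form_eq_lin forms_lin)

lemma peval_arr_poly: "finite Y \<Longrightarrow> peval v (arr_poly Y) = (\<Prod>Q\<in>Y. \<Sum>i\<in>UNIV. rep_proj2 Q $ i * v i)"
  by (simp add: arr_poly_def peval_prod dual_form_eq_lin peval_lin)

lemma pairing_on_line:
  "(\<Sum>i\<in>UNIV. rep_proj2 Q $ i * peval v (line_pt p i)) = T Q 1 * v 2 - T Q 2 * v 1"
  using line_pt_on_line[of v] unfolding pairing_coord[of "($) (rep_proj2 Q)"] by (simp add: peval_line_pt)

text \<open>Near a point \<open>x\<close> of \<open>L\<close> every admissible \<open>G\<close> comes from a syzygy. By genericity at most one line \<open>H\<close> of
  the arrangement passes through \<open>x\<close>; if there is one, let it be dual to \<open>Q\<close>. Choose \<open>(\<pi>1, \<pi>2)\<close> as the projection onto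
  \<open>L\<close> from a point of \<open>H\<close> outside \<open>L\<close>. It maps \<open>H\<close> to the point \<open>x\<close>, so that the lift at a point of \<open>H\<close>,
  evaluated at \<open>Q\<close>, is a multiple of the value of \<open>G\<close> at \<open>Q\<close>, which is zero. Therefore the equation of
  \<open>H\<close> divides the image of the lift, and multiplication by the equations \<open>h\<close> of the other lines, none of
  which vanishes at \<open>x\<close>, turns it into a syzygy.\<close>
lemma local_lift:
  assumes G: "G \<in> forms (int (j + k))" "deg3_le k G" "\<And>Q. Q \<in> Z \<Longrightarrow> peval (T Q) G = 0"
    and x: "x \<in> dual_line P"
  shows "\<exists>\<theta> h c. \<rho>D \<theta> = G \<and> h \<in> forms c \<and> ev h x \<noteq> 0 \<and> cmul h \<theta> \<in> hom (D0 Z k) (c + int j)"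
proof -
  define A where "A = {Q \<in> Z. ev (dual_form Q) x \<noteq> 0}"
  define h where "h = arr_poly A"
  have finA: "finite A" "A \<subseteq> Z"
    using finite_Z by (auto simp: A_def)
  have hx: "ev h x \<noteq> 0"
    using finA by (simp add: h_def arr_poly_def ev_def peval_prod) (simp add: A_def ev_def)
  have xline: "ev (dual_form Q) x = T Q 1 * rep_proj2 x $ 2 - T Q 2 * rep_proj2 x $ 1" for Q
    using pairing_on_line[of Q "($) (rep_proj2 x)"] x
    by (simp add: on_line_iff line_pt_of_on_line ev_def dual_form_eq_lin peval_lin)
  have "\<exists>\<pi>1 \<pi>2. \<pi>1 \<in> forms 1 \<and> \<pi>2 \<in> forms 1 \<and> restrict_line p \<pi>1 = Var 1 \<and> restrict_line p \<pi>2 = Var 2 \<and>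
      (\<forall>Q\<in>Z - A. \<forall>v. dot (rep_proj2 Q) v = 0 \<longrightarrow>
        T Q 1 * peval v \<pi>2 - T Q 2 * peval v \<pi>1 = 0)"
  proof -
    have uniq: "Q = Q'" if "Q \<in> Z - A" "Q' \<in> Z - A" for Q Q'
    proof (rule ccontr)
      assume "Q \<noteq> Q'"
      then have nc: "T Q 1 * T Q' 2 \<noteq> T Q 2 * T Q' 1"
        using not_collinear that by blast
      have e: "T Q 1 * rep_proj2 x $ 2 = T Q 2 * rep_proj2 x $ 1" "T Q' 1 * rep_proj2 x $ 2 = T Q' 2 * rep_proj2 x $ 1"
        using that xline[of Q] xline[of Q'] by (auto simp: A_def)
      have "(T Q 1 * T Q' 2 - T Q 2 * T Q' 1) * rep_proj2 x $ 1 = 0"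
        "(T Q 1 * T Q' 2 - T Q 2 * T Q' 1) * rep_proj2 x $ 2 = 0"
        using e by algebra+
      then show False
        using nc rep_coordinate_nonzero[OF x] by simp
    qed
    \<comment> \<open>the first two coordinates of the centre of projection, a point \<open>z\<close> with \<open>Q \<cdot> z = 0\<close> and
      \<open>p \<cdot> z = 1\<close>\<close>
    obtain c1 c2 where c: "\<And>Q. Q \<in> Z - A \<Longrightarrow> T Q 1 * c2 - T Q 2 * c1 = - T Q 3"
    proof (cases "Z - A = {}")
      case True
      then show ?thesis using that by blast
    next
      case False
      then obtain Q where Q: "Q \<in> Z - A" by blast
      have "\<exists>c1 c2. T Q 1 * c2 - T Q 2 * c1 = - T Q 3"
      proof (cases "T Q 1 = 0")
        case True
        then show ?thesis
          using off_P[of Q] Q by (intro exI[of _ "T Q 3 / T Q 2"] exI[of _ 0]) simp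
      next
        case False
        then show ?thesis
          by (intro exI[of _ 0] exI[of _ "- T Q 3 / T Q 1"]) simp
      qed
      then show ?thesis
        using that uniq[OF Q] by blast
    qed
    define \<pi> where "\<pi> c i = Var i - cmul c (dual_form P)" for c i
    have "\<pi> c i \<in> forms 1" for c i
      unfolding \<pi>_def dual_form_eq_lin by (intro forms_diff forms_Var forms_cmul forms_lin)
    moreover have "restrict_line p (\<pi> c i) = Var i" if "i \<noteq> 3" for c i
      using that by (simp add: \<pi>_def cmul_def ring_map.diff[OF ring_map_restrict_line]
          ring_map.mult[OF ring_map_restrict_line] restrict_line_dual_form restrict_line_Var)
    moreover have "T Q 1 * peval v (\<pi> c2 2) - T Q 2 * peval v (\<pi> c1 1) = 0"
      if Q: "Q \<in> Z - A" and v: "dot (rep_proj2 Q) v = 0" for Q v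
    proof -
      define l where "l = dot p v"
      have l: "peval v (dual_form P) = l"
        by (simp add: dual_form_eq_lin peval_lin l_def flip: p_def)
      have "T Q 3 * l + (T Q 1 * v 2 - T Q 2 * v 1) = 0"
        using v unfolding pairing_coord[of "($) (rep_proj2 Q)"] l_def .
      then show ?thesis
        using c[OF Q] unfolding \<pi>_def peval_diff peval_cmul peval_Var l by algebra
    qed
    ultimately show ?thesis
      by (intro exI[of _ "\<pi> c1 1"] exI[of _ "\<pi> c2 2"]) auto
  qed
  then obtain \<pi>1 \<pi>2 where \<pi>: "\<pi>1 \<in> forms 1" "\<pi>2 \<in> forms 1"
    "restrict_line p \<pi>1 = Var 1" "restrict_line p \<pi>2 = Var 2"
    "\<And>Q v. Q \<in> Z - A \<Longrightarrow> dot (rep_proj2 Q) v = 0 \<Longrightarrow>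
      T Q 1 * peval v \<pi>2 - T Q 2 * peval v \<pi>1 = 0"
    by blast
  define \<theta> where "\<theta> = lift_form j \<pi>1 \<pi>2 G"
  have \<theta>: "\<theta> \<in> forms (int k)" "\<theta> \<in> coeff_forms (int j)"
    unfolding \<theta>_def using lift_form_mem[OF G(1,2) \<pi>(1,2)] by auto
  have dvd: "dual_form Q dvd syz_map (arr_poly Z) \<theta>" if Q: "Q \<in> Z - A" for Q
    unfolding dual_form_eq_lin lin_dvd_iff[OF rep_proj2_nonzero]
  proof (intro allI impI)
    fix v :: "3 \<Rightarrow> complex"
    assume v: "dot (rep_proj2 Q) v = 0"
    \<comment> \<open>The projection of \<open>v\<close> is \<open>\<kappa>\<close> times the point of \<open>L\<close> with the parameters of \<open>Q\<close>.\<close>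
    define \<kappa> where "\<kappa> = (if T Q 1 = 0 then peval v \<pi>2 / T Q 2 else peval v \<pi>1 / T Q 1)"
    have "peval v \<pi>1 = \<kappa> * T Q 1" "peval v \<pi>2 = \<kappa> * T Q 2"
      using \<pi>(5)[OF Q v] off_P[of Q] Q by (auto simp: \<kappa>_def field_simps)
    from peval_lift_form[OF G(1,2) this] have "hsub (peval v) (($) (rep_proj2 Q)) \<theta> = 0"
      using G(3)[of Q] Q by (simp add: \<theta>_def)
    then show "peval v (syz_map (arr_poly Z) \<theta>) = 0"
      using peval_syz_map_arr_poly[OF finite_Z _ v \<theta>(1)] Q by simp
  qed
  have "arr_poly (Z - A) dvd syz_map (arr_poly Z) \<theta>"
    unfolding arr_poly_def[of "Z - A"]
  proof (rule prod_prime_dvd)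
    fix Q Q' assume QQ': "Q \<in> Z - A" "Q' \<in> Z - A" "dual_form Q dvd dual_form Q'"
    show "Q = Q'"
    proof (rule ccontr)
      assume "Q \<noteq> Q'"
      then have nc: "T Q' 1 * T Q 2 - T Q' 2 * T Q 1 \<noteq> 0"
        using not_collinear[of Q Q'] QQ' by (simp add: mult.commute)
      have "\<forall>v. dot (rep_proj2 Q) v = 0 \<longrightarrow> dot (rep_proj2 Q') v = 0"
        using QQ'(3) unfolding dual_form_eq_lin lin_dvd_iff[OF rep_proj2_nonzero] peval_lin .
      from spec[OF this, of "\<lambda>i. peval (T Q) (line_pt p i)"] show False
        using nc by (simp add: pairing_on_line)
    qed
  qed (use finite_Z prime_dual_form dvd in auto)
  then have "arr_poly (Z - A) * h dvd syz_map (arr_poly Z) \<theta> * h"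
    by (rule mult_dvd_mono) simp
  moreover have "arr_poly Z = arr_poly (Z - A) * h"
    unfolding arr_poly_def h_def using finite_Z finA by (intro prod.subset_diff)
  ultimately have "cmul h \<theta> \<in> syz Z k"
    using \<theta>(1) by (intro syzI forms_cmul) (simp_all add: syz_map_cmul mult.commute)
  moreover have hf: "h \<in> forms (int (card A))"
    unfolding h_def by (rule arr_poly_forms[OF finA(1)])
  ultimately have "cmul h \<theta> \<in> hom (D0 Z k) (int (card A) + int j)"
    using coeff_forms_cmul[OF hf \<theta>(2)] by (simp add: hom_D0)
  then show ?thesis
    using \<rho>D_lift_form[OF G(1,2) \<pi>(3,4)] hf hx unfolding \<theta>_def by blast
qed

text \<open>Conversely, at the point where \<open>L\<close> meets the line dual to \<open>Q\<close> no other line of the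
  arrangement passes, so the gradient is a nonzero multiple of \<open>Q\<close>.\<close>
lemma syzygy_vanishes_at:
  assumes \<theta>: "\<theta> \<in> syz Z k" and Q: "Q \<in> Z"
  shows "peval (T Q) (\<rho>D \<theta>) = 0"
proof -
  let ?v = "\<lambda>i. peval (T Q) (line_pt p i)"
  have v: "(\<Sum>i\<in>UNIV. rep_proj2 Q $ i * ?v i) = 0"
    by (simp add: pairing_on_line)
  have "peval ?v (arr_poly (Z - {Q})) \<noteq> 0"
    using finite_Z not_collinear[of _ Q] Q
    by (auto simp: peval_arr_poly pairing_on_line mult.commute)
  moreover have "peval ?v (arr_poly Z) = 0"
    using Q v finite_Z by (auto simp: peval_arr_poly)
  then have "peval ?v (syz_map (arr_poly Z) \<theta>) = 0"
    using \<theta> by (auto simp: syz_def peval_mult elim!: dvdE)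
  ultimately have "hsub (peval ?v) (($) (rep_proj2 Q)) \<theta> = 0"
    using peval_syz_map_arr_poly[OF finite_Z Q v, of \<theta> k] \<theta> by (simp add: syz_def Der_def)
  then show ?thesis
    by (simp add: peval_\<rho>D dual_pt_coord)
qed

lemma twisted_sections_D0:
  "D.twisted_sections j =
    {G \<in> forms (int (j + k)). deg3_le k G \<and> (\<forall>Q\<in>Z. peval (T Q) G = 0)}"
proof (intro equalityI subsetI)
  fix G assume G: "G \<in> D.twisted_sections j"
  then have reg: "Fract G (Var i ^ j) \<in> D.regular (chart P i)" if "i = 1 \<or> i = 2" for i
    using that by (auto simp: D.twisted_sections_def)
  have "peval (T Q) G = 0" if Q: "Q \<in> Z" for Q
  proof -
    obtain i where i: "i = 1 \<or> i = (2::3)" and Ti: "T Q i \<noteq> 0"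
      using off_P[OF Q] by blast
    then have i3: "i \<noteq> 3" by auto
    obtain x c where x: "x \<in> dual_line P" "c \<noteq> 0" "\<And>l. rep_proj2 x $ l = c * peval (T Q) (line_pt p l)"
      using line_point_ex[of "T Q"] off_P[OF Q] by metis
    have "x \<in> chart P i"
      using x Ti i3 by (simp add: chart_def peval_line_pt)
    then obtain \<theta> g d where g: "\<theta> \<in> hom (D0 Z k) d" "g \<in> forms d" "ev g x \<noteq> 0"
      "Fract (\<rho>D \<theta>) (restrict_line p g) = Fract G (Var i ^ j)"
      using reg[OF i] by (fastforce simp: D.regular_def stalk_def fracs_def)
    have "\<rho>D \<theta> * Var i ^ j = G * restrict_line p g"
      using g(4) restrict_line_nonzero[OF x(1) g(3)] by (simp add: eq_fract Var_nonzero)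
    then have "peval (T Q) (\<rho>D \<theta> * Var i ^ j) = peval (T Q) (G * restrict_line p g)"
      by simp
    moreover have "peval (T Q) (\<rho>D \<theta>) = 0"
      using syzygy_vanishes_at[OF _ Q] g(1) by (simp add: hom_D0)
    moreover have "peval (T Q) (restrict_line p g) \<noteq> 0"
      using g(3) ev_line_point[OF x(3) g(2)] by auto
    ultimately show ?thesis
      by (simp add: peval_mult)
  qed
  then show "G \<in> {G \<in> forms (int (j + k)). deg3_le k G \<and> (\<forall>Q\<in>Z. peval (T Q) G = 0)}"
    using D.numerator_homogeneous[OF reg[of 1]] by simp
next
  fix G assume "G \<in> {G \<in> forms (int (j + k)). deg3_le k G \<and> (\<forall>Q\<in>Z. peval (T Q) G = 0)}"
  then have G: "G \<in> forms (int (j + k))" "deg3_le k G" "\<And>Q. Q \<in> Z \<Longrightarrow> peval (T Q) G = 0"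
    by auto
  have "Fract G (Var i ^ j) \<in> D.regular (chart P i)" if i: "i \<noteq> 3" for i
    unfolding D.regular_def
  proof (intro CollectI ballI)
    fix x assume x: "x \<in> chart P i"
    then have xl: "x \<in> dual_line P" and xi: "rep_proj2 x $ i \<noteq> 0"
      by (auto simp: chart_def)
    obtain \<theta> h c where \<theta>: "\<rho>D \<theta> = G" "h \<in> forms c" "ev h x \<noteq> 0" "cmul h \<theta> \<in> hom (D0 Z k) (c + int j)"
      using local_lift[OF G xl] by blast
    interpret r: ring_map "restrict_line p" by (rule ring_map_restrict_line)
    have "h * Var i ^ j \<in> forms (c + int j)"
      using forms_mult[OF \<theta>(2) forms_power[OF forms_Var, of i j]] by simp
    moreover have "ev (h * Var i ^ j) x \<noteq> 0"
      using \<theta>(3) xi by (simp add: ev_mult ev_power ev_Var)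
    moreover have "Fract (\<rho>D (cmul h \<theta>)) (restrict_line p (h * Var i ^ j)) = Fract G (Var i ^ j)"
      using restrict_line_nonzero[OF xl \<theta>(3)] i \<theta>(1) D.\<rho>_scl[of h \<theta>]
      by (simp add: D0_def r.mult r.power restrict_line_Var eq_fract Var_nonzero)
    ultimately have "(cmul h \<theta>, h * Var i ^ j) \<in> stalk p (D0 Z k) \<rho>D x (Fract G (Var i ^ j))"
      using \<theta>(4) by (auto simp: stalk_def fracs_def)
    then show "stalk p (D0 Z k) \<rho>D x (Fract G (Var i ^ j)) \<noteq> {}"
      by blast
  qed
  then show "G \<in> D.twisted_sections j"
    by (simp add: D.twisted_sections_def)
qed

section \<open>Fat forms as global sections\<close>

lemma dual_coord_P: "dual_coord p (($) p) = point3"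
proof
  fix i
  show "dual_coord p (($) p) i = point3 i"
    using p3 exhaust_3[of i] by (auto simp: dual_coord_def point3_def)
qed

text \<open>In the coordinates \<open>t\<^sub>1, t\<^sub>2, s\<close> the point \<open>P\<close> is \<open>(0 : 0 : 1)\<close>. For a form of degree \<open>j + k\<close>, to
  vanish there to order \<open>j\<close> means to have degree at most \<open>k\<close> in \<open>s\<close>.\<close>
lemma fat_forms_iff:
  "F \<in> fat_forms Z j P (int (j + k)) \<longleftrightarrow>
    hsub cst (dual_pt p) F \<in> forms (int (j + k)) \<and> deg3_le k (hsub cst (dual_pt p) F) \<and>
    (\<forall>Q\<in>Z. peval (T Q) (hsub cst (dual_pt p) F) = 0)"
proof -
  define G where "G = hsub cst (dual_pt p) F"
  have dual_pt_forms: "dual_pt p i \<in> forms 1" for i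
    by (simp add: dual_pt_def forms_lin)
  have F: "F = hsub cst (\<lambda>i. lin (dual_coord_form p i)) G"
    unfolding G_def
    by (rule peval_eqI) (simp add: peval_hsub_cst peval_lin dual_coord_form dual_pt_coord)
  have forms: "F \<in> forms d \<longleftrightarrow> G \<in> forms d" for d
  proof
    show "F \<in> forms d \<Longrightarrow> G \<in> forms d"
      unfolding G_def by (rule hsub_cst_forms[OF dual_pt_forms])
    show "G \<in> forms d \<Longrightarrow> F \<in> forms d"
      unfolding F by (rule hsub_cst_forms[OF forms_lin])
  qed
  have at: "peval (dual_coord p q) G = peval q F" for q
    by (simp add: G_def peval_hsub_cst dual_pt_coord)
  have van: "vanish j (($) p) F \<longleftrightarrow> vanish j point3 G"
  proof
    assume "vanish j (($) p) F"
    then show "vanish j point3 G"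
      unfolding G_def dual_pt_def
      by (intro vanish_linear_substitution)
         (simp add: dual_pt_coord flip: dual_pt_def dual_coord_P)
  next
    assume "vanish j point3 G"
    then show "vanish j (($) p) F"
      unfolding F by (intro vanish_linear_substitution) (simp add: peval_lin dual_coord_form dual_coord_P)
  qed
  have low: "vanish j point3 G \<longleftrightarrow> deg3_le k G" if G: "G \<in> forms (int (j + k))"
    unfolding vanish_point3_iff[OF G] deg3_le_def
    using formsD[OF G] by (intro ball_cong refl) (force simp: mdeg_3)
  show ?thesis
    using van low forms at
    by (auto simp: fat_forms_def vanishes_to_order_eq ev_def simp flip: p_def G_def)
qed

end

section \<open>Transport along the splitting\<close>

text \<open>Functions \<open>\<Lambda> _ b\<close> that form linear coordinates on \<open>V\<close> determine its dimension: the vectors dual to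
  them are a basis. Linearity is required on \<open>V\<close> alone, since the coordinates will come from an isomorphism
  which is not defined elsewhere.\<close>
lemma dim_eq_card_coordinates:
  fixes \<Lambda> :: "poly3 \<Rightarrow> 'b \<Rightarrow> complex"
  assumes sub: "module.subspace cmul V" and B: "finite B"
    and add: "\<And>F G b. F \<in> V \<Longrightarrow> G \<in> V \<Longrightarrow> b \<in> B \<Longrightarrow> \<Lambda> (F + G) b = \<Lambda> F b + \<Lambda> G b"
    and scale: "\<And>c F b. F \<in> V \<Longrightarrow> b \<in> B \<Longrightarrow> \<Lambda> (cmul c F) b = c * \<Lambda> F b"
    and inj: "\<And>F. F \<in> V \<Longrightarrow> (\<And>b. b \<in> B \<Longrightarrow> \<Lambda> F b = 0) \<Longrightarrow> F = 0"
    and surj: "\<And>c. \<exists>F\<in>V. \<forall>b\<in>B. \<Lambda> F b = c b"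
  shows "vector_space.dim cmul V = card B"
proof -
  interpret vector_space "cmul :: complex \<Rightarrow> poly3 \<Rightarrow> poly3" by (rule vector_space_cmul)
  have "\<forall>b. \<exists>F\<in>V. \<forall>b'\<in>B. \<Lambda> F b' = (if b' = b then 1 else 0)"
  proof
    fix b show "\<exists>F\<in>V. \<forall>b'\<in>B. \<Lambda> F b' = (if b' = b then 1 else 0)"
      by (rule surj)
  qed
  then obtain e where e: "\<And>b. e b \<in> V" "\<And>b b'. b' \<in> B \<Longrightarrow> \<Lambda> (e b) b' = (if b' = b then 1 else 0)"
    by metis
  have comb: "(\<Sum>b\<in>A. cmul (c b) (e b)) \<in> V \<and>
      (\<forall>b'\<in>B. \<Lambda> (\<Sum>b\<in>A. cmul (c b) (e b)) b' = (if b' \<in> A then c b' else 0))"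
    if "finite A" for A c
    using that
  proof (induction A)
    case empty
    have "0 \<in> V"
      by (rule subspace_0[OF sub])
    then show ?case
      using scale[of 0 _ 0] by simp
  next
    case (insert b A)
    have "cmul (c b) (e b) \<in> V"
      by (rule subspace_scale[OF sub e(1)])
    then show ?case
      using insert subspace_add[OF sub] by (auto simp: add scale e)
  qed
  have inj_e: "inj_on e B"
  proof (rule inj_onI)
    fix b b' assume "b \<in> B" "b' \<in> B" "e b = e b'"
    then show "b = b'"
      using e(2)[of b b] e(2)[of b b'] by (auto split: if_splits)
  qed
  have "span (e ` B) = span V"
  proof
    show "span (e ` B) \<subseteq> span V"
      using e(1) by (intro span_mono) auto
    have "F \<in> span (e ` B)" if F: "F \<in> V" for F
    proof -
      let ?S = "\<Sum>b\<in>B. cmul (\<Lambda> F b) (e b)"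
      have S: "?S \<in> V" "\<And>b. b \<in> B \<Longrightarrow> \<Lambda> ?S b = \<Lambda> F b"
        using comb[OF B, of "\<Lambda> F"] by auto
      have neg: "cmul (-1) ?S \<in> V"
        by (rule subspace_scale[OF sub S(1)])
      have "F + cmul (-1) ?S = 0"
      proof (rule inj)
        show "F + cmul (-1) ?S \<in> V"
          by (rule subspace_add[OF sub F neg])
        show "\<Lambda> (F + cmul (-1) ?S) b = 0" if b: "b \<in> B" for b
          by (simp only: add[OF F neg b] scale[OF S(1) b] S(2)[OF b]) simp
      qed
      then have "F = ?S"
        by (simp add: scale_minus_left)
      then show ?thesis
        by (metis (no_types, lifting) imageI span_base span_scale span_sum)
    qed
    then show "span V \<subseteq> span (e ` B)"
      by (intro span_minimal subsetI) (auto simp: subspace_span)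
  qed
  moreover have "independent (e ` B)"
  proof (rule independent_if_scalars_zero)
    show "finite (e ` B)"
      using B by simp
    fix c v assume c: "(\<Sum>v\<in>e ` B. cmul (c v) v) = 0" and v: "v \<in> e ` B"
    then obtain b where b: "b \<in> B" "v = e b" by blast
    have "(\<Sum>b\<in>B. cmul (c (e b)) (e b)) = 0"
      using c by (simp add: sum.reindex[OF inj_e])
    then have "c (e b) = \<Lambda> 0 b"
      using comb[OF B, of "\<lambda>b. c (e b)"] b(1) by simp
    also have "\<dots> = 0"
      using scale[of 0 b 0] subspace_0[OF sub] b(1) by simp
    finally show "c v = 0"
      by (simp add: b)
  qed
  ultimately have "dim V = card (e ` B)"
    by (rule dim_eq_card)
  then show ?thesis
    by (simp add: card_image[OF inj_e])
qed

text \<open>The dimension of \<open>H\<^sup>0(L, \<O>(d))\<close>.\<close>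
lemma card_binary_monomials:
  "finite {m :: mono3. lookup m 3 = 0 \<and> int (mdeg m) = d} \<and>
   int (card {m :: mono3. lookup m 3 = 0 \<and> int (mdeg m) = d}) = max 0 (d + 1)"
proof (cases "d < 0")
  case True
  then have "{m :: mono3. lookup m 3 = 0 \<and> int (mdeg m) = d} = {}"
    by auto
  then show ?thesis
    using True by simp
next
  case False
  define D where "D = nat d"
  define mon where "mon n = single (1::3) n + single 2 (D - n)" for n
  have look: "lookup (mon n) 1 = n" "lookup (mon n) 2 = D - n"
    "lookup (mon n) 3 = 0" for n
    by (simp_all add: mon_def lookup_add lookup_single)
  have "{m :: mono3. lookup m 3 = 0 \<and> int (mdeg m) = d} = mon ` {0..D}"
  proof (intro equalityI subsetI)
    fix m :: mono3
    assume "m \<in> {m. lookup m 3 = 0 \<and> int (mdeg m) = d}"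
    then have m: "lookup m 3 = 0"
      "lookup m 1 + lookup m 2 = D"
      by (auto simp: mdeg_3 D_def)
    have "m = mon (lookup m 1)"
    proof (rule poly_mapping_eqI)
      fix i :: 3
      show "lookup m i = lookup (mon (lookup m 1)) i"
        using exhaust_3[of i] m look by auto
    qed
    moreover have "lookup m 1 \<in> {0..D}"
      using m by simp
    ultimately show "m \<in> mon ` {0..D}"
      by (rule image_eqI)
  next
    fix m assume "m \<in> mon ` {0..D}"
    then show "m \<in> {m. lookup m 3 = 0 \<and> int (mdeg m) = d}"
      using False by (auto simp: mdeg_3 look D_def)
  qed
  moreover have "inj_on mon {0..D}"
    by (rule inj_onI) (metis look(1))
  ultimately show ?thesis
    using False by (simp add: card_image D_def)
qed

context syz_chart
begin

text \<open>The regular functions of \<open>\<O>(n)\<close>, and the sections that they define.\<close>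
abbreviation "B n \<equiv> realization.regular p (twist n) (restrict_line p)"
abbreviation "sB n \<equiv> realization.sect p (twist n) (restrict_line p)"

interpretation O: realization P p "twist 0" "restrict_line p" 0 0
  by (rule realization_twist)

definition tuple :: "(nat \<Rightarrow> int) \<Rightarrow> proj2 set \<Rightarrow> (nat \<Rightarrow> poly3 fract) \<Rightarrow> nat \<Rightarrow> osection" where
  "tuple a V \<psi> = (\<lambda>i\<in>{..<k + 1}. sB (- a i) V (\<psi> i))"

lemma sections_direct_sum:
  assumes "open_in_line P V" "V \<noteq> {}"
  shows "sec (direct_sum (k + 1) (\<lambda>i. line_bundle P (- a i))) V =
    {tuple a V \<psi> | \<psi>. \<forall>i<k + 1. \<psi> i \<in> B (- a i) V}" (is "?l = ?r")
proof (intro equalityI subsetI)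
  have sec: "sec (line_bundle P n) V = sB n V ` B n V" for n
    using realization.sections_on_eq[OF realization_twist assms] by (simp add: line_bundle_def sheaf_on_line_def)
  fix s
  {
    assume "s \<in> ?l"
    then have s: "s \<in> (\<Pi>\<^sub>E i\<in>{..<k + 1}. sB (- a i) V ` B (- a i) V)"
      by (simp add: direct_sum_def sec)
    then have "\<forall>i\<in>{..<k + 1}. \<exists>\<psi>. \<psi> \<in> B (- a i) V \<and> s i = sB (- a i) V \<psi>"
      by (force dest: PiE_mem)
    then obtain \<psi> where \<psi>: "\<And>i. i < k + 1 \<Longrightarrow> \<psi> i \<in> B (- a i) V" "\<And>i. i < k + 1 \<Longrightarrow> s i = sB (- a i) V (\<psi> i)"
      by (metis lessThan_iff)
    then have "s = tuple a V \<psi>"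
      using PiE_arb[OF s] by (auto simp: tuple_def fun_eq_iff restrict_def)
    then show "s \<in> ?r"
      using \<psi>(1) by blast
  }
  assume "s \<in> ?r"
  then show "s \<in> ?l"
    by (auto simp: direct_sum_def sec tuple_def)
qed

lemma tuple_inj:
  assumes "V \<noteq> {}" "\<And>i. i < k + 1 \<Longrightarrow> \<psi> i \<in> B (- a i) V" "tuple a V \<psi> = tuple a V \<psi>'" "i < k + 1"
  shows "\<psi> i = \<psi>' i"
proof -
  have "sB (- a i) V (\<psi> i) = sB (- a i) V (\<psi>' i)"
    using fun_cong[OF assms(3), of i] assms(4) by (simp add: tuple_def)
  then show ?thesis
    by (rule realization.section_inj[OF realization_twist assms(1) assms(2)[OF assms(4)]])
qed

text \<open>The isomorphism of sheaves in terms of fractions: over each nonempty open set \<open>V\<close> of the line it maps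
  a regular fraction \<open>\<phi>\<close> to \<open>k + 1\<close> regular fractions \<open>f V \<phi> i\<close>. The properties of \<open>f\<close> say that its values
  are regular, that it is additive, linear over the regular functions and compatible with restriction, and
  that it is injective and surjective.\<close>
lemma iso_on_functions:
  assumes "splitting_type Z k P a"
  obtains f where
    "\<And>V \<phi> i. open_in_line P V \<Longrightarrow> V \<noteq> {} \<Longrightarrow> \<phi> \<in> D.regular V \<Longrightarrow> i < k + 1 \<Longrightarrow> f V \<phi> i \<in> B (- a i) V"
    "\<And>V \<phi> \<phi>' i. open_in_line P V \<Longrightarrow> V \<noteq> {} \<Longrightarrow> \<phi> \<in> D.regular V \<Longrightarrow> \<phi>' \<in> D.regular V \<Longrightarrow> i < k + 1 \<Longrightarrow>
      f V (\<phi> + \<phi>') i = f V \<phi> i + f V \<phi>' i"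
    "\<And>V \<phi> \<gamma> i. open_in_line P V \<Longrightarrow> V \<noteq> {} \<Longrightarrow> \<phi> \<in> D.regular V \<Longrightarrow> \<gamma> \<in> B 0 V \<Longrightarrow> i < k + 1 \<Longrightarrow>
      f V (\<gamma> * \<phi>) i = \<gamma> * f V \<phi> i"
    "\<And>V V' \<phi> i. open_in_line P V \<Longrightarrow> open_in_line P V' \<Longrightarrow> V' \<noteq> {} \<Longrightarrow> V' \<subseteq> V \<Longrightarrow> \<phi> \<in> D.regular V \<Longrightarrow>
      i < k + 1 \<Longrightarrow> f V' \<phi> i = f V \<phi> i"
    "\<And>V \<phi> \<phi>'. open_in_line P V \<Longrightarrow> V \<noteq> {} \<Longrightarrow> \<phi> \<in> D.regular V \<Longrightarrow> \<phi>' \<in> D.regular V \<Longrightarrow>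
      (\<And>i. i < k + 1 \<Longrightarrow> f V \<phi> i = f V \<phi>' i) \<Longrightarrow> \<phi> = \<phi>'"
    "\<And>V \<psi>. open_in_line P V \<Longrightarrow> V \<noteq> {} \<Longrightarrow> (\<And>i. i < k + 1 \<Longrightarrow> \<psi> i \<in> B (- a i) V) \<Longrightarrow>
      \<exists>\<phi>\<in>D.regular V. \<forall>i<k + 1. f V \<phi> i = \<psi> i"
proof -
  let ?F = "sheaf_on_line (D0 Z k) P" and ?G = "direct_sum (k + 1) (\<lambda>i. line_bundle P (- a i))"
  obtain \<Phi> where \<Phi>: "\<forall>V. open_in_line P V \<longrightarrow>
     bij_betw (\<Phi> V) (sec ?F V) (sec ?G V) \<and>
     (\<forall>s\<in>sec ?F V. \<forall>t\<in>sec ?F V. \<Phi> V (sadd ?F s t) = sadd ?G (\<Phi> V s) (\<Phi> V t)) \<and>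
     (\<forall>c\<in>sections_on (twist 0) P V. \<forall>s\<in>sec ?F V. \<Phi> V (sscl ?F c s) = sscl ?G c (\<Phi> V s)) \<and>
     (\<forall>V'. open_in_line P V' \<and> V' \<subseteq> V \<longrightarrow>
        (\<forall>s\<in>sec ?F V. \<Phi> V' (res ?F V' s) = res ?G V' (\<Phi> V s)))"
    using assms[unfolded splitting_type_def sheaf_iso_def] by (rule exE)
  have bij: "bij_betw (\<Phi> V) (sec ?F V) (sec ?G V)"
    and add: "\<And>s t. s \<in> sec ?F V \<Longrightarrow> t \<in> sec ?F V \<Longrightarrow>
      \<Phi> V (sadd ?F s t) = sadd ?G (\<Phi> V s) (\<Phi> V t)"
    and scl: "\<And>c s. c \<in> sections_on (twist 0) P V \<Longrightarrow> s \<in> sec ?F V \<Longrightarrow>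
      \<Phi> V (sscl ?F c s) = sscl ?G c (\<Phi> V s)"
    and res: "\<And>V' s. open_in_line P V' \<Longrightarrow> V' \<subseteq> V \<Longrightarrow> s \<in> sec ?F V \<Longrightarrow>
      \<Phi> V' (res ?F V' s) = res ?G V' (\<Phi> V s)"
    if "open_in_line P V" for V
    using spec[OF \<Phi>, of V] that by simp_all
  have sub: "V \<subseteq> dual_line P" if "open_in_line P V" for V
    using that by (auto simp: open_in_line_def)
  have secF: "sec ?F V = D.sect V ` D.regular V" if "open_in_line P V" "V \<noteq> {}" for V
    using D.sections_on_eq[OF that] by (simp add: sheaf_on_line_def)
  have "\<exists>\<psi>. (\<forall>i<k + 1. \<psi> i \<in> B (- a i) V) \<and> \<Phi> V (D.sect V \<phi>) = tuple a V \<psi>"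
    if V: "open_in_line P V" "V \<noteq> {}" and \<phi>: "\<phi> \<in> D.regular V" for V \<phi>
  proof -
    have "\<Phi> V (D.sect V \<phi>) \<in> sec ?G V"
      using bij_betwE[OF bij[OF V(1)]] \<phi> by (auto simp: secF[OF V])
    then show ?thesis
      unfolding sections_direct_sum[OF V] by blast
  qed
  then obtain f where f: "\<And>V \<phi>. open_in_line P V \<Longrightarrow> V \<noteq> {} \<Longrightarrow> \<phi> \<in> D.regular V \<Longrightarrow>
      (\<forall>i<k + 1. f V \<phi> i \<in> B (- a i) V) \<and> \<Phi> V (D.sect V \<phi>) = tuple a V (f V \<phi>)"
    by metis
  have f_unique: "f V \<phi> i = \<psi> i" if V: "open_in_line P V" "V \<noteq> {}" and \<phi>: "\<phi> \<in> D.regular V"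
    and \<psi>: "\<Phi> V (D.sect V \<phi>) = tuple a V \<psi>" and i: "i < k + 1" for V \<phi> \<psi> i
    using tuple_inj[OF V(2), of "f V \<phi>" a \<psi> i] f[OF V \<phi>] \<psi> i by simp
  show ?thesis
  proof (rule that)
    show "f V \<phi> i \<in> B (- a i) V" if "open_in_line P V" "V \<noteq> {}" "\<phi> \<in> D.regular V" "i < k + 1" for V \<phi> i
      using f that by blast
  next
    fix V \<phi> \<phi>' i
    assume V: "open_in_line P V" "V \<noteq> {}" and \<phi>: "\<phi> \<in> D.regular V" "\<phi>' \<in> D.regular V" and i: "i < k + 1"
    have "\<Phi> V (D.sect V (\<phi> + \<phi>')) = \<Phi> V (sadd ?F (D.sect V \<phi>) (D.sect V \<phi>'))"
      by (simp add: D.sadd_section[OF sub[OF V(1)] \<phi>])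
    also have "\<dots> = sadd ?G (tuple a V (f V \<phi>)) (tuple a V (f V \<phi>'))"
      using add[OF V(1)] \<phi> f[OF V] by (simp add: secF[OF V])
    also have "\<dots> = tuple a V (\<lambda>i. f V \<phi> i + f V \<phi>' i)"
      using realization.sadd_section[OF realization_twist sub[OF V(1)]] f[OF V \<phi>(1)] f[OF V \<phi>(2)]
      by (auto simp: direct_sum_def tuple_def line_bundle_def fun_eq_iff restrict_def)
    finally show "f V (\<phi> + \<phi>') i = f V \<phi> i + f V \<phi>' i"
      using f_unique[OF V D.regular_add[OF sub[OF V(1)] \<phi>]] i by blast
  next
    fix V \<phi> \<gamma> i
    assume V: "open_in_line P V" "V \<noteq> {}" and \<phi>: "\<phi> \<in> D.regular V" and \<gamma>: "\<gamma> \<in> B 0 V" and i: "i < k + 1"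
    define c where "c = sB 0 V \<gamma>"
    have c_eq: "c = (\<lambda>x. if x \<in> V then stalk p (twist 0) (restrict_line p) x \<gamma> else {})"
      by (simp add: c_def O.sect_def fun_eq_iff)
    have c: "c \<in> sections_on (twist 0) P V"
      unfolding c_def by (rule O.section_mem_sections_on[OF sub[OF V(1)] \<gamma>])
    have ne: "\<And>x. x \<in> V \<Longrightarrow> stalk p (twist 0) (restrict_line p) x \<gamma> \<noteq> {}"
      using \<gamma> by (simp add: O.regular_def)
    have "sscl ?F c (D.sect V \<phi>) = D.sect V (\<gamma> * \<phi>)"
      unfolding c_eq by (rule D.sscl_section[OF sub[OF V(1)] _ \<phi>]) (rule ne)
    then have "\<Phi> V (D.sect V (\<gamma> * \<phi>)) = \<Phi> V (sscl ?F c (D.sect V \<phi>))"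
      by (simp only:)
    also have "\<dots> = sscl ?G c (tuple a V (f V \<phi>))"
      using scl[OF V(1) c] \<phi> f[OF V \<phi>] by (simp add: secF[OF V])
    also have "\<dots> = tuple a V (\<lambda>i. \<gamma> * f V \<phi> i)"
    proof -
      have "sscl (line_bundle P (- a i)) c (sB (- a i) V (f V \<phi> i)) = sB (- a i) V (\<gamma> * f V \<phi> i)"
        if "i < k + 1" for i
        unfolding c_eq line_bundle_def
        by (rule realization.sscl_section[OF realization_twist sub[OF V(1)]])
           (use ne f[OF V \<phi>] that in blast)+
      then show ?thesis
        by (simp add: direct_sum_def tuple_def fun_eq_iff)
    qed
    finally have "\<Phi> V (D.sect V (\<gamma> * \<phi>)) = tuple a V (\<lambda>i. \<gamma> * f V \<phi> i)" .
    moreover have "\<gamma> * \<phi> \<in> D.regular V"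
      by (rule D.regular_scl[OF sub[OF V(1)] _ \<phi>]) (rule ne)
    ultimately show "f V (\<gamma> * \<phi>) i = \<gamma> * f V \<phi> i"
      using f_unique[OF V] i by blast
  next
    fix V V' \<phi> i
    assume V: "open_in_line P V" and V': "open_in_line P V'" "V' \<noteq> {}" "V' \<subseteq> V"
      and \<phi>: "\<phi> \<in> D.regular V" and i: "i < k + 1"
    have ne: "V \<noteq> {}" and \<phi>': "\<phi> \<in> D.regular V'"
      using V' \<phi> D.regular_antimono by auto
    have "\<Phi> V' (D.sect V' \<phi>) = \<Phi> V' (res ?F V' (D.sect V \<phi>))"
      by (simp add: D.res_section[OF V'(3)])
    also have "\<dots> = res ?G V' (tuple a V (f V \<phi>))"
      using res[OF V V'(1,3)] \<phi> f[OF V ne \<phi>] by (simp add: secF[OF V ne])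
    also have "\<dots> = tuple a V' (f V \<phi>)"
      using realization.res_section[OF realization_twist V'(3)]
      by (auto simp: direct_sum_def tuple_def line_bundle_def fun_eq_iff restrict_def)
    finally show "f V' \<phi> i = f V \<phi> i"
      using f_unique[OF V'(1,2) \<phi>'] i by blast
  next
    fix V \<phi> \<phi>'
    assume V: "open_in_line P V" "V \<noteq> {}" and \<phi>: "\<phi> \<in> D.regular V" "\<phi>' \<in> D.regular V"
      and eq: "\<And>i. i < k + 1 \<Longrightarrow> f V \<phi> i = f V \<phi>' i"
    have "tuple a V (f V \<phi>) = tuple a V (f V \<phi>')"
      by (auto simp: tuple_def eq fun_eq_iff restrict_def)
    then have "D.sect V \<phi> = D.sect V \<phi>'"
      using f[OF V \<phi>(1)] f[OF V \<phi>(2)] \<phi>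
      by (intro inj_onD[OF bij_betw_imp_inj_on[OF bij[OF V(1)]]]) (auto simp: secF[OF V])
    then show "\<phi> = \<phi>'"
      by (rule D.section_inj[OF V(2) \<phi>(1)])
  next
    fix V \<psi>
    assume V: "open_in_line P V" "V \<noteq> {}" and \<psi>: "\<And>i. i < k + 1 \<Longrightarrow> \<psi> i \<in> B (- a i) V"
    have "tuple a V \<psi> \<in> sec ?G V"
      unfolding sections_direct_sum[OF V] using \<psi> by blast
    then obtain \<phi> where \<phi>: "\<phi> \<in> D.regular V" "\<Phi> V (D.sect V \<phi>) = tuple a V \<psi>"
      using bij_betw_imp_surj_on[OF bij[OF V(1)]] by (force simp: secF[OF V])
    then show "\<exists>\<phi>\<in>D.regular V. \<forall>i<k + 1. f V \<phi> i = \<psi> i"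
      using f_unique[OF V] by blast
  qed
qed

text \<open>A pair of sections over the two charts glues to a section of the \<open>j\<close>-th twist iff over the intersection
  they differ by the factor \<open>t\<^sub>1\<^sup>j / t\<^sub>2\<^sup>j\<close>. This factor is a regular function there, so the isomorphism and
  its inverse preserve the condition. Linearity over \<open>\<complex>\<close> comes from the constant functions.\<close>
lemma iso_on_twisted_sections:
  assumes "splitting_type Z k P a"
  obtains g where
    "\<And>G i. G \<in> D.twisted_sections j \<Longrightarrow> i < k + 1 \<Longrightarrow> g G i \<in> forms (int j - a i) \<and> deg3_le 0 (g G i)"
    "\<And>G G' i. G \<in> D.twisted_sections j \<Longrightarrow> G' \<in> D.twisted_sections j \<Longrightarrow> G + G' \<in> D.twisted_sections j \<Longrightarrow>
      i < k + 1 \<Longrightarrow> g (G + G') i = g G i + g G' i"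
    "\<And>G c i. G \<in> D.twisted_sections j \<Longrightarrow> cmul c G \<in> D.twisted_sections j \<Longrightarrow> i < k + 1 \<Longrightarrow>
      g (cmul c G) i = cmul c (g G i)"
    "\<And>G G'. G \<in> D.twisted_sections j \<Longrightarrow> G' \<in> D.twisted_sections j \<Longrightarrow>
      (\<And>i. i < k + 1 \<Longrightarrow> g G i = g G' i) \<Longrightarrow> G = G'"
    "\<And>H. (\<And>i. i < k + 1 \<Longrightarrow> H i \<in> forms (int j - a i) \<and> deg3_le 0 (H i)) \<Longrightarrow>
      \<exists>G\<in>D.twisted_sections j. \<forall>i<k + 1. g G i = H i"
proof (rule iso_on_functions[OF assms])
  fix f
  assume mem: "\<And>V \<phi> i. open_in_line P V \<Longrightarrow> V \<noteq> {} \<Longrightarrow> \<phi> \<in> D.regular V \<Longrightarrow> i < k + 1 \<Longrightarrow> f V \<phi> i \<in> B (- a i) V"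
    and add: "\<And>V \<phi> \<phi>' i. open_in_line P V \<Longrightarrow> V \<noteq> {} \<Longrightarrow> \<phi> \<in> D.regular V \<Longrightarrow> \<phi>' \<in> D.regular V \<Longrightarrow> i < k + 1 \<Longrightarrow>
      f V (\<phi> + \<phi>') i = f V \<phi> i + f V \<phi>' i"
    and scl: "\<And>V \<phi> \<gamma> i. open_in_line P V \<Longrightarrow> V \<noteq> {} \<Longrightarrow> \<phi> \<in> D.regular V \<Longrightarrow> \<gamma> \<in> B 0 V \<Longrightarrow> i < k + 1 \<Longrightarrow>
      f V (\<gamma> * \<phi>) i = \<gamma> * f V \<phi> i"
    and res: "\<And>V V' \<phi> i. open_in_line P V \<Longrightarrow> open_in_line P V' \<Longrightarrow> V' \<noteq> {} \<Longrightarrow> V' \<subseteq> V \<Longrightarrow> \<phi> \<in> D.regular V \<Longrightarrow>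
      i < k + 1 \<Longrightarrow> f V' \<phi> i = f V \<phi> i"
    and inj: "\<And>V \<phi> \<phi>'. open_in_line P V \<Longrightarrow> V \<noteq> {} \<Longrightarrow> \<phi> \<in> D.regular V \<Longrightarrow> \<phi>' \<in> D.regular V \<Longrightarrow>
      (\<And>i. i < k + 1 \<Longrightarrow> f V \<phi> i = f V \<phi>' i) \<Longrightarrow> \<phi> = \<phi>'"
    and surj: "\<And>V \<psi>. open_in_line P V \<Longrightarrow> V \<noteq> {} \<Longrightarrow> (\<And>i. i < k + 1 \<Longrightarrow> \<psi> i \<in> B (- a i) V) \<Longrightarrow>
      \<exists>\<phi>\<in>D.regular V. \<forall>i<k + 1. f V \<phi> i = \<psi> i"
  define V1 where "V1 = chart P 1"
  define V2 where "V2 = chart P 2"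
  have o: "open_in_line P V1" "open_in_line P V2" "open_in_line P (V1 \<inter> V2)"
    by (simp_all add: V1_def V2_def open_chart open_chart_Int)
  have ne: "V1 \<noteq> {}" "V2 \<noteq> {}" "V1 \<inter> V2 \<noteq> {}"
    using charts_meet by (auto simp: V1_def V2_def)
  have sub: "V1 \<inter> V2 \<subseteq> V1" "V1 \<inter> V2 \<subseteq> V2"
    by auto
  let ?q = "\<lambda>i G. Fract G (Var i ^ j :: poly3)"
  define \<gamma> where "\<gamma> = Fract (Var 1 ^ j) (Var 2 ^ j :: poly3)"
  have \<gamma>q: "\<gamma> * ?q 1 G = ?q 2 G" for G
    by (simp add: \<gamma>_def eq_fract Var_nonzero)
  have const_reg: "Fract (cst c) 1 \<in> B 0 V" for c V
  proof -
    have "(cst c, 1) \<in> stalk p (twist 0) (restrict_line p) x (Fract (cst c) 1)" for x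
      using restrict_line_binary[OF deg3_le_cst, of c] ring_map.one[OF ring_map_restrict_line]
      by (auto simp: stalk_def fracs_def hom_twist ev_one intro!: exI[of _ 0] forms_cst forms_one)
    then show ?thesis
      by (auto simp: O.regular_def)
  qed
  have \<gamma>_reg: "\<gamma> \<in> B 0 (V1 \<inter> V2)"
    unfolding O.regular_def
  proof (intro CollectI ballI)
    fix x assume "x \<in> V1 \<inter> V2"
    moreover have "(Var i :: poly3) ^ j \<in> forms (int j)" for i
      using forms_power[OF forms_Var, of i j] by simp
    ultimately have "(Var 1 ^ j, Var 2 ^ j) \<in> stalk p (twist 0) (restrict_line p) x \<gamma>"
      by (auto simp: stalk_def fracs_def hom_twist V2_def chart_def ev_power ev_Var \<gamma>_def
          ring_map.power[OF ring_map_restrict_line] restrict_line_Var)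
    then show "stalk p (twist 0) (restrict_line p) x \<gamma> \<noteq> {}"
      by blast
  qed
  have TS: "G \<in> D.twisted_sections j \<longleftrightarrow> ?q 1 G \<in> D.regular V1 \<and> ?q 2 G \<in> D.regular V2" for G
    by (simp add: D.twisted_sections_def V1_def V2_def)
  have TB: "H \<in> forms (int j - a i) \<and> deg3_le 0 H \<longleftrightarrow> ?q 1 H \<in> B (- a i) V1 \<and> ?q 2 H \<in> B (- a i) V2" for H i
    using twisted_sections_twist[of "- a i" j] realization.twisted_sections_def[OF realization_twist[of "- a i"], of j]
    unfolding V1_def V2_def by auto
  have glue: "f V2 \<phi>2 i = \<gamma> * f V1 \<phi>1 i"
    if "\<phi>1 \<in> D.regular V1" "\<phi>2 \<in> D.regular V2" "\<phi>2 = \<gamma> * \<phi>1" "i < k + 1" for \<phi>1 \<phi>2 i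
  proof -
    have "f V2 \<phi>2 i = f (V1 \<inter> V2) (\<gamma> * \<phi>1) i"
      using res[OF o(2,3) ne(3) sub(2) that(2,4)] that(3) by simp
    also have "\<dots> = \<gamma> * f (V1 \<inter> V2) \<phi>1 i"
      using scl[OF o(3) ne(3) _ \<gamma>_reg that(4)] that(1) D.regular_antimono[OF sub(1)] by blast
    also have "\<dots> = \<gamma> * f V1 \<phi>1 i"
      using res[OF o(1,3) ne(3) sub(1) that(1,4)] by simp
    finally show ?thesis .
  qed
  have glued: "\<psi>2 * Fract (Var 2 ^ j) 1 = \<psi>1 * Fract (Var 1 ^ j) 1" if "\<psi>2 = \<gamma> * \<psi>1" for \<psi>1 \<psi>2
  proof -
    have "\<psi>2 * Fract (Var 2 ^ j) 1 = \<psi>1 * (\<gamma> * Fract (Var 2 ^ j) 1)"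
      unfolding that by (simp only: ac_simps)
    also have "\<gamma> * Fract (Var 2 ^ j) 1 = Fract (Var 1 ^ j) 1"
      by (simp add: \<gamma>_def eq_fract Var_nonzero)
    finally show ?thesis .
  qed
  have "\<exists>H. f V1 (?q 1 G) i = ?q 1 H \<and> f V2 (?q 2 G) i = ?q 2 H"
    if G: "G \<in> D.twisted_sections j" and i: "i < k + 1" for G i
  proof -
    have r: "?q 1 G \<in> D.regular V1" "?q 2 G \<in> D.regular V2"
      using G TS by auto
    have "f V2 (?q 2 G) i = \<gamma> * f V1 (?q 1 G) i"
      using glue[OF r] i by (simp add: \<gamma>q)
    from realization.global_twisted_section[OF realization_twist
        mem[OF o(1) ne(1) r(1) i, unfolded V1_def] mem[OF o(2) ne(2) r(2) i, unfolded V2_def]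
        glued[OF this, unfolded V1_def V2_def]]
    show ?thesis
      by (simp add: V1_def V2_def)
  qed
  then obtain g where g: "\<And>G i. G \<in> D.twisted_sections j \<Longrightarrow> i < k + 1 \<Longrightarrow>
      f V1 (?q 1 G) i = ?q 1 (g G i) \<and> f V2 (?q 2 G) i = ?q 2 (g G i)"
    by metis
  have q_inj: "H = H'" if "?q i H = ?q i H'" for H H' i
    using that by (simp add: eq_fract Var_nonzero)
  show ?thesis
  proof (rule that)
    fix G i assume G: "G \<in> D.twisted_sections j" and i: "i < k + 1"
    show "g G i \<in> forms (int j - a i) \<and> deg3_le 0 (g G i)"
      using mem[OF o(1) ne(1) _ i] mem[OF o(2) ne(2) _ i] G unfolding TB TS
      by (simp flip: g[OF G i])
  next
    fix G G' i
    assume G: "G \<in> D.twisted_sections j" "G' \<in> D.twisted_sections j" "G + G' \<in> D.twisted_sections j" and i: "i < k + 1"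
    have q_add: "?q 1 (H + H') = ?q 1 H + ?q 1 H'" for H H'
      by (simp add: eq_fract Var_nonzero algebra_simps)
    have "?q 1 (g (G + G') i) = ?q 1 (g G i + g G' i)"
      unfolding q_add using g[OF G(1) i] g[OF G(2) i] g[OF G(3) i] add[OF o(1) ne(1) _ _ i] G
      by (simp add: TS q_add)
    then show "g (G + G') i = g G i + g G' i"
      by (rule q_inj)
  next
    fix G c i
    assume G: "G \<in> D.twisted_sections j" "cmul c G \<in> D.twisted_sections j" and i: "i < k + 1"
    have q_scl: "?q 1 (cmul c H) = Fract (cst c) 1 * ?q 1 H" for H
      by (simp add: cmul_def)
    have "?q 1 (g (cmul c G) i) = f V1 (?q 1 (cmul c G)) i"
      using g[OF G(2) i] by simp
    also have "\<dots> = Fract (cst c) 1 * f V1 (?q 1 G) i"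
      unfolding q_scl using scl[OF o(1) ne(1) _ const_reg i] G(1) TS by blast
    also have "\<dots> = ?q 1 (cmul c (g G i))"
      unfolding q_scl by (simp only: conjunct1[OF g[OF G(1) i]])
    finally show "g (cmul c G) i = cmul c (g G i)"
      by (rule q_inj)
  next
    fix G G'
    assume G: "G \<in> D.twisted_sections j" "G' \<in> D.twisted_sections j"
      and eq: "\<And>i. i < k + 1 \<Longrightarrow> g G i = g G' i"
    have "?q 1 G = ?q 1 G'"
    proof (rule inj[OF o(1) ne(1)])
      show "f V1 (?q 1 G) i = f V1 (?q 1 G') i" if "i < k + 1" for i
        using g[OF G(1) that] g[OF G(2) that] eq[OF that] by simp
    qed (use G TS in auto)
    then show "G = G'"
      by (rule q_inj)
  next
    fix H
    assume H: "\<And>i. i < k + 1 \<Longrightarrow> H i \<in> forms (int j - a i) \<and> deg3_le 0 (H i)"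
    obtain \<phi>1 where \<phi>1: "\<phi>1 \<in> D.regular V1" "\<And>i. i < k + 1 \<Longrightarrow> f V1 \<phi>1 i = ?q 1 (H i)"
      using surj[OF o(1) ne(1), of "\<lambda>i. ?q 1 (H i)"] H unfolding TB by blast
    obtain \<phi>2 where \<phi>2: "\<phi>2 \<in> D.regular V2" "\<And>i. i < k + 1 \<Longrightarrow> f V2 \<phi>2 i = ?q 2 (H i)"
      using surj[OF o(2) ne(2), of "\<lambda>i. ?q 2 (H i)"] H unfolding TB by blast
    have r: "\<phi>1 \<in> D.regular (V1 \<inter> V2)" "\<phi>2 \<in> D.regular (V1 \<inter> V2)"
      using \<phi>1(1) \<phi>2(1) D.regular_antimono sub by blast+
    have "\<gamma> * \<phi>1 \<in> D.regular (V1 \<inter> V2)"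
      using D.regular_scl[of "V1 \<inter> V2" \<gamma> \<phi>1] r(1) \<gamma>_reg by (auto simp: O.regular_def V1_def chart_def)
    then have "\<phi>2 = \<gamma> * \<phi>1"
    proof (rule inj[OF o(3) ne(3) r(2)])
      fix i assume i: "i < k + 1"
      have "f (V1 \<inter> V2) \<phi>2 i = ?q 2 (H i)"
        using res[OF o(2,3) ne(3) sub(2) \<phi>2(1) i] \<phi>2(2)[OF i] by simp
      also have "\<dots> = \<gamma> * f (V1 \<inter> V2) \<phi>1 i"
        using res[OF o(1,3) ne(3) sub(1) \<phi>1(1) i] \<phi>1(2)[OF i] by (simp add: \<gamma>q)
      also have "\<dots> = f (V1 \<inter> V2) (\<gamma> * \<phi>1) i"
        using scl[OF o(3) ne(3) r(1) \<gamma>_reg i] by simp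
      finally show "f (V1 \<inter> V2) \<phi>2 i = f (V1 \<inter> V2) (\<gamma> * \<phi>1) i" .
    qed
    from D.global_twisted_section[OF \<phi>1(1)[unfolded V1_def] \<phi>2(1)[unfolded V2_def] glued[OF this]]
    obtain G where G: "\<phi>1 = ?q 1 G" "\<phi>2 = ?q 2 G" by blast
    have GT: "G \<in> D.twisted_sections j"
      using \<phi>1(1) \<phi>2(1) G TS by simp
    moreover have "g G i = H i" if i: "i < k + 1" for i
      using g[OF GT i] \<phi>1(2)[OF i] G q_inj by metis
    ultimately show "\<exists>G\<in>D.twisted_sections j. \<forall>i<k + 1. g G i = H i"
      by blast
  qed
qed

end

context syz_chart
begin

theorem dim_fat_forms:
  assumes "splitting_type Z k P a"
  shows "int (vector_space.dim cmul (fat_forms Z j P (int (j + k)))) = (\<Sum>i<k + 1. max 0 (int j - a i + 1))"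
proof (rule iso_on_twisted_sections[OF assms, where j = j])
  fix g
  assume g_mem: "\<And>G i. G \<in> D.twisted_sections j \<Longrightarrow> i < k + 1 \<Longrightarrow> g G i \<in> forms (int j - a i) \<and> deg3_le 0 (g G i)"
    and g_add: "\<And>G G' i. G \<in> D.twisted_sections j \<Longrightarrow> G' \<in> D.twisted_sections j \<Longrightarrow> G + G' \<in> D.twisted_sections j \<Longrightarrow>
      i < k + 1 \<Longrightarrow> g (G + G') i = g G i + g G' i"
    and g_scl: "\<And>G c i. G \<in> D.twisted_sections j \<Longrightarrow> cmul c G \<in> D.twisted_sections j \<Longrightarrow> i < k + 1 \<Longrightarrow>
      g (cmul c G) i = cmul c (g G i)"
    and g_inj: "\<And>G G'. G \<in> D.twisted_sections j \<Longrightarrow> G' \<in> D.twisted_sections j \<Longrightarrow>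
      (\<And>i. i < k + 1 \<Longrightarrow> g G i = g G' i) \<Longrightarrow> G = G'"
    and g_surj: "\<And>H. (\<And>i. i < k + 1 \<Longrightarrow> H i \<in> forms (int j - a i) \<and> deg3_le 0 (H i)) \<Longrightarrow>
      \<exists>G\<in>D.twisted_sections j. \<forall>i<k + 1. g G i = H i"
  define V where "V = fat_forms Z j P (int (j + k))"
  define \<sigma> where "\<sigma> = hsub cst (dual_pt p)"
  define Bi where "Bi i = {m :: mono3. lookup m 3 = 0 \<and> int (mdeg m) = int j - a i}" for i
  define Bs where "Bs = Sigma {..<k + 1} Bi"
  have Bi: "finite (Bi i)" "int (card (Bi i)) = max 0 (int j - a i + 1)" for i
    using card_binary_monomials[of "int j - a i"] by (auto simp: Bi_def)
  have binary: "H \<in> forms (int j - a i) \<and> deg3_le 0 H \<longleftrightarrow> keys H \<subseteq> Bi i" for H i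
    by (auto simp: forms_def deg3_le_def Bi_def)
  interpret \<sigma>: ring_map \<sigma>
    unfolding \<sigma>_def by (intro ring_map.ring_map_hsub ring_map_cst)
  have \<sigma>_cmul: "\<sigma> (cmul c F) = cmul c (\<sigma> F)" for c F
    by (simp add: cmul_def \<sigma>.mult) (simp add: \<sigma>_def ring_map.hsub_cst ring_map_cst)
  have \<sigma>_inv: "hsub cst (\<lambda>i. lin (dual_coord_form p i)) (\<sigma> F) = F"
    "\<sigma> (hsub cst (\<lambda>i. lin (dual_coord_form p i)) F) = F" for F
    unfolding \<sigma>_def
    by (rule peval_eqI, simp add: peval_hsub_cst peval_lin dual_coord_form dual_pt_coord dual_coord_pt)+
  have V: "F \<in> V \<longleftrightarrow> \<sigma> F \<in> D.twisted_sections j" for F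
    unfolding V_def \<sigma>_def fat_forms_iff twisted_sections_D0 by simp
  have TS: "0 \<in> D.twisted_sections j" "\<And>G G'. G \<in> D.twisted_sections j \<Longrightarrow> G' \<in> D.twisted_sections j \<Longrightarrow> G + G' \<in> D.twisted_sections j"
    "\<And>G c. G \<in> D.twisted_sections j \<Longrightarrow> cmul c G \<in> D.twisted_sections j"
    unfolding twisted_sections_D0
    using deg3_le_mult[OF deg3_le_cst[of 0]]
    by (auto simp: forms_zero forms_add forms_cmul deg3_le_zero deg3_le_add peval_zero peval_add peval_cmul cmul_def peval_mult)
       (auto simp: cmul_def[symmetric] forms_cmul)
  have g0: "g 0 i = 0" if "i < k + 1" for i
    using g_scl[of 0 0 i] TS(1) that by (simp add: cmul_def)
  define \<Lambda> where "\<Lambda> F b = lookup (g (\<sigma> F) (fst b)) (snd b)" for F b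
  have "vector_space.dim cmul V = card Bs"
  proof (rule dim_eq_card_coordinates)
    interpret vector_space "cmul :: complex \<Rightarrow> poly3 \<Rightarrow> poly3" by (rule vector_space_cmul)
    show "subspace V"
      using TS by (intro subspaceI) (auto simp: V \<sigma>.zero \<sigma>.add \<sigma>_cmul)
    show "finite Bs"
      using Bi by (auto simp: Bs_def)
  next
    fix F G b assume "F \<in> V" "G \<in> V" "b \<in> Bs"
    then show "\<Lambda> (F + G) b = \<Lambda> F b + \<Lambda> G b"
      using TS(2) by (auto simp: \<Lambda>_def V \<sigma>.add g_add lookup_add Bs_def)
  next
    fix c F b assume "F \<in> V" "b \<in> Bs"
    then show "\<Lambda> (cmul c F) b = c * \<Lambda> F b"
      using TS(3) by (auto simp: \<Lambda>_def V \<sigma>_cmul g_scl lookup_cmul Bs_def)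
  next
    fix F assume F: "F \<in> V" and zero: "\<And>b. b \<in> Bs \<Longrightarrow> \<Lambda> F b = 0"
    have "\<sigma> F = 0"
    proof (rule g_inj)
      fix i assume i: "i < k + 1"
      have keys: "keys (g (\<sigma> F) i) \<subseteq> Bi i"
        using g_mem[of "\<sigma> F" i] F i binary by (simp add: V)
      have "lookup (g (\<sigma> F) i) m = 0" for m
      proof (cases "m \<in> Bi i")
        case True
        then show ?thesis
          using zero[of "(i, m)"] i by (simp add: \<Lambda>_def Bs_def)
      next
        case False
        then have "m \<notin> keys (g (\<sigma> F) i)"
          using keys by blast
        then show ?thesis
          by (simp add: in_keys_iff)
      qed
      then have "g (\<sigma> F) i = 0"
        by (intro poly_mapping_eqI) simp
      then show "g (\<sigma> F) i = g 0 i"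
        using g0[OF i] by simp
    qed (use F TS V in auto)
    then show "F = 0"
      using \<sigma>_inv(1)[of F] by (simp add: ring_map.hsub_zero ring_map_cst)
  next
    fix c :: "nat \<times> mono3 \<Rightarrow> complex"
    define H where "H i = (\<Sum>m\<in>Bi i. single m (c (i, m)))" for i
    have H: "lookup (H i) m = (if m \<in> Bi i then c (i, m) else 0)" for i m
      using Bi(1)[of i] by (simp add: H_def lookup_sum lookup_single when_def)
    have "keys (H i) \<subseteq> Bi i" for i
      by (auto simp: in_keys_iff H split: if_splits)
    then obtain G where G: "G \<in> D.twisted_sections j" "\<And>i. i < k + 1 \<Longrightarrow> g G i = H i"
      using g_surj[of H] binary by blast
    let ?F = "hsub cst (\<lambda>i. lin (dual_coord_form p i)) G"
    have "?F \<in> V"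
      using G(1) by (simp add: V \<sigma>_inv)
    moreover have "\<forall>b\<in>Bs. \<Lambda> ?F b = c b"
      using G(2) H by (auto simp: \<Lambda>_def \<sigma>_inv Bs_def)
    ultimately show "\<exists>F\<in>V. \<forall>b\<in>Bs. \<Lambda> F b = c b"
      by blast
  qed
  also have "card Bs = (\<Sum>i<k + 1. card (Bi i))"
    unfolding Bs_def using Bi(1) by (intro card_SigmaI) auto
  finally have "int (vector_space.dim cmul V) = (\<Sum>i<k + 1. int (card (Bi i)))"
    by simp
  then show ?thesis
    by (simp add: Bi(2) V_def)
qed

end

section \<open>General points\<close>

lemma generic_point:
  assumes "finite A" "0 \<notin> A"
  obtains U where "zariski_open U" "U \<noteq> {}" "\<And>P c. P \<in> U \<Longrightarrow> c \<in> A \<Longrightarrow> (\<Sum>i\<in>UNIV. c $ i * rep_proj2 P $ i) \<noteq> 0"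
proof -
  define h where "h = (\<Prod>c\<in>A. lin c)"
  have hf: "h \<in> forms (int (card A))"
    using forms_prod[of A lin "\<lambda>_. 1"] by (simp add: h_def forms_lin)
  have "lin c \<noteq> 0" if "c \<in> A" for c
    using assms(2) that by (intro lin_nonzero) blast
  then have "h * Var 1 \<noteq> 0"
    using assms(1) Var_nonzero by (simp add: h_def)
  then obtain v where v: "peval v (h * Var 1) \<noteq> 0"
    using peval_nonzero_ex by blast
  define u :: "complex ^ 3" where "u = (\<chi> i. v i)"
  have "u \<noteq> 0"
    using v by (auto simp: u_def peval_mult peval_Var vec_eq_iff)
  then obtain x b where x: "b \<noteq> 0" "rep_proj2 x = b *s u"
    by (rule proj2_of_vector)
  have "(($) (rep_proj2 x)) = (\<lambda>i. b * v i)"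
    by (simp add: fun_eq_iff x u_def)
  then have "ev h x = peval (\<lambda>i. b * v i) h"
    by (simp add: ev_def)
  also have "\<dots> = b ^ card A * peval v h"
    using peval_homogeneous_scale[OF hf] by simp
  finally have "ev h x \<noteq> 0"
    using v x(1) by (auto simp: peval_mult)
  then have ne: "{x. ev h x \<noteq> 0} \<noteq> {}"
    by blast
  show ?thesis
  proof (rule that[OF zariski_open_form[OF hf] ne])
    fix P c assume "P \<in> {x. ev h x \<noteq> 0}" "c \<in> A"
    then have "\<forall>c\<in>A. peval (($) (rep_proj2 P)) (lin c) \<noteq> 0"
      using assms(1) by (simp add: h_def ev_def peval_prod)
    then show "(\<Sum>i\<in>UNIV. c $ i * rep_proj2 P $ i) \<noteq> 0"
      using \<open>c \<in> A\<close> by (simp add: peval_lin)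
  qed
qed

definition cross :: "complex ^ 3 \<Rightarrow> complex ^ 3 \<Rightarrow> complex ^ 3" where
  "cross q r = vector [q $ 2 * r $ 3 - q $ 3 * r $ 2, q $ 3 * r $ 1 - q $ 1 * r $ 3, q $ 1 * r $ 2 - q $ 2 * r $ 1]"

lemma cross_nonzero:
  assumes "q \<noteq> 0" "\<And>c. r \<noteq> c *s q"
  shows "cross q r \<noteq> 0"
proof
  assume "cross q r = 0"
  then have e: "q $ 2 * r $ 3 = q $ 3 * r $ 2" "q $ 3 * r $ 1 = q $ 1 * r $ 3" "q $ 1 * r $ 2 = q $ 2 * r $ 1"
    by (auto simp: cross_def vec_eq_iff forall_3)
  obtain i where i: "q $ i \<noteq> 0"
    using assms(1) by (auto simp: vec_eq_iff)
  have "\<forall>i l. q $ i * r $ l = r $ i * q $ l"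
    unfolding forall_3 using e by (simp add: mult.commute)
  then have "r $ i / q $ i * q $ l = r $ l" for l
    using i by (metis nonzero_eq_divide_eq mult.commute times_divide_eq_left)
  then have "r = (r $ i / q $ i) *s q"
    by (simp add: vec_eq_iff)
  then show False
    using assms(2) by blast
qed

lemma dual_coord_cross:
  assumes "p $ 3 \<noteq> 0"
  shows "p $ 3 * (dual_coord p (($) q) 1 * dual_coord p (($) r) 2 - dual_coord p (($) q) 2 * dual_coord p (($) r) 1)
    = (\<Sum>i\<in>UNIV. cross q r $ i * p $ i)"
  using assms by (simp add: dual_coord_def cross_def sum_3 field_simps)

text \<open>A linear form that vanishes at \<open>q\<close> and witnesses \<open>q \<noteq> P\<close> by one of the first two parameters of \<open>q\<close>.\<close>
definition separating :: "complex ^ 3 \<Rightarrow> complex ^ 3" where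
  "separating q = (if q $ 2 = 0 \<and> q $ 3 = 0 then vector [q $ 3, 0, - q $ 1] else vector [0, - q $ 3, q $ 2])"

lemma separating_nonzero: "q \<noteq> 0 \<Longrightarrow> separating q \<noteq> 0"
  by (auto simp: separating_def vec_eq_iff forall_3)

lemma dual_coord_separating:
  assumes "p $ 3 \<noteq> 0" "(\<Sum>i\<in>UNIV. separating q $ i * p $ i) \<noteq> 0"
  shows "dual_coord p (($) q) 1 \<noteq> 0 \<or> dual_coord p (($) q) 2 \<noteq> 0"
  using assms by (auto simp: dual_coord_def separating_def sum_3 field_simps split: if_splits)

theorem lemma5p3:
  fixes k :: nat and Z :: "proj2 set"
  assumes "k \<ge> 1" and "finite Z"
  shows "\<exists>U. zariski_open U \<and> U \<noteq> {} \<and>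
    (\<forall>P\<in>U. \<forall>a :: nat \<Rightarrow> int. splitting_type Z k P a \<longrightarrow>
      (\<forall>j :: nat. int (vector_space.dim cmul (fat_forms Z j P (int (j + k)))) =
         (\<Sum>i<k + 1. max 0 (int j - a i + 1))))"
proof -
  \<comment> \<open>Each condition on \<open>P\<close> is the nonvanishing of a linear form: \<open>p\<^sub>3 \<noteq> 0\<close>, \<open>P \<noteq> Q\<close>, and \<open>P\<close> is not on
    the line through \<open>Q\<close> and \<open>Q'\<close>.\<close>
  define A where "A = insert (axis 3 1) (separating ` rep_proj2 ` Z \<union>
    (\<lambda>(Q, Q'). cross (rep_proj2 Q) (rep_proj2 Q')) ` (Z \<times> Z - Id))"
  have "finite A"
    using assms(2) by (simp add: A_def)
  moreover have "0 \<notin> A"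
    using separating_nonzero[OF rep_proj2_nonzero] cross_nonzero[OF rep_proj2_nonzero rep_proj2_not_proportional]
    by (fastforce simp: A_def axis_eq_0_iff)
  ultimately obtain U where U: "zariski_open U" "U \<noteq> {}"
    "\<And>P c. P \<in> U \<Longrightarrow> c \<in> A \<Longrightarrow> (\<Sum>i\<in>UNIV. c $ i * rep_proj2 P $ i) \<noteq> 0"
    using generic_point by metis
  have "syz_chart P (rep_proj2 P) Z k" if P: "P \<in> U" for P
  proof
    show p3: "rep_proj2 P $ 3 \<noteq> 0"
      using U(3)[OF P, of "axis 3 1"] by (simp add: A_def sum_axis_mult)
    show "dual_coord (rep_proj2 P) (($) (rep_proj2 Q)) 1 \<noteq> 0 \<or> dual_coord (rep_proj2 P) (($) (rep_proj2 Q)) 2 \<noteq> 0"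
      if "Q \<in> Z" for Q
      using U(3)[OF P, of "separating (rep_proj2 Q)"] that p3 by (intro dual_coord_separating) (auto simp: A_def)
    show "dual_coord (rep_proj2 P) (($) (rep_proj2 Q)) 1 * dual_coord (rep_proj2 P) (($) (rep_proj2 Q')) 2 \<noteq>
        dual_coord (rep_proj2 P) (($) (rep_proj2 Q)) 2 * dual_coord (rep_proj2 P) (($) (rep_proj2 Q')) 1"
      if "Q \<in> Z" "Q' \<in> Z" "Q \<noteq> Q'" for Q Q'
    proof -
      have "cross (rep_proj2 Q) (rep_proj2 Q') \<in> A"
        using that by (force simp: A_def)
      then show ?thesis
        using U(3)[OF P] dual_coord_cross[OF p3, of "rep_proj2 Q" "rep_proj2 Q'"] by auto
    qed
  qed (use assms in auto)
  then show ?thesis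
    using U(1,2) syz_chart.dim_fat_forms by blast
qed

end
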